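(* The decision problem ABF is reducible to the decision problem LC\&RP in polynomial time; that is, there is a polynomial-time computable map sending each ABF instance $(X,Y,\varphi)$ to an LC\&RP instance $(G,\ell)$ such that Player A has a winning strategy in the Alternating Boolean Formula game on $(X,Y,\varphi)$ if and only if $\ell$ cops have a winning strategy in the Lazy Cops and Robbers with protection game on $G$.
   Context: Alternating Boolean Formula game (ABF): players A and B are given disjoint sets $X$ and $Y$ of boolean variables, each with a prescribed initial value, and a boolean formula $\varphi$ in conjunctive normal form over $X\cup Y$. The players play alternately (starting with A), each on his turn changing the value of at most one of his own variables (A controls $X$, B controls $Y$). Player A wins if $\varphi$ ever becomes true; otherwise B wins. ABF is the problem of deciding whether Player A has a winning strategy. Lazy Cops and Robbers with protection: an instance consists of a finite reflexive undirected graph $G$ (every vertex has a loop) in which every edge (including loops) is designated protected or unprotected as part of the input, together with a positive integer $k$. The game is played by $k$ cops and one robber with perfect information: first the cops choose initial vertices, then the robber chooses his (possibly a vertex containing a cop). Play proceeds in rounds, each a cop turn followed by a robber turn; on a cop turn at most one cop moves, along an edge to an adjacent vertex (the cops collectively choose which one, if any), and on a robber turn the robber stays or moves to an adjacent vertex. The cops win only if some cop comes to occupy the robber's vertex by traveling along an unprotected edge (cops may also travel along protected edges, but cannot capture across them); the robber wins if this never happens. LC\&RP is the problem: given such $(G,k)$, do the $k$ cops have a winning strategy? *)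

theory Defs
  imports "HOL-Computational_Algebra.Polynomial"
begin

section \<open>Polynomial-time computability\<close>

text \<open>
  Deterministic multi-tape Turing machines with one-way infinite tapes. The tape alphabet is fixed;
  the number of tapes and of states is arbitrary. The states are \<open>0, \<dots>, nstates\<close>, where
  \<open>0\<close> is the start state and \<open>nstates\<close> is the halting state.
\<close>

datatype sym = Blank | Zero | One | Open | Close

datatype dir = MoveLeft | Stay | MoveRight

record tm =
  ntapes :: nat
  nstates :: nat
  delta :: "nat \<Rightarrow> sym list \<Rightarrow> nat \<times> (sym \<times> dir) list"

text \<open>There must be at least an input tape (tape 0) and an output tape (tape 1).\<close>

definition wf_tm :: "tm \<Rightarrow> bool" where
  "wf_tm M \<longleftrightarrow> 2 \<le> ntapes M \<and>
     (\<forall>q < nstates M. \<forall>ss. length ss = ntapes M \<longrightarrow>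
        fst (delta M q ss) \<le> nstates M \<and> length (snd (delta M q ss)) = ntapes M)"

text \<open>A tape together with its head position; moving left from cell 0 leaves the head in place.\<close>

type_synonym tape = "(nat \<Rightarrow> sym) \<times> nat"

type_synonym tm_config = "nat \<times> tape list"

fun move_head :: "dir \<Rightarrow> nat \<Rightarrow> nat" where
  "move_head MoveLeft h = h - 1"
| "move_head Stay h = h"
| "move_head MoveRight h = h + 1"

fun act :: "sym \<times> dir \<Rightarrow> tape \<Rightarrow> tape" where
  "act (s, d) (t, h) = (t(h := s), move_head d h)"

fun tm_step :: "tm \<Rightarrow> tm_config \<Rightarrow> tm_config" where
  "tm_step M (q, ts) =
     (if q < nstates M
      then let (q', as) = delta M q (map (\<lambda>(t, h). t h) ts) in (q', map2 act as ts)
      else (q, ts))"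

definition word_on_tape :: "sym list \<Rightarrow> nat \<Rightarrow> sym" where
  "word_on_tape w = (\<lambda>i. if i < length w then w ! i else Blank)"

definition tm_init :: "tm \<Rightarrow> sym list \<Rightarrow> tm_config" where
  "tm_init M w = (0, (word_on_tape w, 0) # replicate (ntapes M - 1) (word_on_tape [], 0))"

definition tm_outputs_within :: "tm \<Rightarrow> sym list \<Rightarrow> sym list \<Rightarrow> nat \<Rightarrow> bool" where
  "tm_outputs_within M w u T \<longleftrightarrow>
     (\<exists>n \<le> T. \<exists>ts. (tm_step M ^^ n) (tm_init M w) = (nstates M, ts) \<and>
        fst (ts ! 1) = word_on_tape u)"

text \<open>
  \<open>f\<close> is computable in polynomial time on the instances in \<open>D\<close>, with respect to the
  encodings \<open>e\<close> of its arguments and \<open>e'\<close> of its values.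
\<close>

definition poly_time_computable ::
    "('a \<Rightarrow> sym list) \<Rightarrow> ('b \<Rightarrow> sym list) \<Rightarrow> 'a set \<Rightarrow> ('a \<Rightarrow> 'b) \<Rightarrow> bool" where
  "poly_time_computable e e' D f \<longleftrightarrow>
     (\<exists>M (p :: nat poly). wf_tm M \<and>
        (\<forall>x \<in> D. tm_outputs_within M (e x) (e' (f x)) (poly p (length (e x)))))"

text \<open>
  Encodings: numbers are written in binary, least significant bit first; every number, list and
  tuple is enclosed in brackets, so that all encodings below are uniquely decodable.
\<close>

definition enc_list :: "('a \<Rightarrow> sym list) \<Rightarrow> 'a list \<Rightarrow> sym list" where
  "enc_list e xs = Open # concat (map e xs) @ [Close]"

definition enc_pair :: "('a \<Rightarrow> sym list) \<Rightarrow> ('b \<Rightarrow> sym list) \<Rightarrow> 'a \<times> 'b \<Rightarrow> sym list" where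
  "enc_pair e e' = (\<lambda>(x, y). Open # e x @ e' y @ [Close])"

definition enc_bool :: "bool \<Rightarrow> sym list" where
  "enc_bool b = [if b then One else Zero]"

fun binary :: "nat \<Rightarrow> bool list" where
  "binary n = (if n = 0 then [] else odd n # binary (n div 2))"

declare binary.simps [simp del]

definition enc_nat :: "nat \<Rightarrow> sym list" where
  "enc_nat n = enc_list enc_bool (binary n)"


section \<open>Winning strategies in alternating games\<close>

text \<open>
  Players 1 and 2 move alternately, player 1 first, and player 1 wants to reach a position
  satisfying \<open>goal\<close>. A strategy for player 1 maps the (nonempty) history of positions to the
  next position. A play is continued formally after the goal has been reached; in both games
  below every player always has a legal move.
\<close>

definition consistent_play ::
    "('p list \<Rightarrow> 'p) \<Rightarrow> ('p \<Rightarrow> 'p \<Rightarrow> bool) \<Rightarrow> 'p \<Rightarrow> (nat \<Rightarrow> 'p) \<Rightarrow> bool" where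
  "consistent_play \<sigma> mv2 s \<rho> \<longleftrightarrow> \<rho> 0 = s \<and>
     (\<forall>t. if even t then \<rho> (Suc t) = \<sigma> (map \<rho> [0..<Suc t]) else mv2 (\<rho> t) (\<rho> (Suc t)))"

definition winning_strategy ::
    "('p \<Rightarrow> 'p \<Rightarrow> bool) \<Rightarrow> ('p \<Rightarrow> 'p \<Rightarrow> bool) \<Rightarrow> ('p \<Rightarrow> bool) \<Rightarrow> 'p \<Rightarrow> ('p list \<Rightarrow> 'p) \<Rightarrow> bool" where
  "winning_strategy mv1 mv2 goal s \<sigma> \<longleftrightarrow>
     (\<forall>h. h \<noteq> [] \<longrightarrow> mv1 (last h) (\<sigma> h)) \<and>
     (\<forall>\<rho>. consistent_play \<sigma> mv2 s \<rho> \<longrightarrow> (\<exists>t. goal (\<rho> t)))"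


section \<open>The Alternating Boolean Formula game\<close>

text \<open>
  Variables are named by natural numbers. \<open>xvars\<close> and \<open>yvars\<close> list the variables of \<open>X\<close> and
  \<open>Y\<close> with their initial values. A literal is a variable with the value that makes it true; a
  formula in conjunctive normal form is a list of clauses, a clause being a list of literals.
\<close>

type_synonym literal = "nat \<times> bool"

type_synonym cnf = "literal list list"

type_synonym assignment = "nat \<Rightarrow> bool"

record abf =
  xvars :: "(nat \<times> bool) list"
  yvars :: "(nat \<times> bool) list"
  formula :: cnf

definition abf_X :: "abf \<Rightarrow> nat set" where
  "abf_X I = fst ` set (xvars I)"

definition abf_Y :: "abf \<Rightarrow> nat set" where
  "abf_Y I = fst ` set (yvars I)"

definition abf_instance :: "abf \<Rightarrow> bool" where
  "abf_instance I \<longleftrightarrow>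
     distinct (map fst (xvars I)) \<and> distinct (map fst (yvars I)) \<and> abf_X I \<inter> abf_Y I = {} \<and>
     (\<forall>C \<in> set (formula I). \<forall>(v, b) \<in> set C. v \<in> abf_X I \<union> abf_Y I)"

definition cnf_true :: "cnf \<Rightarrow> assignment \<Rightarrow> bool" where
  "cnf_true \<phi> \<alpha> \<longleftrightarrow> (\<forall>C \<in> set \<phi>. \<exists>(v, b) \<in> set C. \<alpha> v = b)"

definition initial_assignment :: "abf \<Rightarrow> assignment" where
  "initial_assignment I = (\<lambda>v. (v, True) \<in> set (xvars I) \<union> set (yvars I))"

definition change_at_most_one :: "nat set \<Rightarrow> assignment \<Rightarrow> assignment \<Rightarrow> bool" where
  "change_at_most_one Z \<alpha> \<alpha>' \<longleftrightarrow> \<alpha>' = \<alpha> \<or> (\<exists>v \<in> Z. \<exists>b. \<alpha>' = \<alpha>(v := b))"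

definition player_A_wins :: "abf \<Rightarrow> bool" where
  "player_A_wins I \<longleftrightarrow>
     (\<exists>\<sigma>. winning_strategy (change_at_most_one (abf_X I)) (change_at_most_one (abf_Y I))
            (cnf_true (formula I)) (initial_assignment I) \<sigma>)"

definition enc_abf :: "abf \<Rightarrow> sym list" where
  "enc_abf I =
     Open # enc_list (enc_pair enc_nat enc_bool) (xvars I)
          @ enc_list (enc_pair enc_nat enc_bool) (yvars I)
          @ enc_list (enc_list (enc_pair enc_nat enc_bool)) (formula I) @ [Close]"


section \<open>Lazy Cops and Robbers with protection\<close>

text \<open>
  Vertices are natural numbers. An undirected edge joining \<open>u\<close> and \<open>v\<close> is the set \<open>{u, v}\<close>,
  hence a loop at \<open>v\<close> is \<open>{v}\<close>. The lists are read as sets, and a pair \<open>(u, v)\<close> in an edge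
  list stands for the edge \<open>{u, v}\<close>.
\<close>

record lcrp =
  vertices :: "nat list"
  prot_edges :: "(nat \<times> nat) list"
  unprot_edges :: "(nat \<times> nat) list"
  num_cops :: nat

definition protected_edges :: "lcrp \<Rightarrow> nat set set" where
  "protected_edges G = (\<lambda>(u, v). {u, v}) ` set (prot_edges G)"

definition unprotected_edges :: "lcrp \<Rightarrow> nat set set" where
  "unprotected_edges G = (\<lambda>(u, v). {u, v}) ` set (unprot_edges G)"

definition edges :: "lcrp \<Rightarrow> nat set set" where
  "edges G = protected_edges G \<union> unprotected_edges G"

definition lcrp_instance :: "lcrp \<Rightarrow> bool" where
  "lcrp_instance G \<longleftrightarrow>
     vertices G \<noteq> [] \<and>
     (\<forall>e \<in> edges G. e \<subseteq> set (vertices G)) \<and>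
     (\<forall>v \<in> set (vertices G). {v} \<in> edges G) \<and>
     protected_edges G \<inter> unprotected_edges G = {} \<and>
     0 < num_cops G"

text \<open>
  A position consists of the vertices of the cops, the vertex of the robber, and a flag that
  records whether the robber has been captured.
\<close>

type_synonym lcrp_position = "nat list \<times> nat \<times> bool"

text \<open>
  Either no cop moves or one cop moves along an edge, possibly a loop. Capture happens only when
  a cop travels along an unprotected edge to the vertex of the robber; so a cop sharing the
  robber's vertex captures him there only by traversing an unprotected loop.
\<close>

fun cops_move :: "lcrp \<Rightarrow> lcrp_position \<Rightarrow> lcrp_position \<Rightarrow> bool" where
  "cops_move G (cs, r, cap) (cs', r', cap') \<longleftrightarrow> r' = r \<and>
     ((cs' = cs \<and> cap' = cap) \<or>
      (\<exists>i < length cs. \<exists>v. {cs ! i, v} \<in> edges G \<and> cs' = cs[i := v] \<and>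
         cap' = (cap \<or> (v = r \<and> {cs ! i, v} \<in> unprotected_edges G))))"

fun robber_move :: "lcrp \<Rightarrow> lcrp_position \<Rightarrow> lcrp_position \<Rightarrow> bool" where
  "robber_move G (cs, r, cap) (cs', r', cap') \<longleftrightarrow>
     cs' = cs \<and> cap' = cap \<and> (r' = r \<or> {r, r'} \<in> edges G)"

fun captured :: "lcrp_position \<Rightarrow> bool" where
  "captured (cs, r, cap) = cap"

definition cops_win :: "lcrp \<Rightarrow> bool" where
  "cops_win G \<longleftrightarrow>
     (\<exists>cs \<sigma>. length cs = num_cops G \<and> set cs \<subseteq> set (vertices G) \<and>
        (\<forall>r \<in> set (vertices G).
           winning_strategy (cops_move G) (robber_move G) captured (cs, r, False) \<sigma>))"

definition enc_lcrp :: "lcrp \<Rightarrow> sym list" where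
  "enc_lcrp G =
     Open # enc_list enc_nat (vertices G)
          @ enc_list (enc_pair enc_nat enc_nat) (prot_edges G)
          @ enc_list (enc_pair enc_nat enc_nat) (unprot_edges G)
          @ enc_nat (num_cops G) @ [Close]"

end

theory Submission
  imports Defs
begin

text \<open>
  There is one cop for every variable, and one more, the judge. The cop of \<open>v\<close> stands on \<open>Lit v b\<close> if
  \<open>v\<close> has the value \<open>b\<close>. As long as nobody cheats, the judge waits on \<open>K0\<close> and the robber on \<open>R3\<close>. In
  a cops' turn some cop of a variable in \<open>X\<close> may change its value. To set \<open>y \<in> Y\<close> to \<open>b\<close>, the
  robber goes to \<open>Ask y b\<close>, where he threatens to escape to \<open>Esc y b\<close>; so the cop of \<open>y\<close> moves to \<open>Mid y\<close>.
  The robber then goes to \<open>Put y b\<close>, which forces that cop to finish the move, and back to \<open>R3\<close>. At any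
  time the judge may move to \<open>KX\<close>. Then the robber has to flee to a clause, and he is captured there
  iff the clause has a true literal. A cop on \<open>Mid y\<close> attacks all clauses, so the robber cannot return
  to \<open>R3\<close> before the value is set.

  If the cops cheat, some vertex \<open>Gate\<close>, \<open>Esc\<close> or \<open>Dock\<close> or a clause is not attacked, and from there the
  robber reaches the havens. \<open>Haven v\<close> is attacked only from the initial place of the cop of \<open>v\<close>, and
  \<open>HavenK\<close> only from \<open>K0\<close>, \<open>K1\<close>, \<open>K2\<close>. By counting the cops, all havens are attacked only if the cops
  show the initial assignment, and in this case the game starts again. The vertices \<open>R0\<close>, \<dots>, \<open>R5\<close>
  form a double cover of the triangle \<open>K0\<close>, \<open>K1\<close>, \<open>K2\<close>: the judge attacks those of them whose index
  is not congruent to his own modulo 3. A robber in the havens returns to \<open>R0\<close>, and one tour of the judge around the triangle drives him to \<open>R3\<close>, from which the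
  havens are not adjacent. This is what makes it possible that the havens are accessible from the
  starting position but not during the game.

  The reduction is computed by a program with four read-only heads on copies of the input. If such a
  program halts, it does not repeat a configuration, hence its running time is polynomial.
\<close>

section \<open>Winning positions\<close>

text \<open>Capture needs an unprotected edge, and edges between two of the robber's vertices are
  protected. So a cop who leaves the places meant for cops attacks none of the robber's vertices,
  not even one he shares with him: straying only weakens the cops. The game thus reduces to the
  robber's task of always stepping to an unattacked vertex. The cops choose their first places
  freely, so every placement except the initial assignment must be punishable, yet this punishment
  must not be available once A has changed a value. \<open>R3\<close> resolves the conflict: it is
  the only vertex of the hexagon without a haven next to it, and its neighbours that lead back to
  the havens are guarded exactly while the cops behave. Vertices of flight are joined at least to
  \<open>R0\<close>, \<open>R1\<close>, \<open>R5\<close>, whose indices differ modulo 3, so that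
  one of them is free wherever the judge stands on the triangle. \<open>Ask\<close> and
  \<open>Put\<close> have \<open>R3\<close> in place of \<open>R0\<close>, because \<open>R0\<close>
  is next to the havens.\<close>

inductive wins :: "('p \<Rightarrow> 'p \<Rightarrow> bool) \<Rightarrow> ('p \<Rightarrow> 'p \<Rightarrow> bool) \<Rightarrow> ('p \<Rightarrow> bool) \<Rightarrow> 'p \<Rightarrow> bool"
  for mv1 mv2 goal where
  wins_goal: "goal s \<Longrightarrow> wins mv1 mv2 goal s"
| wins_move_goal: "mv1 s s' \<Longrightarrow> goal s' \<Longrightarrow> wins mv1 mv2 goal s"
| wins_move: "mv1 s s' \<Longrightarrow> (\<And>s''. mv2 s' s'' \<Longrightarrow> wins mv1 mv2 goal s'') \<Longrightarrow> wins mv1 mv2 goal s"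

text \<open>Outside the attractor \<open>wins\<close>, every move of player 1 misses the goal and
  leaves player 2 a reply that is again outside; otherwise \<open>wins_move_goal\<close> or
  \<open>wins_move\<close> would apply. Such replies against \<open>\<sigma>\<close> give a
  consistent play that never meets the goal. \<open>wins_move_goal\<close> covers a goal that may
  hold only while player 2 is to move.\<close>

lemma winning_strategy_imp_wins:
  assumes "winning_strategy mv1 mv2 goal s \<sigma>"
  shows "wins mv1 mv2 goal s"
proof (rule ccontr)
  assume s: "\<not> wins mv1 mv2 goal s"
  let ?W = "wins mv1 mv2 goal"
  have legal: "mv1 (last h) (\<sigma> h)" if "h \<noteq> []" for h
    using assms that by (simp add: winning_strategy_def)
  define nxt where "nxt t h = (if even t then \<sigma> h else SOME s''. mv2 (last h) s'' \<and> \<not> ?W s'')" for t :: nat and h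
  \<comment> \<open>\<open>\<sigma>\<close> sees the whole history, so the recursion builds
    histories, and \<open>\<rho>\<close> reads off their last entries.\<close>
  define H where "H = rec_nat [s] (\<lambda>t h. h @ [nxt t h])"
  define \<rho> where "\<rho> t = last (H t)" for t
  have H0: "H 0 = [s]" and HS: "H (Suc t) = H t @ [nxt t (H t)]" for t
    by (simp_all add: H_def)
  have \<rho>S: "\<rho> (Suc t) = nxt t (H t)" for t
    by (simp add: \<rho>_def HS)
  have Hm: "H t = map \<rho> [0..<Suc t]" for t
    by (induction t) (simp_all add: H0 HS \<rho>S, simp add: \<rho>_def H0)
  have Hne: "H t \<noteq> []" for t by (simp add: Hm)
  have inv: "if even t then \<not> ?W (\<rho> t) else \<not> goal (\<rho> t) \<and> (\<exists>s''. mv2 (\<rho> t) s'' \<and> \<not> ?W s'')" for t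
  proof (induction t)
    case 0 then show ?case using s by (simp add: \<rho>_def H0)
  next
    case (Suc t)
    show ?case
    proof (cases "even t")
      case True
      have "mv1 (\<rho> t) (\<rho> (Suc t))" using legal[OF Hne[of t]] True by (simp add: \<rho>S nxt_def flip: \<rho>_def)
      moreover have "\<not> ?W (\<rho> t)" using Suc True by simp
      ultimately show ?thesis using True wins_move_goal[of mv1 "\<rho> t" "\<rho> (Suc t)" goal mv2]
          wins_move[of mv1 "\<rho> t" "\<rho> (Suc t)" mv2 goal] by auto
    next
      case False
      with Suc have "\<exists>s''. mv2 (last (H t)) s'' \<and> \<not> ?W s''" by (simp add: \<rho>_def)
      from someI_ex[OF this] have "\<not> ?W (nxt t (H t))" using False by (simp add: nxt_def)
      then show ?thesis using False by (simp add: \<rho>S)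
    qed
  qed
  have "consistent_play \<sigma> mv2 s \<rho>"
    unfolding consistent_play_def
  proof (intro conjI allI)
    show "\<rho> 0 = s" by (simp add: \<rho>_def H0)
    fix t
    show "if even t then \<rho> (Suc t) = \<sigma> (map \<rho> [0..<Suc t]) else mv2 (\<rho> t) (\<rho> (Suc t))"
    proof (cases "even t")
      case True then show ?thesis by (simp only: \<rho>S nxt_def Hm if_True)
    next
      case False
      with inv[of t] have "\<exists>s''. mv2 (last (H t)) s'' \<and> \<not> ?W s''" by (simp add: \<rho>_def)
      from someI_ex[OF this] show ?thesis using False by (simp add: \<rho>S nxt_def, simp add: \<rho>_def)
    qed
  qed
  then obtain t where "goal (\<rho> t)" using assms by (auto simp: winning_strategy_def)
  then show False using inv[of t] wins_goal[of goal "\<rho> t" mv1 mv2] by (auto split: if_splits)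
qed

text \<open>The strategy obtained from a derivation plays the chosen move and then follows, on the history
  without its first two positions, the strategy for the position the opponent moved to.\<close>

lemma wins_imp_winning_strategy:
  assumes refl: "\<And>s. mv1 s s"
  assumes "wins mv1 mv2 goal s"
  shows "\<exists>\<sigma>. winning_strategy mv1 mv2 goal s \<sigma>"
  using assms(2)
proof induction
  case (wins_goal s)
  then have "winning_strategy mv1 mv2 goal s last"
    by (auto simp: winning_strategy_def refl consistent_play_def)
  then show ?case by blast
next
  case (wins_move_goal s s')
  let ?\<sigma> = "\<lambda>h. if h = [s] then s' else last h"
  have "winning_strategy mv1 mv2 goal s ?\<sigma>"
    unfolding winning_strategy_def
  proof (intro conjI allI impI)
    fix \<rho> assume \<rho>: "consistent_play ?\<sigma> mv2 s \<rho>"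
    have "\<rho> (Suc 0) = s'" using spec[OF conjunct2[OF \<rho>[unfolded consistent_play_def]], of 0]
      conjunct1[OF \<rho>[unfolded consistent_play_def]] by simp
    then show "\<exists>t. goal (\<rho> t)" using wins_move_goal(2) by metis
  qed (use refl wins_move_goal in auto)
  then show ?case by blast
next
  case (wins_move s s')
  then obtain \<tau> where \<tau>: "\<And>s''. mv2 s' s'' \<Longrightarrow> winning_strategy mv1 mv2 goal s'' (\<tau> s'')"
    by metis
  \<comment> \<open>Histories that do not fit the plan are answered by \<open>last h\<close>, that
    is by passing, which \<open>refl\<close> makes legal.\<close>
  let ?\<sigma> = "\<lambda>h. if h = [s] then s'
      else if 3 \<le> length h \<and> mv2 s' (h ! 2) then \<tau> (h ! 2) (drop 2 h) else last h"
  have "winning_strategy mv1 mv2 goal s ?\<sigma>"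
    unfolding winning_strategy_def
  proof (intro conjI allI impI)
    fix h :: "'a list" assume "h \<noteq> []"
    have "mv1 (last h) (\<tau> (h ! 2) (drop 2 h))" if "3 \<le> length h" "mv2 s' (h ! 2)"
    proof -
      have "drop 2 h \<noteq> []" using that(1) by auto
      moreover have "last (drop 2 h) = last h" using that(1) by auto
      ultimately show ?thesis using \<tau>[OF that(2)] by (metis winning_strategy_def)
    qed
    then show "mv1 (last h) (?\<sigma> h)" using refl wins_move(1) by auto
  next
    fix \<rho> assume \<rho>: "consistent_play ?\<sigma> mv2 s \<rho>"
    have 0: "\<rho> 0 = s" and st: "\<And>t. if even t then \<rho> (Suc t) = ?\<sigma> (map \<rho> [0..<Suc t]) else mv2 (\<rho> t) (\<rho> (Suc t))"
      using \<rho> by (auto simp: consistent_play_def)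
    have 1: "\<rho> 1 = s'" using st[of 0] 0 by simp
    have odd_st: "mv2 (\<rho> t) (\<rho> (Suc t))" if "odd t" for t
      using st[of t] that by simp
    have 2: "mv2 s' (\<rho> 2)" using odd_st[of 1] 1 by (simp add: numeral_2_eq_2)
    have even_st: "\<rho> (Suc (t + 2)) = \<tau> (\<rho> 2) (map (\<lambda>t. \<rho> (t + 2)) [0..<Suc t])" if "even t" for t
    proof -
      define h where "h = map \<rho> [0..<Suc (t + 2)]"
      have len: "length h = t + 3" by (simp add: h_def)
      have nth: "h ! i = \<rho> i" if "i < t + 3" for i
        using that unfolding h_def by (subst nth_map) (simp_all del: upt_Suc)
      have dr: "drop 2 h = map (\<lambda>t. \<rho> (t + 2)) [0..<Suc t]"
      proof (rule nth_equalityI)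
        fix i assume "i < length (drop 2 h)"
        then have i: "i < Suc t" using len by simp
        have "drop 2 h ! i = h ! (2 + i)" using len by (simp add: nth_drop)
        also have "\<dots> = \<rho> (i + 2)" using i by (subst nth) (simp_all add: add.commute)
        finally show "drop 2 h ! i = map (\<lambda>t. \<rho> (t + 2)) [0..<Suc t] ! i"
          using i by (subst nth_map) (simp_all del: upt_Suc)
      qed (simp add: len)
      have ne: "h \<noteq> [s]" using len by auto
      have "\<rho> (Suc (t + 2)) = ?\<sigma> h" using st[of "t + 2"] that unfolding h_def by simp
      also have "\<dots> = \<tau> (\<rho> 2) (drop 2 h)" using ne len 2 by (simp add: nth)
      finally show ?thesis unfolding dr .
    qed
    have "consistent_play (\<tau> (\<rho> 2)) mv2 (\<rho> 2) (\<lambda>t. \<rho> (t + 2))"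
      unfolding consistent_play_def
    proof (intro conjI allI)
      fix t
      show "if even t then \<rho> (Suc t + 2) = \<tau> (\<rho> 2) (map (\<lambda>t. \<rho> (t + 2)) [0..<Suc t])
          else mv2 (\<rho> (t + 2)) (\<rho> (Suc t + 2))"
      proof (cases "even t")
        case True then show ?thesis using even_st[OF True] by (simp del: upt_Suc)
      next
        case False then show ?thesis using odd_st[of "t + 2"] by simp
      qed
    qed (simp add: numeral_2_eq_2)
    then show "\<exists>t. goal (\<rho> t)" using \<tau>[OF 2] by (auto simp: winning_strategy_def)
  qed
  then show ?case by blast
qed

text \<open>\<open>cops_win\<close> asks for one strategy that serves all initial vertices of the
  robber. A history begins with the initial position, so strategies for single positions can be
  merged by looking at \<open>hd h\<close>.\<close>

lemma wins_uniform_strategy: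
  assumes refl: "\<And>s. mv1 s s"
  shows "\<exists>\<sigma>. \<forall>s. wins mv1 mv2 goal s \<longrightarrow> winning_strategy mv1 mv2 goal s \<sigma>"
proof -
  have "\<forall>s. \<exists>\<sigma>. wins mv1 mv2 goal s \<longrightarrow> winning_strategy mv1 mv2 goal s \<sigma>"
    using wins_imp_winning_strategy[where ?mv1.0 = mv1] refl by blast
  from choice[OF this] obtain \<tau>
    where \<tau>: "\<And>s. wins mv1 mv2 goal s \<Longrightarrow> winning_strategy mv1 mv2 goal s (\<tau> s)" by blast
  let ?\<sigma> = "\<lambda>h. if wins mv1 mv2 goal (hd h) then \<tau> (hd h) h else last h"
  have "winning_strategy mv1 mv2 goal s ?\<sigma>" if "wins mv1 mv2 goal s" for s
    unfolding winning_strategy_def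
  proof (intro conjI allI impI)
    fix h :: "'a list" assume "h \<noteq> []"
    then show "mv1 (last h) (?\<sigma> h)" using \<tau>[of "hd h"] refl by (auto simp: winning_strategy_def)
  next
    fix \<rho> assume "consistent_play ?\<sigma> mv2 s \<rho>"
    moreover have "hd (map \<rho> [0..<Suc t]) = \<rho> 0" for t
      by (simp add: upt_conv_Cons del: upt_Suc)
    ultimately have "consistent_play (\<tau> s) mv2 s \<rho>"
      using that unfolding consistent_play_def by simp
    then show "\<exists>t. goal (\<rho> t)" using \<tau>[OF that] by (auto simp: winning_strategy_def)
  qed
  then show ?thesis by blast
qed

text \<open>The proof method for player 2. A derivation of \<open>wins\<close> is well founded, and
  each rule would either meet the goal or admit a reply inside \<open>Inv\<close>; no strategy for
  player 2 has to be constructed.\<close>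

lemma not_wins_coinduct:
  assumes "Inv s"
    and "\<And>s. Inv s \<Longrightarrow> \<not> goal s"
    and "\<And>s s'. Inv s \<Longrightarrow> mv1 s s' \<Longrightarrow> \<not> goal s' \<and> (\<exists>s''. mv2 s' s'' \<and> Inv s'')"
  shows "\<not> wins mv1 mv2 goal s"
proof
  assume "wins mv1 mv2 goal s"
  then show False using assms(1)
    by induction (use assms(2,3) in blast)+
qed

section \<open>The graph\<close>

text \<open>Cops are meant to stand on \<open>K0\<close>, \<open>K1\<close>, \<open>K2\<close>, \<open>KX\<close>, \<open>Lit\<close> and \<open>Mid\<close>, the robber on all other
  vertices. The unprotected edges are those with an end of the first kind. The value \<open>b\<close> in \<open>Var k v b\<close> is always
  \<open>True\<close> if \<open>k\<close> is one of \<open>Mid\<close>, \<open>Gate\<close>, \<open>Haven\<close>, \<open>Dock\<close>.\<close>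

datatype spot = K0 | K1 | K2 | KX | R0 | R1 | R2 | R3 | R4 | R5 | HavenK | GateK

datatype kind = Lit | Mid | Gate | Haven | Dock | Esc | Ask | Put

datatype vert = Con spot | Var kind nat bool | Clause nat

text \<open>The graph is composed of lists, in the order in which the transducer writes them. The
  same functions serve there as templates, with the number of a head in place of the name of a
  variable.\<close>

definition spot_verts :: "vert list" where
  "spot_verts = map Con [K0, K1, K2, KX, R0, R1, R2, R3, R4, R5, HavenK, GateK]"

fun x_verts :: "nat \<times> bool \<Rightarrow> vert list" where
  "x_verts (v, b) = [Var Lit v True, Var Lit v False, Var Gate v True, Var Haven v True]"

fun y_verts :: "nat \<times> bool \<Rightarrow> vert list" where
  "y_verts (v, b) = x_verts (v, b) @ [Var Mid v True, Var Dock v True, Var Esc v True,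
     Var Esc v False, Var Ask v True, Var Ask v False, Var Put v True, Var Put v False]"

definition star :: "'a \<Rightarrow> 'a list \<Rightarrow> ('a \<times> 'a) list" where
  "star a bs = map (Pair a) bs"

definition spot_prot :: "(vert \<times> vert) list" where
  "spot_prot =
     star (Con R0) (map Con [R0, R1]) @ star (Con R1) (map Con [R1, R2]) @
     star (Con R2) (map Con [R2, R3]) @ star (Con R3) (map Con [R3, R4, GateK]) @
     star (Con R4) (map Con [R4, R5]) @ star (Con R5) (map Con [R5, R0]) @
     star (Con HavenK) (map Con [HavenK, R0, R1, R2, R4, R5]) @
     star (Con GateK) (map Con [GateK, R0, R1, R5, HavenK])"

fun x_prot :: "nat \<times> bool \<Rightarrow> (vert \<times> vert) list" where
  "x_prot (v, b) =
     star (Var Gate v True) (Var Gate v True # map Con [R3, R0, R1, R5, HavenK]) @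
     star (Var Haven v True) (Var Haven v True # map Con [R0, R1, R2, R4, R5, HavenK, GateK])"

fun y_prot :: "nat \<times> bool \<Rightarrow> (vert \<times> vert) list" where
  "y_prot (v, b) = x_prot (v, b) @
     star (Var Dock v True) (Var Dock v True # map Con [R0, R1, R5, HavenK]) @
     concat (map (\<lambda>c.
       star (Var Esc v c) (Var Esc v c # map Con [R0, R1, R5, HavenK]) @
       star (Var Ask v c) (Var Ask v c # Var Put v c # Var Esc v c # map Con [R3, GateK, R1, R5]) @
       star (Var Put v c) (Var Put v c # Var Dock v True # map Con [R3, GateK, R1, R5]))
     [True, False])"

fun xv_prot :: "nat \<times> bool \<Rightarrow> nat \<times> bool \<Rightarrow> (vert \<times> vert) list" where
  "xv_prot (v, b) (v', b') =
     [(Var Gate v True, Var Haven v' True), (Var Haven v True, Var Haven v' True)]"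

fun yv_prot :: "nat \<times> bool \<Rightarrow> nat \<times> bool \<Rightarrow> (vert \<times> vert) list" where
  "yv_prot (v, b) (v', b') = xv_prot (v, b) (v', b') @
     [(Var Dock v True, Var Haven v' True), (Var Esc v True, Var Haven v' True),
      (Var Esc v False, Var Haven v' True)]"

fun xc_prot :: "nat \<times> bool \<Rightarrow> nat \<Rightarrow> (vert \<times> vert) list" where
  "xc_prot (v, b) j = [(Var Haven v True, Clause j)]"

fun yc_prot :: "nat \<times> bool \<Rightarrow> nat \<Rightarrow> (vert \<times> vert) list" where
  "yc_prot (v, b) j =
     [(Var Haven v True, Clause j), (Var Ask v True, Clause j), (Var Ask v False, Clause j)]"

definition c_prot :: "nat \<Rightarrow> (vert \<times> vert) list" where
  "c_prot j = star (Clause j) (Clause j # map Con [R3, R0, R1, R5, HavenK])"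

definition spot_unprot :: "(vert \<times> vert) list" where
  "spot_unprot =
     star (Con K0) (map Con [K0, K1, K2, KX]) @ star (Con K1) (map Con [K1, K2, KX]) @
     star (Con K2) (map Con [K2, KX]) @ star (Con KX) (map Con [KX]) @
     star (Con R0) (map Con [K1, K2, KX]) @ star (Con R1) (map Con [K0, K2, KX]) @
     star (Con R2) (map Con [K0, K1, KX]) @ star (Con R3) (map Con [K1, K2, KX]) @
     star (Con R4) (map Con [K0, K2, KX]) @ star (Con R5) (map Con [K0, K1, KX]) @
     star (Con HavenK) (map Con [K0, K1, K2]) @ star (Con GateK) (map Con [K0, K1, K2, KX])"

fun v_unprot :: "nat \<times> bool \<Rightarrow> (vert \<times> vert) list" where
  "v_unprot (v, b) =
     star (Var Lit v True) [Var Lit v True, Con K0] @ star (Var Lit v False) [Var Lit v False, Con K0] @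
     star (Var Gate v True) (Var Lit v True # Var Lit v False # map Con [K1, K2, KX])"

text \<open>Only here does the initial value enter the graph: the other functions of an entry of
  \<open>xvars\<close> or \<open>yvars\<close> ignore it. The edge makes the initial place of the
  cop of \<open>v\<close> the only vertex that attacks this haven.\<close>

fun own_unprot :: "nat \<times> bool \<Rightarrow> (vert \<times> vert) list" where
  "own_unprot (v, b) = [(Var Haven v True, Var Lit v b)]"

fun x_unprot :: "nat \<times> bool \<Rightarrow> (vert \<times> vert) list" where
  "x_unprot (v, b) = v_unprot (v, b) @ [(Var Lit v True, Var Lit v False)]"

fun y_unprot :: "nat \<times> bool \<Rightarrow> (vert \<times> vert) list" where
  "y_unprot (v, b) = v_unprot (v, b) @
     star (Var Mid v True) [Var Mid v True, Con K0, Var Lit v True, Var Lit v False] @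
     star (Var Dock v True) (Var Lit v True # Var Lit v False # map Con [K1, K2]) @
     concat (map (\<lambda>c.
       star (Var Esc v c) (Var Mid v True # Var Lit v c # map Con [K1, K2, KX]) @
       star (Var Ask v c) (map Con [K1, K2, KX]) @ star (Var Put v c) (map Con [K1, K2, KX]))
     [True, False])"

fun yc_unprot :: "nat \<times> bool \<Rightarrow> nat \<Rightarrow> (vert \<times> vert) list" where
  "yc_unprot (v, b) j = [(Clause j, Var Mid v True)]"

definition c_unprot :: "nat \<Rightarrow> (vert \<times> vert) list" where
  "c_unprot j = star (Clause j) (map Con [K0, K1, K2])"

fun lc_unprot :: "nat \<times> bool \<Rightarrow> nat \<Rightarrow> (vert \<times> vert) list" where
  "lc_unprot (v, b) j = [(Clause j, Var Lit v b)]"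

definition for_vars :: "abf \<Rightarrow> (nat \<times> bool \<Rightarrow> 'a list) \<Rightarrow> (nat \<times> bool \<Rightarrow> 'a list) \<Rightarrow> 'a list" where
  "for_vars I f g = concat (map f (xvars I)) @ concat (map g (yvars I))"

definition for_clauses :: "abf \<Rightarrow> (nat \<Rightarrow> 'a list) \<Rightarrow> (nat \<times> bool \<Rightarrow> nat \<Rightarrow> 'a list) \<Rightarrow> 'a list" where
  "for_clauses I f g = concat (map (\<lambda>j. f j @ concat (map (\<lambda>l. g l j) (formula I ! j))) [0..<length (formula I)])"

definition vert_list :: "abf \<Rightarrow> vert list" where
  "vert_list I = spot_verts @ for_vars I x_verts y_verts @ for_clauses I (\<lambda>j. [Clause j]) (\<lambda>l j. [])"

definition prot_list :: "abf \<Rightarrow> (vert \<times> vert) list" where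
  "prot_list I = spot_prot @
     for_vars I
       (\<lambda>p. x_prot p @ for_vars I (xv_prot p) (xv_prot p) @ for_clauses I (xc_prot p) (\<lambda>l j. []))
       (\<lambda>p. y_prot p @ for_vars I (yv_prot p) (yv_prot p) @ for_clauses I (yc_prot p) (\<lambda>l j. [])) @
     for_clauses I c_prot (\<lambda>l j. [])"

definition unprot_list :: "abf \<Rightarrow> (vert \<times> vert) list" where
  "unprot_list I = spot_unprot @
     for_vars I (\<lambda>p. x_unprot p @ own_unprot p)
       (\<lambda>p. y_unprot p @ own_unprot p @ for_clauses I (yc_unprot p) (\<lambda>l j. [])) @
     for_clauses I c_unprot lc_unprot"

primrec spot_index :: "spot \<Rightarrow> nat" where
  "spot_index K0 = 0" | "spot_index K1 = 1" | "spot_index K2 = 2" | "spot_index KX = 3"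
| "spot_index R0 = 4" | "spot_index R1 = 5" | "spot_index R2 = 6" | "spot_index R3 = 7"
| "spot_index R4 = 8" | "spot_index R5 = 9" | "spot_index HavenK = 10" | "spot_index GateK = 11"

primrec kind_index :: "kind \<Rightarrow> nat" where
  "kind_index Lit = 12" | "kind_index Mid = 13" | "kind_index Gate = 14" | "kind_index Haven = 15"
| "kind_index Dock = 16" | "kind_index Esc = 17" | "kind_index Ask = 18" | "kind_index Put = 19"

text \<open>Unary with a terminator: strings with different tags differ already within the tag. Tags
  0 to 11 are the spots, 12 to 19 the kinds, and 20 the clauses.\<close>

definition tag_bits :: "nat \<Rightarrow> bool list" where
  "tag_bits n = replicate n True @ [False]"

text \<open>The last bit is set because the binary representation of a number has no leading zeros.\<close>

primrec vert_bits :: "vert \<Rightarrow> bool list" where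
  "vert_bits (Con s) = tag_bits (spot_index s) @ [True, True]"
| "vert_bits (Var k v b) = tag_bits (kind_index k) @ binary v @ [b, True]"
| "vert_bits (Clause j) = tag_bits 20 @ replicate j True @ [True, True]"

text \<open>The number is given by its digits so that the transducer can write it without
  arithmetic, copying the name of a variable from the input. The index of a clause is in unary
  because the transducer has it only as a head position.\<close>

definition vert_num :: "vert \<Rightarrow> nat" where
  "vert_num x = horner_sum of_bool 2 (vert_bits x)"

definition reduction :: "abf \<Rightarrow> lcrp" where
  "reduction I = \<lparr>vertices = map vert_num (vert_list I),
     prot_edges = map (map_prod vert_num vert_num) (prot_list I),
     unprot_edges = map (map_prod vert_num vert_num) (unprot_list I),
     num_cops = length (xvars I) + length (yvars I) + 1\<rparr>"

section \<open>Vertex numbers and their digits\<close>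

lemma horner_sum_binary: "horner_sum of_bool 2 (binary n) = n"
proof (induction n rule: binary.induct)
  case (1 n)
  then show ?case by (cases "n = 0") (auto simp: binary.simps[of n] binary.simps[of 0] elim: oddE)
qed

lemma binary_horner_sum: "binary (horner_sum of_bool 2 (bs @ [True])) = bs @ [True]"
proof (induction bs)
  case Nil
  then show ?case by (simp add: binary.simps)
next
  case (Cons b bs)
  let ?n = "horner_sum of_bool 2 (bs @ [True]) :: nat"
  have "?n \<noteq> 0" using Cons by (metis binary.simps snoc_eq_iff_butlast)
  then show ?case using Cons by (subst binary.simps) simp
qed

lemma binary_vert_num: "binary (vert_num x) = vert_bits x"
proof -
  obtain bs where "vert_bits x = bs @ [True]"
    by (cases x) (auto simp: tag_bits_def)
  then show ?thesis by (simp only: vert_num_def binary_horner_sum)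
qed

lemma replicate_True_False_eq:
  "replicate m True @ False # xs = replicate n True @ False # ys \<longleftrightarrow> m = n \<and> xs = ys"
  by (induction m arbitrary: n; case_tac n) auto

lemma vert_bits_inj: "vert_bits x = vert_bits y \<longleftrightarrow> x = y"
proof -
  have s: "spot_index s < 12" "spot_index s = spot_index s' \<longleftrightarrow> s = s'" for s s'
    by (cases s; cases s'; simp)+
  have k: "kind_index k < 20" "\<not> kind_index k < 12" "kind_index k = kind_index k' \<longleftrightarrow> k = k'" for k k'
    by (cases k; cases k'; simp)+
  have b: "binary n = binary m \<longleftrightarrow> n = m" for n m
    by (metis horner_sum_binary)
  have sk: "spot_index s \<noteq> kind_index k" "spot_index s \<noteq> 20" "kind_index k \<noteq> 20" for s k
    using s(1)[of s] k(1,2)[of k] by auto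
  show ?thesis
    by (cases x; cases y) (auto simp: tag_bits_def replicate_True_False_eq s k b sk sk[symmetric])
qed

lemma vert_num_inj [simp]: "vert_num x = vert_num y \<longleftrightarrow> x = y"
  by (metis binary_vert_num vert_bits_inj)

locale abf_game =
  fixes I :: abf
  assumes inst: "abf_instance I"
begin

abbreviation "X \<equiv> abf_X I"
abbreviation "Y \<equiv> abf_Y I"
abbreviation "V \<equiv> X \<union> Y"
abbreviation "init \<equiv> initial_assignment I"
abbreviation "nc \<equiv> length (formula I)"
abbreviation "clause j \<equiv> set (formula I ! j)"

lemma init_unique: "(v, b) \<in> set (xvars I) \<union> set (yvars I) \<Longrightarrow> b = init v"
proof -
  assume vb: "(v, b) \<in> set (xvars I) \<union> set (yvars I)"
  have "distinct (map fst (xvars I @ yvars I))"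
    using inst by (auto simp: abf_instance_def abf_X_def abf_Y_def)
  moreover have "set (xvars I) \<union> set (yvars I) = set (xvars I @ yvars I)" by simp
  ultimately have "c = b" if "(v, c) \<in> set (xvars I) \<union> set (yvars I)" for c
    using that vb by (metis eq_key_imp_eq_value)
  from this[of True] this[of False] vb show ?thesis
    by (cases b) (auto simp: initial_assignment_def)
qed

lemma xvars_eq: "set (xvars I) = (\<lambda>v. (v, init v)) ` X"
  and yvars_eq: "set (yvars I) = (\<lambda>v. (v, init v)) ` Y"
  using init_unique by (force simp: abf_X_def abf_Y_def)+

lemma set_for_vars: "set (for_vars I f g) = (\<Union>v\<in>X. set (f (v, init v))) \<union> (\<Union>v\<in>Y. set (g (v, init v)))"
  by (simp add: for_vars_def xvars_eq yvars_eq)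

lemma set_for_clauses:
  "set (for_clauses I f g) = (\<Union>j<nc. set (f j) \<union> (\<Union>l\<in>clause j. set (g l j)))"
  by (auto simp: for_clauses_def)

lemma X_Y_disjoint: "v \<in> X \<Longrightarrow> v \<notin> Y"
  using inst by (auto simp: abf_instance_def)

lemma clause_vars: "j < nc \<Longrightarrow> (v, b) \<in> clause j \<Longrightarrow> v \<in> V"
  using inst by (force simp: abf_instance_def)

section \<open>The protected and the unprotected adjacency relation\<close>

definition P :: "vert \<Rightarrow> vert \<Rightarrow> bool" where
  "P a b \<longleftrightarrow> (a, b) \<in> set (prot_list I) \<or> (b, a) \<in> set (prot_list I)"

definition U :: "vert \<Rightarrow> vert \<Rightarrow> bool" where
  "U a b \<longleftrightarrow> (a, b) \<in> set (unprot_list I) \<or> (b, a) \<in> set (unprot_list I)"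

definition E :: "vert \<Rightarrow> vert \<Rightarrow> bool" where
  "E a b \<longleftrightarrow> P a b \<or> U a b"

lemma P_sym: "P a b \<longleftrightarrow> P b a" and U_sym: "U a b \<longleftrightarrow> U b a" and E_sym: "E a b \<longleftrightarrow> E b a"
  by (auto simp: P_def U_def E_def)

lemma set_star: "set (star a bs) = (\<lambda>b. (a, b)) ` set bs"
  by (simp add: star_def)

lemma bex_lessThan: "(\<exists>j\<in>{..<n :: nat}. Q j) \<longleftrightarrow> (\<exists>j<n. Q j)"
  by auto

lemma prot_Con: "(Con s, x) \<in> set (prot_list I) \<longleftrightarrow> (Con s, x) \<in> set spot_prot"
  by (auto simp: prot_list_def set_for_vars set_for_clauses set_star c_prot_def)

lemma prot_Clause: "(Clause j, x) \<in> set (prot_list I) \<longleftrightarrow>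
    j < nc \<and> (x = Clause j \<or> x \<in> Con ` {R3, R0, R1, R5, HavenK})"
  by (auto simp: prot_list_def set_for_vars set_for_clauses set_star c_prot_def spot_prot_def)

lemma prot_Var: "(Var k v b, x) \<in> set (prot_list I) \<longleftrightarrow>
    v \<in> V \<and> b \<and> k = Gate \<and> (x = Var Gate v True \<or> x \<in> Con ` {R3, R0, R1, R5, HavenK} \<or>
      (\<exists>w\<in>V. x = Var Haven w True)) \<or>
    v \<in> V \<and> b \<and> k = Haven \<and> (x \<in> Con ` {R0, R1, R2, R4, R5, HavenK, GateK} \<or>
      (\<exists>w\<in>V. x = Var Haven w True) \<or> (\<exists>j<nc. x = Clause j)) \<or>
    v \<in> Y \<and> b \<and> k = Dock \<and> (x = Var Dock v True \<or> x \<in> Con ` {R0, R1, R5, HavenK} \<or>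
      (\<exists>w\<in>V. x = Var Haven w True)) \<or>
    v \<in> Y \<and> k = Esc \<and> (x = Var Esc v b \<or> x \<in> Con ` {R0, R1, R5, HavenK} \<or>
      (\<exists>w\<in>V. x = Var Haven w True)) \<or>
    v \<in> Y \<and> k = Ask \<and> (x = Var Ask v b \<or> x = Var Put v b \<or> x = Var Esc v b \<or>
      x \<in> Con ` {R3, GateK, R1, R5} \<or> (\<exists>j<nc. x = Clause j)) \<or>
    v \<in> Y \<and> k = Put \<and> (x = Var Put v b \<or> x = Var Dock v True \<or> x \<in> Con ` {R3, GateK, R1, R5})"
proof -
  \<comment> \<open>A block written for the entry \<open>p\<close> contains only edges whose first
    end, if it is a \<open>Var\<close>, is named after \<open>fst p\<close>. Hence the union over
    all variables collapses to the contribution of \<open>v\<close>.\<close>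
  have fst: "(Var k v b, x) \<in> set (x_prot p) \<Longrightarrow> fst p = v" "(Var k v b, x) \<in> set (y_prot p) \<Longrightarrow> fst p = v"
    "(Var k v b, x) \<in> set (xv_prot p q) \<Longrightarrow> fst p = v" "(Var k v b, x) \<in> set (yv_prot p q) \<Longrightarrow> fst p = v"
    "(Var k v b, x) \<in> set (xc_prot p j) \<Longrightarrow> fst p = v" "(Var k v b, x) \<in> set (yc_prot p j) \<Longrightarrow> fst p = v"
    for p q j
    by (cases p; cases q; auto simp: set_star)+
  have none: "(Var k v b, x) \<notin> set spot_prot" "(Var k v b, x) \<notin> set (c_prot j)" for j
    by (auto simp: spot_prot_def c_prot_def set_star)
  let ?x = "\<lambda>p. (Var k v b, x) \<in> set (x_prot p) \<or> (\<exists>w\<in>V. (Var k v b, x) \<in> set (xv_prot p (w, init w))) \<or>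
       (\<exists>j<nc. (Var k v b, x) \<in> set (xc_prot p j))"
  let ?y = "\<lambda>p. (Var k v b, x) \<in> set (y_prot p) \<or> (\<exists>w\<in>V. (Var k v b, x) \<in> set (yv_prot p (w, init w))) \<or>
       (\<exists>j<nc. (Var k v b, x) \<in> set (yc_prot p j))"
  have "(Var k v b, x) \<in> set (prot_list I) \<longleftrightarrow> (\<exists>u\<in>X. ?x (u, init u)) \<or> (\<exists>u\<in>Y. ?y (u, init u))"
    unfolding prot_list_def set_append set_for_vars set_for_clauses
    by (simp add: none bex_Un bex_lessThan del: x_prot.simps y_prot.simps xv_prot.simps yv_prot.simps xc_prot.simps yc_prot.simps)
  also have "\<dots> \<longleftrightarrow> v \<in> X \<and> ?x (v, init v) \<or> v \<in> Y \<and> ?y (v, init v)"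
  proof -
    have "?x (u, init u) \<Longrightarrow> u = v" "?y (u, init u) \<Longrightarrow> u = v" for u
      using fst[of "(u, init u)"] by (simp only: fst_conv, blast)+
    then show ?thesis by blast
  qed
  finally show ?thesis
    by (cases k; cases b; simp add: set_star) blast+
qed

lemma unprot_Con: "(Con s, x) \<in> set (unprot_list I) \<longleftrightarrow> (Con s, x) \<in> set spot_unprot"
proof -
  have "(Con s, x) \<notin> set (x_unprot p)" "(Con s, x) \<notin> set (y_unprot p)" "(Con s, x) \<notin> set (yc_unprot p j)"
    "(Con s, x) \<notin> set (c_unprot j)" "(Con s, x) \<notin> set (lc_unprot p j)"
    "(Con s, x) \<notin> set (own_unprot p)" for p j
    by (cases p; auto simp: set_star c_unprot_def)+
  then show ?thesis
    unfolding unprot_list_def set_append set_for_vars set_for_clauses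
    by (simp del: x_unprot.simps y_unprot.simps own_unprot.simps yc_unprot.simps lc_unprot.simps)
qed

lemma unprot_Clause: "(Clause j, x) \<in> set (unprot_list I) \<longleftrightarrow>
    j < nc \<and> (x \<in> Con ` {K0, K1, K2} \<or> (\<exists>l\<in>clause j. x = Var Lit (fst l) (snd l)) \<or> (\<exists>y\<in>Y. x = Var Mid y True))"
proof -
  have none: "(Clause j, x) \<notin> set (x_unprot p)" "(Clause j, x) \<notin> set (y_unprot p)"
    "(Clause j, x) \<notin> set spot_unprot" "(Clause j, x) \<notin> set (own_unprot p)" for p
    by (cases p; auto simp: set_star spot_unprot_def)+
  have eqs: "lc_unprot l i = [(Clause i, Var Lit (fst l) (snd l))]" "yc_unprot l i = [(Clause i, Var Mid (fst l) True)]"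
    for l i
    by (cases l; simp)+
  have "(Clause j, x) \<in> set (unprot_list I) \<longleftrightarrow> j < nc \<and> (\<exists>y\<in>Y. x = Var Mid y True) \<or>
      j < nc \<and> ((Clause j, x) \<in> set (c_unprot j) \<or> (\<exists>l\<in>clause j. x = Var Lit (fst l) (snd l)))"
    unfolding unprot_list_def set_append set_for_vars set_for_clauses eqs
    by (auto simp: none c_unprot_def set_star simp del: x_unprot.simps y_unprot.simps own_unprot.simps)
  then show ?thesis
    by (auto simp: c_unprot_def set_star)
qed

lemma unprot_Var: "(Var k v b, x) \<in> set (unprot_list I) \<longleftrightarrow>
    v \<in> V \<and> k = Lit \<and> (x = Var Lit v b \<or> x = Con K0 \<or> v \<in> X \<and> b \<and> x = Var Lit v False) \<or>
    v \<in> V \<and> b \<and> k = Gate \<and> (x \<in> Con ` {K1, K2, KX} \<or> (\<exists>c. x = Var Lit v c)) \<or>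
    v \<in> V \<and> b \<and> k = Haven \<and> x = Var Lit v (init v) \<or>
    v \<in> Y \<and> b \<and> k = Mid \<and> (x = Var Mid v True \<or> x = Con K0 \<or> (\<exists>c. x = Var Lit v c)) \<or>
    v \<in> Y \<and> b \<and> k = Dock \<and> (x \<in> Con ` {K1, K2} \<or> (\<exists>c. x = Var Lit v c)) \<or>
    v \<in> Y \<and> k = Esc \<and> (x \<in> Con ` {K1, K2, KX} \<or> x = Var Mid v True \<or> x = Var Lit v b) \<or>
    v \<in> Y \<and> (k = Ask \<or> k = Put) \<and> x \<in> Con ` {K1, K2, KX}"
proof -
  have fst: "(Var k v b, x) \<in> set (x_unprot p) \<Longrightarrow> fst p = v" "(Var k v b, x) \<in> set (y_unprot p) \<Longrightarrow> fst p = v"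
    "(Var k v b, x) \<notin> set (yc_unprot p j)" "(Var k v b, x) \<in> set (own_unprot p) \<Longrightarrow> fst p = v" for p j
    by (cases p; auto simp: set_star)+
  have none: "(Var k v b, x) \<notin> set spot_unprot" "(Var k v b, x) \<notin> set (c_unprot j)"
    "(Var k v b, x) \<notin> set (lc_unprot l j)" for l j
    by (cases l; auto simp: spot_unprot_def c_unprot_def set_star)+
  let ?x = "\<lambda>p. (Var k v b, x) \<in> set (x_unprot p) \<or> (Var k v b, x) \<in> set (own_unprot p)"
  let ?y = "\<lambda>p. (Var k v b, x) \<in> set (y_unprot p) \<or> (Var k v b, x) \<in> set (own_unprot p)"
  have "(Var k v b, x) \<in> set (unprot_list I) \<longleftrightarrow>
    (\<exists>u\<in>X. ?x (u, init u)) \<or> (\<exists>u\<in>Y. ?y (u, init u))"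
    unfolding unprot_list_def set_append set_for_vars set_for_clauses
    by (simp add: none fst(3) bex_Un bex_lessThan del: x_unprot.simps y_unprot.simps own_unprot.simps yc_unprot.simps)
  also have "\<dots> \<longleftrightarrow> v \<in> X \<and> ?x (v, init v) \<or> v \<in> Y \<and> ?y (v, init v)"
  proof -
    have "?x (u, init u) \<Longrightarrow> u = v" "?y (u, init u) \<Longrightarrow> u = v" for u
      using fst(1,2,4)[of "(u, init u)"] by (simp only: fst_conv, blast)+
    then show ?thesis by blast
  qed
  finally show ?thesis
    by (cases k; cases b; simp add: set_star ex_bool_eq) blast+
qed

lemma prot_spot: "(Con s, Var k v b) \<notin> set (prot_list I)" "(Con s, Clause j) \<notin> set (prot_list I)"
   "(Clause j, Var k v b) \<notin> set (prot_list I)"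
  and unprot_spot: "(Con s, Var k v b) \<notin> set (unprot_list I)" "(Con s, Clause j) \<notin> set (unprot_list I)"
    "(Var k v b, Clause j) \<notin> set (unprot_list I)"
  by (auto simp: prot_Con prot_Clause unprot_Con unprot_Var spot_prot_def spot_unprot_def set_star)

lemma P_Con_Con: "P (Con s) (Con t) \<longleftrightarrow> (Con s, Con t) \<in> set spot_prot \<or> (Con t, Con s) \<in> set spot_prot"
  by (simp add: P_def prot_Con)

lemma P_Con_Var: "P (Con s) (Var k v b) \<longleftrightarrow>
    v \<in> V \<and> b \<and> k = Gate \<and> s \<in> {R0, R1, R3, R5, HavenK} \<or>
    v \<in> V \<and> b \<and> k = Haven \<and> s \<in> {R0, R1, R2, R4, R5, HavenK, GateK} \<or>
    v \<in> Y \<and> (b \<and> k = Dock \<or> k = Esc) \<and> s \<in> {R0, R1, R5, HavenK} \<or>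
    v \<in> Y \<and> (k = Ask \<or> k = Put) \<and> s \<in> {R1, R3, R5, GateK}"
  by (cases k; simp add: P_def prot_spot prot_Var del: Un_iff; blast?)

lemma P_Con_Clause: "P (Con s) (Clause j) \<longleftrightarrow> j < nc \<and> s \<in> {R0, R1, R3, R5, HavenK}"
  by (simp add: P_def prot_spot prot_Clause; blast)

lemma P_Clause_Clause: "P (Clause i) (Clause j) \<longleftrightarrow> i = j \<and> j < nc"
  by (auto simp add: P_def prot_Clause)

lemma P_Var_Clause: "P (Var k v b) (Clause j) \<longleftrightarrow> j < nc \<and> (v \<in> V \<and> b \<and> k = Haven \<or> v \<in> Y \<and> k = Ask)"
  by (cases k; simp add: P_def prot_spot prot_Var del: Un_iff; blast?)

lemma U_Con_Con: "U (Con s) (Con t) \<longleftrightarrow> (Con s, Con t) \<in> set spot_unprot \<or> (Con t, Con s) \<in> set spot_unprot"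
  by (simp add: U_def unprot_Con)

lemma U_Con_Var: "U (Con s) (Var k v b) \<longleftrightarrow>
    v \<in> V \<and> k = Lit \<and> s = K0 \<or> v \<in> Y \<and> k = Mid \<and> b \<and> s = K0 \<or>
    v \<in> V \<and> b \<and> k = Gate \<and> s \<in> {K1, K2, KX} \<or>
    v \<in> Y \<and> b \<and> k = Dock \<and> s \<in> {K1, K2} \<or>
    v \<in> Y \<and> (k = Esc \<or> k = Ask \<or> k = Put) \<and> s \<in> {K1, K2, KX}"
  by (cases k; simp add: U_def unprot_spot unprot_Var del: Un_iff; blast?)

lemma U_Con_Clause: "U (Con s) (Clause j) \<longleftrightarrow> j < nc \<and> s \<in> {K0, K1, K2}"
  by (simp add: U_def unprot_spot unprot_Clause; blast)

lemma U_Var_Clause: "U (Var k v b) (Clause j) \<longleftrightarrow> j < nc \<and> (k = Lit \<and> (v, b) \<in> clause j \<or> v \<in> Y \<and> k = Mid \<and> b)"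
  by (cases k; simp add: U_def unprot_spot unprot_Clause; force)

lemma U_Var_Var: "U (Var k v b) (Var k' v' b') \<longleftrightarrow> v = v' \<and> v \<in> V \<and> (
    k = Lit \<and> k' = Lit \<and> (b = b' \<or> v \<in> X) \<or>
    k = Gate \<and> b \<and> k' = Lit \<or> k' = Gate \<and> b' \<and> k = Lit \<or>
    k = Haven \<and> b \<and> k' = Lit \<and> b' = init v \<or> k' = Haven \<and> b' \<and> k = Lit \<and> b = init v \<or>
    v \<in> Y \<and> (k = Mid \<and> b \<and> k' = Mid \<and> b' \<or>
      k = Mid \<and> b \<and> k' = Lit \<or> k' = Mid \<and> b' \<and> k = Lit \<or>
      k = Dock \<and> b \<and> k' = Lit \<or> k' = Dock \<and> b' \<and> k = Lit \<or>
      k = Esc \<and> k' = Mid \<and> b' \<or> k' = Esc \<and> k = Mid \<and> b \<or>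
      k = Esc \<and> k' = Lit \<and> b' = b \<or> k' = Esc \<and> k = Lit \<and> b' = b))"
  by (cases k; cases k'; simp add: U_def unprot_Var del: Un_iff; blast?)

lemma P_Var_Var: "P (Var k v b) (Var k' v' b') \<longleftrightarrow>
    v \<in> V \<and> v' \<in> V \<and> b \<and> b' \<and> k = Haven \<and> k' = Haven \<or>
    v \<in> V \<and> v' \<in> V \<and> b \<and> b' \<and> (k = Gate \<and> k' = Haven \<or> k = Haven \<and> k' = Gate) \<or>
    v \<in> V \<and> v' = v \<and> b \<and> b' \<and> k = Gate \<and> k' = Gate \<or>
    v \<in> Y \<and> v' \<in> V \<and> (b \<and> k = Dock \<or> k = Esc) \<and> b' \<and> k' = Haven \<or>
    v' \<in> Y \<and> v \<in> V \<and> (b' \<and> k' = Dock \<or> k' = Esc) \<and> b \<and> k = Haven \<or>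
    v \<in> Y \<and> v = v' \<and> (b \<and> b' \<and> k = Dock \<and> k' = Dock \<or>
      b = b' \<and> (k, k') \<in> {(Esc, Esc), (Ask, Ask), (Put, Put), (Ask, Put), (Put, Ask), (Ask, Esc), (Esc, Ask)} \<or>
      b \<and> k = Dock \<and> k' = Put \<or> b' \<and> k' = Dock \<and> k = Put)"
  by (cases k; cases k'; simp add: P_def prot_Var del: Un_iff; blast?)

definition is_vert :: "vert \<Rightarrow> bool" where
  "is_vert x = (case x of Con s \<Rightarrow> True | Clause j \<Rightarrow> j < nc
     | Var k v b \<Rightarrow> if k \<in> {Lit, Gate, Haven} then v \<in> V \<and> (k = Lit \<or> b)
         else v \<in> Y \<and> (b \<or> k \<in> {Esc, Ask, Put}))"

definition cop_vert :: "vert \<Rightarrow> bool" where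
  "cop_vert x = (case x of Con s \<Rightarrow> s \<in> {K0, K1, K2, KX} | Clause j \<Rightarrow> False | Var k v b \<Rightarrow> k \<in> {Lit, Mid})"

lemma set_vert_list: "set (vert_list I) = Collect is_vert"
proof -
  have "x \<in> set (vert_list I) \<longleftrightarrow> is_vert x" for x
  proof (cases x)
    case (Con s)
    then show ?thesis by (cases s) (auto simp: vert_list_def spot_verts_def is_vert_def)
  next
    case (Var k v b)
    then show ?thesis
      by (cases k; cases b; simp add: vert_list_def spot_verts_def set_for_vars set_for_clauses is_vert_def; blast)
  next
    case (Clause j)
    then show ?thesis by (auto simp: vert_list_def spot_verts_def set_for_vars set_for_clauses is_vert_def)
  qed
  then show ?thesis by blast
qed

lemma prot_vert: "(a, b) \<in> set (prot_list I) \<Longrightarrow> \<not> cop_vert a \<and> \<not> cop_vert b \<and> is_vert a \<and> is_vert b"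
proof (cases a)
  case (Con s)
  assume "(a, b) \<in> set (prot_list I)"
  then have "(Con s, b) \<in> set spot_prot" by (simp add: Con prot_Con)
  then show ?thesis by (auto simp: Con spot_prot_def set_star cop_vert_def is_vert_def)
next
  case (Var k v c)
  assume "(a, b) \<in> set (prot_list I)"
  then show ?thesis unfolding Var prot_Var by (elim disjE conjE bexE exE; simp add: cop_vert_def is_vert_def; elim disjE; simp)
next
  case (Clause j)
  assume "(a, b) \<in> set (prot_list I)"
  then show ?thesis unfolding Clause prot_Clause by (auto simp: cop_vert_def is_vert_def)
qed

lemma unprot_vert: "(a, b) \<in> set (unprot_list I) \<Longrightarrow> (cop_vert a \<or> cop_vert b) \<and> is_vert a \<and> is_vert b"
proof (cases a)
  case (Con s)
  assume "(a, b) \<in> set (unprot_list I)"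
  then have "(Con s, b) \<in> set spot_unprot" by (simp add: Con unprot_Con)
  then show ?thesis by (auto simp: Con spot_unprot_def set_star cop_vert_def is_vert_def)
next
  case (Var k v c)
  assume "(a, b) \<in> set (unprot_list I)"
  then show ?thesis unfolding Var unprot_Var by (elim disjE conjE bexE exE; simp add: cop_vert_def is_vert_def; elim disjE; simp)
next
  case (Clause j)
  assume "(a, b) \<in> set (unprot_list I)"
  then show ?thesis unfolding Clause unprot_Clause using clause_vars by (force simp: cop_vert_def is_vert_def)
qed

text \<open>Hence no edge is both protected and unprotected, as \<open>lcrp_instance\<close>
  demands, and a cop off the places \<open>cop_vert\<close> cannot capture a robber who keeps off
  them too.\<close>

lemma P_cop: "P a b \<Longrightarrow> \<not> cop_vert a \<and> \<not> cop_vert b"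
  and U_cop: "U a b \<Longrightarrow> cop_vert a \<or> cop_vert b"
  and E_is_vert: "E a b \<Longrightarrow> is_vert a \<and> is_vert b"
  using prot_vert unprot_vert by (auto simp: P_def U_def E_def)

lemma P_loop: "is_vert a \<Longrightarrow> \<not> cop_vert a \<Longrightarrow> P a a"
proof (cases a)
  case (Con s)
  assume "\<not> cop_vert a"
  then show ?thesis by (cases s) (auto simp: Con P_Con_Con spot_prot_def set_star cop_vert_def)
next
  case (Var k v c)
  assume "is_vert a" "\<not> cop_vert a"
  then show ?thesis by (cases k) (auto simp: Var P_Var_Var cop_vert_def is_vert_def)
next
  case (Clause j)
  assume "is_vert a"
  then show ?thesis by (simp add: Clause P_Clause_Clause is_vert_def)
qed

lemma U_loop: "is_vert a \<Longrightarrow> cop_vert a \<Longrightarrow> U a a"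
proof (cases a)
  case (Con s)
  assume "cop_vert a"
  then show ?thesis by (cases s) (auto simp: Con U_Con_Con spot_unprot_def set_star cop_vert_def)
next
  case (Var k v c)
  assume "is_vert a" "cop_vert a"
  then show ?thesis by (cases k) (auto simp: Var U_Var_Var cop_vert_def is_vert_def)
qed (simp add: cop_vert_def)

lemma E_loop: "is_vert a \<Longrightarrow> E a a"
  using P_loop U_loop E_def by blast

abbreviation "G \<equiv> reduction I"

lemma edge_sets:
  "protected_edges G = {{vert_num a, vert_num b} | a b. P a b}"
  "unprotected_edges G = {{vert_num a, vert_num b} | a b. U a b}"
  by (force simp: protected_edges_def unprotected_edges_def reduction_def P_def U_def image_iff)+

lemma vert_num_doubleton: "{vert_num a, vert_num b} = {vert_num c, vert_num d} \<longleftrightarrow> a = c \<and> b = d \<or> a = d \<and> b = c"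
  by (auto simp: doubleton_eq_iff)

lemma protected_iff: "{vert_num a, vert_num b} \<in> protected_edges G \<longleftrightarrow> P a b"
  and unprotected_iff: "{vert_num a, vert_num b} \<in> unprotected_edges G \<longleftrightarrow> U a b"
  unfolding edge_sets using P_sym U_sym by (auto simp: vert_num_doubleton)

lemma edge_iff: "{vert_num a, vert_num b} \<in> edges G \<longleftrightarrow> E a b"
  by (simp add: edges_def protected_iff unprotected_iff E_def)

lemma edge_from: "{vert_num a, n} \<in> edges G \<Longrightarrow> \<exists>b. n = vert_num b"
  unfolding edges_def edge_sets by (auto simp: doubleton_eq_iff)

lemma lcrp_instance_reduction: "lcrp_instance G"
  unfolding lcrp_instance_def
proof (intro conjI ballI)
  show "vertices G \<noteq> []" by (simp add: reduction_def vert_list_def spot_verts_def)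
  show "0 < num_cops G" by (simp add: reduction_def)
  have vs: "set (vertices G) = vert_num ` Collect is_vert"
    by (simp add: reduction_def set_vert_list)
  show "e \<subseteq> set (vertices G)" if "e \<in> edges G" for e
    using that E_is_vert unfolding vs edges_def edge_sets by (auto simp: E_def)
  show "{n} \<in> edges G" if "n \<in> set (vertices G)" for n
    using that E_loop edge_iff[of a a for a] unfolding vs by auto
  show "protected_edges G \<inter> unprotected_edges G = {}"
    using P_cop U_cop unprotected_iff unfolding edge_sets(1) by blast
qed

section \<open>The game on named vertices, before any capture\<close>

abbreviation pos :: "vert list \<Rightarrow> vert \<Rightarrow> lcrp_position" where
  "pos as r \<equiv> (map vert_num as, vert_num r, False)"

definition winning :: "vert list \<Rightarrow> vert \<Rightarrow> bool" where
  "winning as r \<longleftrightarrow> wins (cops_move G) (robber_move G) captured (pos as r)"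

definition attacked :: "vert list \<Rightarrow> vert \<Rightarrow> bool" where
  "attacked as r \<longleftrightarrow> (\<exists>a\<in>set as. U a r)"

definition nbh :: "vert \<Rightarrow> vert \<Rightarrow> bool" where
  "nbh r r' \<longleftrightarrow> r' = r \<or> E r r'"

definition cmove :: "vert list \<Rightarrow> vert list \<Rightarrow> bool" where
  "cmove as as' \<longleftrightarrow> as' = as \<or> (\<exists>i<length as. \<exists>v. E (as ! i) v \<and> as' = as[i := v])"

lemma winning_attacked: "attacked as r \<Longrightarrow> winning as r"
proof -
  assume "attacked as r"
  then obtain i where i: "i < length as" "U (as ! i) r"
    by (auto simp: attacked_def in_set_conv_nth)
  then have "cops_move G (pos as r) (map vert_num (as[i := r]), vert_num r, True)"
    by (auto simp: edge_iff unprotected_iff map_update E_def intro!: exI[of _ i])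
  then show ?thesis unfolding winning_def by (rule wins_move_goal) simp
qed

lemma robber_move_pos: "robber_move G (pos as r) s \<Longrightarrow> \<exists>r'. s = pos as r' \<and> nbh r r'"
proof -
  assume "robber_move G (pos as r) s"
  then obtain n where s: "s = (map vert_num as, n, False)" and n: "n = vert_num r \<or> {vert_num r, n} \<in> edges G"
    by (cases s) auto
  from n edge_from obtain r' where r': "n = vert_num r'" by blast
  with n have "nbh r r'" by (auto simp: nbh_def edge_iff)
  then show ?thesis using s r' by blast
qed

text \<open>A robber on an attacked vertex is captured in one move, so only replies to unattacked
  vertices count. If he is not attacked at present, the move to \<open>as'\<close> cannot capture
  him, so the flag stays \<open>False\<close> and the new position is again of the form
  \<open>pos as' r\<close>.\<close>

lemma winning_move:
  assumes "cmove as as'" and "\<And>r'. nbh r r' \<Longrightarrow> \<not> attacked as' r' \<Longrightarrow> winning as' r'"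
  shows "winning as r"
proof (cases "attacked as r")
  case False
  then have "cops_move G (pos as r) (pos as' r)"
    using assms(1) by (fastforce simp: cmove_def edge_iff unprotected_iff map_update attacked_def)
  then show ?thesis
    unfolding winning_def
  proof (rule wins_move)
    fix s assume "robber_move G (pos as' r) s"
    from robber_move_pos[OF this] show "wins (cops_move G) (robber_move G) captured s"
      using assms(2) winning_attacked[unfolded winning_def] by (force simp: winning_def)
  qed
qed (rule winning_attacked)

lemma not_winning:
  assumes "Inv as r"
    and unattacked: "\<And>as r. Inv as r \<Longrightarrow> \<not> attacked as r"
    and step: "\<And>as as' r. Inv as r \<Longrightarrow> cmove as as' \<Longrightarrow> \<exists>r'. nbh r r' \<and> Inv as' r'"
  shows "\<not> winning as r"
  unfolding winning_def
proof (rule not_wins_coinduct[where Inv = "\<lambda>s. \<exists>as r. s = pos as r \<and> Inv as r"])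
  show "\<exists>as' r'. pos as r = pos as' r' \<and> Inv as' r'" using assms(1) by blast
next
  fix s s' assume "\<exists>as r. s = pos as r \<and> Inv as r" and mv: "cops_move G s s'"
  then obtain as r where s: "s = pos as r" and inv: "Inv as r" by blast
  obtain as' where s': "s' = pos as' r" and cm: "cmove as as'"
  proof -
    obtain cs' r' cap' where [simp]: "s' = (cs', r', cap')" by (cases s')
    from mv have r': "r' = vert_num r" unfolding s by auto
    have "cs' = map vert_num as \<and> \<not> cap' \<or> (\<exists>i<length as. \<exists>n. {vert_num (as ! i), n} \<in> edges G \<and>
        cs' = (map vert_num as)[i := n] \<and> cap' = (n = vert_num r \<and> {vert_num (as ! i), n} \<in> unprotected_edges G))"
      using mv unfolding s by (simp cong: conj_cong)
    then consider "cs' = map vert_num as" "\<not> cap'" |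
      (b) i n where "i < length as" "{vert_num (as ! i), n} \<in> edges G" "cs' = (map vert_num as)[i := n]"
        "cap' = (n = vert_num r \<and> {vert_num (as ! i), n} \<in> unprotected_edges G)" by blast
    then show ?thesis
    proof cases
      case 1
      then show ?thesis using r' that[of as] by (auto simp: cmove_def)
    next
      case b
      then obtain v where v: "n = vert_num v" using edge_from by blast
      have "\<not> cap'" using b unattacked[OF inv] by (auto simp: v unprotected_iff attacked_def)
      then show ?thesis using b r' that[of "as[i := v]"] by (auto simp: v cmove_def edge_iff map_update)
    qed
  qed
  from step[OF inv cm] obtain r' where "nbh r r'" "Inv as' r'" by blast
  then show "\<not> captured s' \<and> (\<exists>s''. robber_move G s' s'' \<and> (\<exists>as r. s'' = pos as r \<and> Inv as r))"
    unfolding s' by (intro conjI exI[of _ "pos as' r'"] exI[of _ as'] exI[of _ r']) (auto simp: nbh_def edge_iff)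
qed auto

text \<open>\<open>wins_uniform_strategy\<close> removes the common strategy from the statement;
  what is left speaks only of winning positions on named vertices.\<close>

lemma cops_win_iff:
  "cops_win G \<longleftrightarrow> (\<exists>as. length as = num_cops G \<and> Ball (set as) is_vert \<and> (\<forall>r. is_vert r \<longrightarrow> winning as r))"
proof
  assume "cops_win G"
  then obtain cs \<sigma> where cs: "length cs = num_cops G" "set cs \<subseteq> set (vertices G)"
    "\<And>r. r \<in> set (vertices G) \<Longrightarrow> winning_strategy (cops_move G) (robber_move G) captured (cs, r, False) \<sigma>"
    by (auto simp: cops_win_def)
  have vs: "set (vertices G) = vert_num ` Collect is_vert"
    by (simp add: reduction_def set_vert_list)
  from cs(2) have "\<forall>c\<in>set cs. \<exists>a. is_vert a \<and> c = vert_num a" unfolding vs by blast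
  then obtain f where f: "\<forall>c\<in>set cs. is_vert (f c) \<and> c = vert_num (f c)" by metis
  then have "map vert_num (map f cs) = cs" by (simp add: map_idI)
  then have "winning (map f cs) r" if "is_vert r" for r
    unfolding winning_def using winning_strategy_imp_wins[OF cs(3)[of "vert_num r"]] that vs by auto
  then show "\<exists>as. length as = num_cops G \<and> Ball (set as) is_vert \<and> (\<forall>r. is_vert r \<longrightarrow> winning as r)"
    using f cs(1) by (intro exI[of _ "map f cs"]) auto
next
  assume "\<exists>as. length as = num_cops G \<and> Ball (set as) is_vert \<and> (\<forall>r. is_vert r \<longrightarrow> winning as r)"
  then obtain as where as: "length as = num_cops G" "Ball (set as) is_vert" "\<And>r. is_vert r \<Longrightarrow> winning as r" by blast
  have vs: "set (vertices G) = vert_num ` Collect is_vert"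
    by (simp add: reduction_def set_vert_list)
  obtain \<sigma> where "\<And>s. wins (cops_move G) (robber_move G) captured s \<Longrightarrow>
      winning_strategy (cops_move G) (robber_move G) captured s \<sigma>"
  proof -
    have "cops_move G s s" for s by (cases s) simp
    from wins_uniform_strategy[of "cops_move G", OF this] that show thesis by blast
  qed
  then show "cops_win G" unfolding cops_win_def vs
    using as by (intro exI[of _ "map vert_num as"] exI[of _ \<sigma>]) (auto simp: winning_def)
qed

section \<open>Configurations of the cops and neighbourhoods of the robber\<close>

definition vs :: "nat list" where
  "vs = map fst (xvars I @ yvars I)"

lemma set_vs: "set vs = V" and distinct_vs: "distinct vs" and length_vs: "num_cops G = Suc (length vs)"
  using inst by (auto simp: vs_def abf_X_def abf_Y_def abf_instance_def reduction_def)

definition cfg :: "(nat \<Rightarrow> vert) \<Rightarrow> spot \<Rightarrow> vert list" where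
  "cfg l j = map l vs @ [Con j]"

definition lits :: "assignment \<Rightarrow> nat \<Rightarrow> vert" where
  "lits \<alpha> v = Var Lit v (\<alpha> v)"

lemma attacked_cfg: "attacked (cfg l j) r \<longleftrightarrow> U (Con j) r \<or> (\<exists>v\<in>V. U (l v) r)"
  by (auto simp: attacked_def cfg_def set_vs)

lemma cmove_judge: "E (Con j) (Con j') \<Longrightarrow> cmove (cfg l j) (cfg l j')"
  by (auto simp: cmove_def cfg_def list_update_append nth_append intro!: exI[of _ "length vs"])

lemma cmove_var:
  assumes "v \<in> V" "E (l v) u"
  shows "cmove (cfg l j) (cfg (l(v := u)) j)"
proof -
  obtain i where i: "i < length vs" "vs ! i = v" using assms(1) set_vs by (metis in_set_conv_nth)
  have "(map l vs)[i := u] = map (l(v := u)) vs"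
    using i distinct_vs by (intro nth_equalityI) (auto simp: nth_list_update nth_eq_iff_index_eq)
  then show ?thesis using i assms(2)
    by (auto simp: cmove_def cfg_def list_update_append nth_append intro!: exI[of _ i] exI[of _ u])
qed

lemma cmove_refl: "cmove as as"
  by (simp add: cmove_def)

lemmas set_spot_prot = spot_prot_def[THEN arg_cong, of set, simplified star_def list.map append.simps list.set]
lemmas set_spot_unprot = spot_unprot_def[THEN arg_cong, of set, simplified star_def list.map append.simps list.set]
lemma P_spots:
  "P (Con R0) (Con t) \<longleftrightarrow> t \<in> {R0, R1, R5, HavenK, GateK}"
  "P (Con R1) (Con t) \<longleftrightarrow> t \<in> {R0, R1, R2, HavenK, GateK}"
  "P (Con R2) (Con t) \<longleftrightarrow> t \<in> {R1, R2, R3, HavenK}"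
  "P (Con R3) (Con t) \<longleftrightarrow> t \<in> {R2, R3, R4, GateK}"
  "P (Con R4) (Con t) \<longleftrightarrow> t \<in> {R3, R4, R5, HavenK}"
  "P (Con R5) (Con t) \<longleftrightarrow> t \<in> {R4, R5, R0, HavenK, GateK}"
  "P (Con HavenK) (Con t) \<longleftrightarrow> t \<in> {R0, R1, R2, R4, R5, HavenK, GateK}"
  "\<not> P (Con K0) (Con t)" "\<not> P (Con K1) (Con t)" "\<not> P (Con K2) (Con t)" "\<not> P (Con KX) (Con t)"
  "P (Con GateK) (Con t) \<longleftrightarrow> t \<in> {R0, R1, R3, R5, HavenK, GateK}"
  by (cases t; simp add: P_Con_Con set_spot_prot)+
lemma U_spots:
  "U (Con K0) (Con t) \<longleftrightarrow> t \<in> {K0, K1, K2, KX, R1, R2, R4, R5, HavenK, GateK}"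
  "U (Con K1) (Con t) \<longleftrightarrow> t \<in> {K0, K1, K2, KX, R0, R2, R3, R5, HavenK, GateK}"
  "U (Con K2) (Con t) \<longleftrightarrow> t \<in> {K0, K1, K2, KX, R0, R1, R3, R4, HavenK, GateK}"
  "U (Con R0) (Con t) \<longleftrightarrow> t \<in> {K1, K2, KX}"
  "U (Con R1) (Con t) \<longleftrightarrow> t \<in> {K0, K2, KX}"
  "U (Con R2) (Con t) \<longleftrightarrow> t \<in> {K0, K1, KX}"
  "U (Con R3) (Con t) \<longleftrightarrow> t \<in> {K1, K2, KX}"
  "U (Con R4) (Con t) \<longleftrightarrow> t \<in> {K0, K2, KX}"
  "U (Con R5) (Con t) \<longleftrightarrow> t \<in> {K0, K1, KX}"
  "U (Con HavenK) (Con t) \<longleftrightarrow> t \<in> {K0, K1, K2}"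
  "U (Con GateK) (Con t) \<longleftrightarrow> t \<in> {K0, K1, K2, KX}"
  "U (Con KX) (Con t) \<longleftrightarrow> t \<in> {K0, K1, K2, KX, R0, R1, R2, R3, R4, R5, GateK}"
  by (cases t; simp add: U_Con_Con set_spot_unprot)+
lemmas spot_simps = P_spots U_spots

lemma judge_moves: "j \<in> {K0, K1, K2, KX} \<Longrightarrow> j' \<in> {K0, K1, K2, KX} \<Longrightarrow> E (Con j) (Con j')"
  by (auto simp: E_def spot_simps)

lemma nbh_R3: "nbh (Con R3) r \<longleftrightarrow> r \<in> Con ` {R2, R3, R4, GateK, K1, K2, KX} \<or> (\<exists>v\<in>V. r = Var Gate v True) \<or>
    (\<exists>j<nc. r = Clause j) \<or> (\<exists>y\<in>Y. \<exists>b. r = Var Ask y b \<or> r = Var Put y b)"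
  by (cases r) (auto simp: nbh_def E_def spot_simps P_Con_Var U_Con_Var P_Con_Clause U_Con_Clause)

lemma P_Var_Con: "P (Var k v b) (Con s) \<longleftrightarrow> P (Con s) (Var k v b)"
  and U_Var_Con: "U (Var k v b) (Con s) \<longleftrightarrow> U (Con s) (Var k v b)"
  using P_sym U_sym by blast+

lemma nbh_Ask: "y \<in> Y \<Longrightarrow> nbh (Var Ask y b) r \<longleftrightarrow> r \<in> Con ` {R3, GateK, R1, R5, K1, K2, KX} \<or>
    (\<exists>j<nc. r = Clause j) \<or> r \<in> {Var Ask y b, Var Put y b, Var Esc y b}"
  by (cases r) (auto simp: nbh_def E_def P_Var_Con U_Var_Con P_Con_Var U_Con_Var P_Var_Var U_Var_Var P_Var_Clause U_Var_Clause)

lemma nbh_Put: "y \<in> Y \<Longrightarrow> nbh (Var Put y b) r \<longleftrightarrow> r \<in> Con ` {R3, GateK, R1, R5, K1, K2, KX} \<or>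
    r \<in> {Var Ask y b, Var Put y b, Var Dock y True}"
  by (cases r) (auto simp: nbh_def E_def P_Var_Con U_Var_Con P_Con_Var U_Con_Var P_Var_Var U_Var_Var P_Var_Clause U_Var_Clause)

lemma nbh_Esc: "y \<in> Y \<Longrightarrow> nbh (Var Esc y b) r \<longleftrightarrow> r \<in> Con ` {R0, R1, R5, HavenK, K1, K2, KX} \<or>
    (\<exists>w\<in>V. r = Var Haven w True) \<or> r \<in> {Var Esc y b, Var Ask y b, Var Mid y True, Var Lit y b}"
  by (cases r) (auto simp: nbh_def E_def P_Var_Con U_Var_Con P_Con_Var U_Con_Var P_Var_Var U_Var_Var P_Var_Clause U_Var_Clause)

lemma nbh_Lit: "y \<in> Y \<Longrightarrow> nbh (Var Lit y b) r \<Longrightarrow> r = Con K0 \<or> (\<exists>j<nc. r = Clause j) \<or>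
    r \<in> {Var Lit y b, Var Mid y True, Var Gate y True, Var Dock y True, Var Esc y b} \<or> r = Var Haven y True \<and> b = init y"
  using X_Y_disjoint
  by (cases r) (auto simp: nbh_def E_def P_Var_Con U_Var_Con P_Con_Var U_Con_Var P_Var_Var U_Var_Var P_Var_Clause U_Var_Clause)

lemma nbh_R0: "nbh (Con R0) r \<Longrightarrow> r \<in> Con ` {R0, R1, R5, HavenK, GateK, K1, K2, KX} \<or> (\<exists>v\<in>V. r = Var Gate v True \<or> r = Var Haven v True)
   \<or> (\<exists>y\<in>Y. \<exists>b. r = Var Dock y True \<or> r = Var Esc y b) \<or> (\<exists>j<nc. r = Clause j)"
  by (cases r) (auto simp: nbh_def E_def spot_simps P_Con_Var U_Con_Var P_Con_Clause U_Con_Clause)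

lemma nbh_R1: "nbh (Con R1) r \<Longrightarrow> r \<in> Con ` {R0, R1, R2, HavenK, GateK, K0, K2, KX} \<or> (\<exists>v\<in>V. r = Var Gate v True \<or> r = Var Haven v True)
   \<or> (\<exists>y\<in>Y. \<exists>b. r = Var Dock y True \<or> r = Var Esc y b \<or> r = Var Ask y b \<or> r = Var Put y b) \<or> (\<exists>j<nc. r = Clause j)"
  by (cases r) (auto simp: nbh_def E_def spot_simps P_Con_Var U_Con_Var P_Con_Clause U_Con_Clause)

lemma nbh_R2: "nbh (Con R2) r \<Longrightarrow> r \<in> Con ` {R1, R2, R3, HavenK, K0, K1, KX} \<or> (\<exists>v\<in>V. r = Var Haven v True)"
  by (cases r) (auto simp: nbh_def E_def spot_simps P_Con_Var U_Con_Var P_Con_Clause U_Con_Clause)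

section \<open>The strategy of the cops\<close>

lemma attacked_var: "v \<in> V \<Longrightarrow> U (l v) r \<Longrightarrow> attacked (cfg l j) r"
  by (auto simp: attacked_cfg)

lemma U_K0: "r \<in> Con ` {K0, K1, K2, KX, R1, R2, R4, R5, HavenK, GateK} \<or> (\<exists>j<nc. r = Clause j) \<Longrightarrow> U (Con K0) r"
  by (elim disjE imageE exE conjE; simp add: U_spots U_Con_Clause)

lemma U_K1: "r \<in> Con ` {K0, K1, K2, KX, R0, R2, R3, R5, HavenK, GateK} \<or> (\<exists>j<nc. r = Clause j) \<or>
   (\<exists>v\<in>V. r = Var Gate v True) \<or> (\<exists>y\<in>Y. \<exists>b. r = Var Dock y True \<or> r = Var Esc y b \<or> r = Var Ask y b \<or> r = Var Put y b)
   \<Longrightarrow> U (Con K1) r"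
  by (elim disjE imageE exE bexE conjE; simp add: U_spots U_Con_Clause U_Con_Var)

lemma U_K2: "r \<in> Con ` {K0, K1, K2, KX, R0, R1, R3, R4, HavenK, GateK} \<or> (\<exists>j<nc. r = Clause j) \<or>
   (\<exists>v\<in>V. r = Var Gate v True) \<or> (\<exists>y\<in>Y. \<exists>b. r = Var Dock y True \<or> r = Var Esc y b \<or> r = Var Ask y b \<or> r = Var Put y b)
   \<Longrightarrow> U (Con K2) r"
  by (elim disjE imageE exE bexE conjE; simp add: U_spots U_Con_Clause U_Con_Var)

lemma U_KX: "r \<in> Con ` {K0, K1, K2, KX, R0, R1, R2, R3, R4, R5, GateK} \<or>
   (\<exists>v\<in>V. r = Var Gate v True) \<or> (\<exists>y\<in>Y. \<exists>b. r = Var Esc y b \<or> r = Var Ask y b \<or> r = Var Put y b)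
   \<Longrightarrow> U (Con KX) r"
  by (elim disjE imageE exE bexE conjE; simp add: U_spots U_Con_Clause U_Con_Var)

text \<open>The challenge: the judge goes to \<open>KX\<close>, and the variable cops take care of
  what \<open>KX\<close> leaves free around \<open>r\<close>. Then every reply of the robber is
  attacked.\<close>

lemma winning_challenge:
  assumes "\<And>r'. nbh r r' \<Longrightarrow> \<not> U (Con KX) r' \<Longrightarrow> \<exists>v\<in>V. U (l v) r'"
  shows "winning (cfg l K0) r"
proof (rule winning_move[OF cmove_judge[of K0 KX]])
  show "E (Con K0) (Con KX)" by (rule judge_moves) simp_all
  fix r' assume "nbh r r'" "\<not> attacked (cfg l KX) r'"
  with assms[of r'] show "winning (cfg l KX) r'" unfolding attacked_cfg by blast
qed

lemma unattacked_KX_R3: "nbh (Con R3) r' \<Longrightarrow> \<not> U (Con KX) r' \<Longrightarrow> \<exists>j<nc. r' = Clause j"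
  using U_KX[of r'] unfolding nbh_R3 by blast

lemma unattacked_KX_Ask: "y \<in> Y \<Longrightarrow> nbh (Var Ask y b) r' \<Longrightarrow> \<not> U (Con KX) r' \<Longrightarrow> \<exists>j<nc. r' = Clause j"
  using U_KX[of r'] by (simp only: nbh_Ask) blast

lemma unattacked_KX_Put: "y \<in> Y \<Longrightarrow> nbh (Var Put y b) r' \<Longrightarrow> \<not> U (Con KX) r' \<Longrightarrow> r' = Var Dock y True"
  using U_KX[of r'] by (simp only: nbh_Put) blast

text \<open>\<open>KX\<close> leaves only clauses free around \<open>R3\<close> and around
  \<open>Ask\<close>, and a true literal in each clause attacks it. \<open>Ask\<close> is included
  because the robber still moves once between A's satisfying move and the challenge.\<close>

lemma winning_satisfied:
  assumes \<alpha>: "cnf_true (formula I) \<alpha>" and r: "r = Con R3 \<or> (\<exists>y\<in>Y. \<exists>b. r = Var Ask y b)"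
  shows "winning (cfg (lits \<alpha>) K0) r"
proof (rule winning_challenge)
  fix r' assume "nbh r r'" "\<not> U (Con KX) r'"
  with r obtain j where j: "j < nc" "r' = Clause j"
    using unattacked_KX_R3 unattacked_KX_Ask by blast
  from j(1) have "formula I ! j \<in> set (formula I)" by simp
  with \<alpha> obtain v b where vb: "(v, b) \<in> clause j" "\<alpha> v = b"
    unfolding cnf_true_def by blast
  then show "\<exists>v\<in>V. U (lits \<alpha> v) r'" using clause_vars[OF j(1) vb(1)] j
    by (intro bexI[of _ v]) (auto simp: lits_def U_Var_Clause)
qed

text \<open>\<open>Put\<close> is adjacent to no clause. Under a challenge only
  \<open>Dock y True\<close> is left, and it is attacked while the cop of \<open>y\<close> stands on
  a literal. So entering \<open>Put\<close> too early, or staying there too long, loses.\<close>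

lemma winning_Put:
  assumes y: "y \<in> Y"
  shows "winning (cfg (lits \<alpha>) K0) (Var Put y b)"
proof (rule winning_challenge)
  fix r' assume "nbh (Var Put y b) r'" "\<not> U (Con KX) r'"
  with y unattacked_KX_Put have "r' = Var Dock y True" by blast
  then show "\<exists>v\<in>V. U (lits \<alpha> v) r'"
    using y by (intro bexI[of _ y]) (simp_all add: lits_def U_Var_Var)
qed

abbreviation "mids \<alpha> y \<equiv> (lits \<alpha>)(y := Var Mid y True)"

text \<open>This punishes a robber who has drawn the cop to \<open>Mid y\<close> and does not
  proceed to \<open>Put\<close>. The flight to a clause fails whatever the formula says, since
  \<open>Mid y\<close> attacks all clauses.\<close>

lemma winning_Mid:
  assumes y: "y \<in> Y" and r: "r = Con R3 \<or> r = Var Ask y b"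
  shows "winning (cfg (mids \<alpha> y) K0) r"
proof (rule winning_challenge)
  fix r' assume "nbh r r'" "\<not> U (Con KX) r'"
  with r y obtain j where j: "j < nc" "r' = Clause j"
    using unattacked_KX_R3 unattacked_KX_Ask by blast
  then show "\<exists>v\<in>V. U ((mids \<alpha> y) v) r'"
    using y by (intro bexI[of _ y]) (simp_all add: U_Var_Clause)
qed

lemma unattacked_R3: "nbh (Con R3) r' \<Longrightarrow> \<not> attacked (cfg (lits \<alpha>) K0) r' \<Longrightarrow>
    r' = Con R3 \<or> (\<exists>y\<in>Y. \<exists>b. r' = Var Ask y b \<or> r' = Var Put y b)"
proof -
  assume n: "nbh (Con R3) r'" "\<not> attacked (cfg (lits \<alpha>) K0) r'"
  have "U (lits \<alpha> v) (Var Gate v True)" if "v \<in> V" for v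
    using that by (simp add: lits_def U_Var_Var)
  with n U_K0[of r'] show ?thesis unfolding nbh_R3 attacked_cfg by blast
qed

lemma unattacked_Ask:
  assumes "y \<in> Y" "nbh (Var Ask y b) r'" "\<not> attacked (cfg l K0) r'" "U (l y) (Var Esc y b)"
  shows "r' = Con R3 \<or> r' = Var Ask y b \<or> r' = Var Put y b"
  using assms U_K0[of r'] by (simp only: nbh_Ask attacked_cfg) blast

lemma unattacked_Put:
  assumes "y \<in> Y" "nbh (Var Put y b) r'" "\<not> attacked (cfg (lits \<alpha>) K0) r'"
  shows "r' = Con R3 \<or> r' = Var Ask y b \<or> r' = Var Put y b"
proof -
  have "U (lits \<alpha> y) (Var Dock y True)"
    using assms(1) by (simp add: lits_def U_Var_Var)
  with assms U_K0[of r'] show ?thesis by (simp only: nbh_Put attacked_cfg) blast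
qed

lemma lits_upd: "(lits \<alpha>)(v := Var Lit v b) = lits (\<alpha>(v := b))"
  by (auto simp: lits_def)

text \<open>A request costs the cop of \<open>y\<close> two moves, from \<open>Lit\<close> to
  \<open>Mid\<close> to \<open>Lit\<close>. After the second one the robber is on \<open>R3\<close>
  or \<open>Ask y b\<close>, which the hypotheses cover, or on \<open>Put\<close>, where he loses to
  a challenge.\<close>

lemma winning_request:
  assumes y: "y \<in> Y" and b: "\<alpha> y \<noteq> b"
    and next1: "winning (cfg (lits (\<alpha>(y := b))) K0) (Con R3)"
    and next2: "winning (cfg (lits (\<alpha>(y := b))) K0) (Var Ask y b)"
  shows "winning (cfg (lits \<alpha>) K0) (Var Ask y b)"
proof (rule winning_move[OF cmove_var])
  show "y \<in> V" using y by blast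
  show "E (lits \<alpha> y) (Var Mid y True)" using y by (simp add: lits_def E_def U_Var_Var)
  fix r' assume r': "nbh (Var Ask y b) r'" "\<not> attacked (cfg (mids \<alpha> y) K0) r'"
  have "U ((mids \<alpha> y) y) (Var Esc y b)" using y by (simp add: U_Var_Var)
  from unattacked_Ask[OF y r' this] consider "r' = Con R3 \<or> r' = Var Ask y b" | "r' = Var Put y b" by blast
  then show "winning (cfg (mids \<alpha> y) K0) r'"
  proof cases
    case 1
    then show ?thesis using winning_Mid[OF y] by blast
  next
    case 2
    show ?thesis
    proof (rule winning_move[OF cmove_var])
      show "y \<in> V" using y by blast
      show "E ((mids \<alpha> y) y) (Var Lit y b)" using y by (simp add: E_def U_Var_Var)
      fix r'' assume "nbh r' r''" "\<not> attacked (cfg ((mids \<alpha> y)(y := Var Lit y b)) K0) r''"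
      then have "r'' = Con R3 \<or> r'' = Var Ask y b \<or> r'' = Var Put y b"
        using unattacked_Put[OF y] unfolding 2 fun_upd_upd lits_upd by blast
      then show "winning (cfg ((mids \<alpha> y)(y := Var Lit y b)) K0) r''"
        unfolding fun_upd_upd lits_upd using next1 next2 winning_Put[OF y] by blast
    qed
  qed
qed

text \<open>Asking for the present value is no threat, because the cop on
  \<open>Lit y (\<alpha> y)\<close> attacks \<open>Esc y (\<alpha> y)\<close>. It counts as waiting,
  like \<open>R3\<close>, and the induction has to cover both.\<close>

definition stable :: "assignment \<Rightarrow> vert \<Rightarrow> bool" where
  "stable \<alpha> r \<longleftrightarrow> r = Con R3 \<or> (\<exists>y\<in>Y. r = Var Ask y (\<alpha> y))"

lemma unattacked_stable:
  assumes "stable \<alpha> r" "nbh r r'" "\<not> attacked (cfg (lits \<alpha>) K0) r'"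
  shows "r' = Con R3 \<or> (\<exists>y\<in>Y. \<exists>b. r' = Var Ask y b \<or> r' = Var Put y b)"
proof (cases "r = Con R3")
  case True
  then show ?thesis using assms unattacked_R3 by blast
next
  case False
  then obtain y where y: "y \<in> Y" "r = Var Ask y (\<alpha> y)" using assms(1) by (auto simp: stable_def)
  have "U (lits \<alpha> y) (Var Esc y (\<alpha> y))" using y by (simp add: lits_def U_Var_Var)
  then show ?thesis using unattacked_Ask[OF y(1)] y assms(2,3) by blast
qed

lemma stable_upd: "stable \<alpha> r \<Longrightarrow> v \<in> X \<Longrightarrow> stable (\<alpha>(v := b)) r"
  using X_Y_disjoint by (auto simp: stable_def)

section \<open>Following a derivation of A's win on the graph\<close>

abbreviation "A_wins \<equiv> wins (change_at_most_one X) (change_at_most_one Y) (cnf_true (formula I))"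

lemma A_move:
  assumes "change_at_most_one X \<alpha> \<alpha>'"
  shows "cmove (cfg (lits \<alpha>) K0) (cfg (lits \<alpha>') K0)"
  using assms unfolding change_at_most_one_def
proof (elim disjE bexE exE)
  fix v b assume v: "v \<in> X" and \<alpha>': "\<alpha>' = \<alpha>(v := b)"
  have "E (lits \<alpha> v) (Var Lit v b)" using v by (simp add: lits_def E_def U_Var_Var)
  with cmove_var[of v "lits \<alpha>" "Var Lit v b" K0] v show ?thesis unfolding \<alpha>' lits_upd by blast
qed (simp add: cmove_refl)

lemma stable_A_move: "stable \<alpha> r \<Longrightarrow> change_at_most_one X \<alpha> \<alpha>' \<Longrightarrow> stable \<alpha>' r"
  using stable_upd unfolding change_at_most_one_def by blast

text \<open>The robber's reply is read as a move of B: a stable vertex is a pass,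
  \<open>Ask y b\<close> with a different value \<open>b\<close> sets \<open>y\<close>, and
  \<open>Put\<close> loses to a challenge. If A has just made the formula true, the challenge comes
  instead of the next move of A.\<close>

lemma winning_after_A_move:
  assumes win: "cnf_true (formula I) \<alpha> \<or>
      (\<forall>\<alpha>' r. change_at_most_one Y \<alpha> \<alpha>' \<longrightarrow> stable \<alpha>' r \<longrightarrow> winning (cfg (lits \<alpha>') K0) r)"
    and r: "r = Con R3 \<or> (\<exists>y\<in>Y. \<exists>b. r = Var Ask y b \<or> r = Var Put y b)"
  shows "winning (cfg (lits \<alpha>) K0) r"
proof -
  from r consider "\<exists>y\<in>Y. \<exists>b. r = Var Put y b" | "r = Con R3 \<or> (\<exists>y\<in>Y. \<exists>b. r = Var Ask y b)" by blast
  then show ?thesis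
  proof cases
    case 1 then show ?thesis using winning_Put by blast
  next
    case 2
    show ?thesis
    proof (cases "cnf_true (formula I) \<alpha>")
      case True
      then show ?thesis using winning_satisfied 2 by blast
    next
      case False
      with win have nxt: "winning (cfg (lits \<alpha>') K0) r" if "change_at_most_one Y \<alpha> \<alpha>'" "stable \<alpha>' r" for \<alpha>' r
        using that by blast
      show ?thesis
      proof (cases "stable \<alpha> r")
        case True
        then show ?thesis using nxt[of \<alpha>] by (simp add: change_at_most_one_def)
      next
        case False
        with 2 obtain y b where y: "y \<in> Y" "r = Var Ask y b" "\<alpha> y \<noteq> b" by (auto simp: stable_def)
        have "change_at_most_one Y \<alpha> (\<alpha>(y := b))" using y by (auto simp: change_at_most_one_def)
        moreover have "stable (\<alpha>(y := b)) (Con R3)" "stable (\<alpha>(y := b)) (Var Ask y b)"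
          using y(1) by (auto simp: stable_def)
        ultimately show ?thesis using winning_request[of y \<alpha> b, OF y(1,3)] nxt y(2) by blast
      qed
    qed
  qed
qed

lemma A_wins_winning:
  assumes "A_wins \<alpha>"
  shows "stable \<alpha> r \<Longrightarrow> winning (cfg (lits \<alpha>) K0) r"
  using assms
proof (induction arbitrary: r)
  case (wins_goal \<alpha>)
  then show ?case by (auto simp: stable_def intro!: winning_satisfied)
next
  case (wins_move_goal \<alpha> \<alpha>')
  show ?case
  proof (rule winning_move[OF A_move[OF wins_move_goal(1)]])
    fix r' assume "nbh r r'" "\<not> attacked (cfg (lits \<alpha>') K0) r'"
    from unattacked_stable[OF stable_A_move this] wins_move_goal show "winning (cfg (lits \<alpha>') K0) r'"
      by (intro winning_after_A_move) blast+
  qed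
next
  case (wins_move \<alpha> \<alpha>')
  show ?case
  proof (rule winning_move[OF A_move[OF wins_move(1)]])
    fix r' assume "nbh r r'" "\<not> attacked (cfg (lits \<alpha>') K0) r'"
    from unattacked_stable[OF stable_A_move this] wins_move show "winning (cfg (lits \<alpha>') K0) r'"
      by (intro winning_after_A_move) blast+
  qed
qed

section \<open>From an arbitrary initial vertex to \<open>R3\<close>\<close>

lemma U_Haven: "v \<in> V \<Longrightarrow> U (lits init v) (Var Haven v True)"
  by (simp add: lits_def U_Var_Var)

text \<open>The last leg of the judge's tour. With all havens attacked, his step leaves one free
  neighbour of \<open>R2\<close>, namely \<open>R3\<close>, where the game proper begins with A to
  move.\<close>

lemma winning_R2:
  assumes "A_wins init"
  shows "winning (cfg (lits init) K2) (Con R2)"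
proof (rule winning_move[OF cmove_judge[of K2 K0]])
  show "E (Con K2) (Con K0)" by (rule judge_moves) simp_all
  fix r' assume "nbh (Con R2) r'" "\<not> attacked (cfg (lits init) K0) r'"
  then have "r' = Con R3" using nbh_R2[of r'] U_K0[of r'] U_Haven unfolding attacked_cfg by blast
  then show "winning (cfg (lits init) K0) r'" using A_wins_winning[OF assms] by (simp add: stable_def)
qed

lemma winning_R1:
  assumes "A_wins init"
  shows "winning (cfg (lits init) K1) (Con R1)"
proof (rule winning_move[OF cmove_judge[of K1 K2]])
  show "E (Con K1) (Con K2)" by (rule judge_moves) simp_all
  fix r' assume "nbh (Con R1) r'" "\<not> attacked (cfg (lits init) K2) r'"
  then have "r' = Con R2" using nbh_R1[of r'] U_K2[of r'] U_Haven unfolding attacked_cfg by blast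
  then show "winning (cfg (lits init) K2) r'" using winning_R2[OF assms] by simp
qed

text \<open>From \<open>Esc y b\<close> the robber may step onto the cops' vertex
  \<open>Lit y b\<close>. The cop of \<open>y\<close> answers with \<open>Mid y\<close>, which
  attacks \<open>Lit y b\<close> and, by its loop, \<open>Mid y\<close>; the judge on
  \<open>K1\<close> attacks the other neighbours. \<open>b \<noteq> init y\<close> excludes the
  haven, which this cop has ceased to guard.\<close>

lemma winning_Lit:
  assumes y: "y \<in> Y" and b: "b \<noteq> init y"
  shows "winning (cfg (lits init) K1) (Var Lit y b)"
proof (rule winning_move[OF cmove_var])
  show "y \<in> V" using y by blast
  show "E (lits init y) (Var Mid y True)" using y by (simp add: lits_def E_def U_Var_Var)
  fix r' assume r': "nbh (Var Lit y b) r'" "\<not> attacked (cfg (mids init y) K1) r'"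
  have "U ((mids init y) y) (Var Lit y b)" "U ((mids init y) y) (Var Mid y True)" using y by (simp_all add: U_Var_Var)
  then have "attacked (cfg (mids init y) K1) (Var Lit y b)" "attacked (cfg (mids init y) K1) (Var Mid y True)"
    using y attacked_var by blast+
  then show "winning (cfg (mids init y) K1) r'"
    using nbh_Lit[OF y r'(1)] b r' U_K1[of r'] y unfolding attacked_cfg by blast
qed

lemma winning_start:
  assumes A: "A_wins init" and r: "is_vert r"
  shows "winning (cfg (lits init) K0) r"
proof (cases "attacked (cfg (lits init) K0) r")
  case True then show ?thesis by (rule winning_attacked)
next
  case unattacked: False
  then have K0: "\<not> U (Con K0) r" by (simp add: attacked_cfg)
  have lit: "\<not> U (lits init v) r" if "v \<in> V" for v using unattacked that by (auto simp: attacked_cfg)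
  consider "stable init r" | (Put) y b where "y \<in> Y" "r = Var Put y b" |
    (Ask) y b where "y \<in> Y" "r = Var Ask y b" | (Esc) y b where "y \<in> Y" "r = Var Esc y b" "b \<noteq> init y" | (R0) "r = Con R0"
  proof (cases r)
    case (Con s)
    then have "r = Con R0 \<or> r = Con R3" using K0 by (cases s) (simp_all add: U_spots)
    then show ?thesis using that by (auto simp: stable_def)
  next
    case (Var k v b)
    have "k \<in> {Lit, Mid, Gate, Haven, Dock} \<Longrightarrow> False"
      using r K0 lit[of v] unfolding Var by (cases k) (auto simp: is_vert_def U_Con_Var U_Var_Var lits_def)
    moreover have "k = Esc \<Longrightarrow> b \<noteq> init v"
      using r lit[of v] unfolding Var by (auto simp: is_vert_def U_Var_Var lits_def)
    moreover have "k \<in> {Ask, Esc, Put} \<Longrightarrow> v \<in> Y" using r Var by (auto simp: is_vert_def)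
    ultimately show ?thesis using that Var by (cases k) simp_all
  next
    case (Clause j)
    then show ?thesis using r K0 by (simp add: is_vert_def U_Con_Clause)
  qed
  then show ?thesis
  proof cases
    case 1 then show ?thesis using A_wins_winning[OF A] by blast
  next
    case Put then show ?thesis using winning_Put by blast
  next
    \<comment> \<open>Granting the request would give B a move before A's first one. The judge
      starts his tour instead: with him on \<open>K1\<close> only \<open>R1\<close> is free.\<close>
    case Ask
    show ?thesis
    proof (rule winning_move[OF cmove_judge[of K0 K1]])
      show "E (Con K0) (Con K1)" by (rule judge_moves) simp_all
      fix r' assume "nbh r r'" "\<not> attacked (cfg (lits init) K1) r'"
      then have "r' = Con R1" using Ask U_K1[of r'] unfolding attacked_cfg Ask(2) nbh_Ask[OF Ask(1)] by blast
      then show "winning (cfg (lits init) K1) r'" using winning_R1[OF A] by simp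
    qed
  next
    case Esc
    show ?thesis
    proof (rule winning_move[OF cmove_judge[of K0 K1]])
      show "E (Con K0) (Con K1)" by (rule judge_moves) simp_all
      fix r' assume r': "nbh r r'" "\<not> attacked (cfg (lits init) K1) r'"
      have "U (lits init y) (Var Mid y True)" using Esc(1) by (simp add: lits_def U_Var_Var)
      then have "r' = Con R1 \<or> r' = Var Lit y b"
        using r' Esc(1) U_K1[of r'] U_Haven unfolding attacked_cfg Esc(2) nbh_Esc[OF Esc(1)] by blast
      then show "winning (cfg (lits init) K1) r'" using winning_R1[OF A] winning_Lit[OF Esc(1,3)] by blast
    qed
  next
    case R0
    show ?thesis
    proof (rule winning_move[OF cmove_judge[of K0 K1]])
      show "E (Con K0) (Con K1)" by (rule judge_moves) simp_all
      fix r' assume "nbh r r'" "\<not> attacked (cfg (lits init) K1) r'"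
      then have "r' = Con R1" using R0 nbh_R0[of r'] U_K1[of r'] U_Haven unfolding attacked_cfg by blast
      then show "winning (cfg (lits init) K1) r'" using winning_R1[OF A] by simp
    qed
  qed
qed

theorem A_wins_cops_win:
  assumes "A_wins init"
  shows "cops_win G"
  unfolding cops_win_iff
proof (intro exI conjI)
  show "length (cfg (lits init) K0) = num_cops G" by (simp add: cfg_def length_vs)
  show "Ball (set (cfg (lits init) K0)) is_vert" by (auto simp: cfg_def lits_def set_vs is_vert_def)
  show "\<forall>r. is_vert r \<longrightarrow> winning (cfg (lits init) K0) r" using winning_start[OF assms] by blast
qed

section \<open>The strategy of the robber\<close>

lemma attackers_spot:
  "U a (Con R0) \<longleftrightarrow> a \<in> Con ` {K1, K2, KX}"
  "U a (Con R1) \<longleftrightarrow> a \<in> Con ` {K0, K2, KX}"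
  "U a (Con R2) \<longleftrightarrow> a \<in> Con ` {K0, K1, KX}"
  "U a (Con R3) \<longleftrightarrow> a \<in> Con ` {K1, K2, KX}"
  "U a (Con R4) \<longleftrightarrow> a \<in> Con ` {K0, K2, KX}"
  "U a (Con R5) \<longleftrightarrow> a \<in> Con ` {K0, K1, KX}"
  "U a (Con HavenK) \<longleftrightarrow> a \<in> Con ` {K0, K1, K2}"
  "U a (Con GateK) \<longleftrightarrow> a \<in> Con ` {K0, K1, K2, KX}"
  unfolding U_sym[of a] by (cases a; simp add: U_spots U_Con_Var U_Con_Clause image_iff)+

lemma U_Clause_Var: "U (Clause j) (Var k v b) \<longleftrightarrow> U (Var k v b) (Clause j)"
  using U_sym by blast

lemma attackers_Gate: "U a (Var Gate v True) \<Longrightarrow> a \<in> Con ` {K1, K2, KX} \<or> (\<exists>c. a = Var Lit v c)"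
  by (cases a) (auto simp: U_Con_Var U_Var_Var U_Clause_Var U_Var_Clause)

lemma attackers_Haven: "U a (Var Haven v True) \<Longrightarrow> a = Var Lit v (init v)"
  by (cases a) (auto simp: U_Con_Var U_Var_Var U_Clause_Var U_Var_Clause)

lemma attackers_Dock: "U a (Var Dock y True) \<Longrightarrow> a \<in> Con ` {K1, K2} \<or> (\<exists>c. a = Var Lit y c)"
  by (cases a) (auto simp: U_Con_Var U_Var_Var U_Clause_Var U_Var_Clause)

lemma attackers_Esc: "U a (Var Esc y b) \<Longrightarrow> a \<in> Con ` {K1, K2, KX} \<or> a = Var Mid y True \<or> a = Var Lit y b"
  by (cases a) (auto simp: U_Con_Var U_Var_Var U_Clause_Var U_Var_Clause)

lemma attackers_Ask: "U a (Var Ask y b) \<Longrightarrow> a \<in> Con ` {K1, K2, KX}"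
  by (cases a) (auto simp: U_Con_Var U_Var_Var U_Clause_Var U_Var_Clause)

lemma attackers_Put: "U a (Var Put y b) \<Longrightarrow> a \<in> Con ` {K1, K2, KX}"
  by (cases a) (auto simp: U_Con_Var U_Var_Var U_Clause_Var U_Var_Clause)

text \<open>What a variable cop cannot do in one move: take the judge's part on \<open>K1\<close>,
  \<open>K2\<close> or \<open>KX\<close>, take the part of another variable cop, or change the value
  of a variable outside \<open>X\<close>.\<close>

lemma E_Lit: "E (Var Lit v c) u \<Longrightarrow> u \<notin> Con ` {K1, K2, KX} \<and>
    (\<forall>w c'. u = Var Lit w c' \<longrightarrow> w = v \<and> (c' = c \<or> v \<in> X)) \<and> (\<forall>w c'. u = Var Mid w c' \<longrightarrow> w = v \<and> c')"
  by (cases u) (auto simp: E_def P_Var_Con U_Var_Con P_Con_Var U_Con_Var P_Var_Var U_Var_Var)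

lemma E_Mid: "E (Var Mid v c) u \<Longrightarrow> u \<notin> Con ` {K1, K2, KX} \<and> (\<forall>w c'. u = Var Lit w c' \<longrightarrow> w = v)"
  by (cases u) (auto simp: E_def P_Var_Con U_Var_Con P_Con_Var U_Con_Var P_Var_Var U_Var_Var)

text \<open>The vertices from which every haven and, for each place of the judge on the triangle, a
  suitable hexagon vertex are within one move. \<open>R3\<close> is missing, having no haven as a
  neighbour.\<close>

definition escape :: "vert \<Rightarrow> bool" where
  "escape r \<longleftrightarrow> r \<in> Con ` {R0, R1, R2, R4, R5, HavenK, GateK} \<or> (\<exists>v\<in>V. r = Var Gate v True \<or> r = Var Haven v True)
   \<or> (\<exists>y\<in>Y. \<exists>b. r = Var Dock y True \<or> r = Var Esc y b) \<or> (\<exists>j<nc. r = Clause j)"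

lemma escape_Haven: "escape r \<Longrightarrow> v \<in> V \<Longrightarrow> nbh r (Var Haven v True)"
  unfolding escape_def nbh_def E_def
  by (elim disjE imageE bexE exE conjE; simp add: P_Con_Var P_Var_Var P_Var_Clause P_sym[of "Clause j" for j])

lemma escape_HavenK: "escape r \<Longrightarrow> nbh r (Con HavenK)"
  unfolding escape_def nbh_def E_def
  by (elim disjE imageE bexE exE conjE; simp add: P_spots P_Var_Con P_Con_Var P_Con_Clause P_sym[of "Clause j" for j];
    elim disjE; simp add: P_spots)

text \<open>From \<open>R2\<close> and \<open>R4\<close> only \<open>R3\<close> is available, so a
  driven robber may have to begin the game. The hexagon vertices of the other two residues all
  belong to \<open>escape\<close>.\<close>

lemma escape_K0: "escape r \<Longrightarrow> nbh r (Con R0) \<or> nbh r (Con R3)"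
  unfolding escape_def nbh_def E_def
  by (elim disjE imageE bexE exE conjE; simp add: P_spots P_Var_Con P_Con_Var P_Con_Clause P_sym[of "Clause j" for j];
    elim disjE; simp add: P_spots)

lemma escape_K1: "escape r \<Longrightarrow> nbh r (Con R1) \<or> nbh r (Con R4)"
  unfolding escape_def nbh_def E_def
  by (elim disjE imageE bexE exE conjE; simp add: P_spots P_Var_Con P_Con_Var P_Con_Clause P_sym[of "Clause j" for j];
    elim disjE; simp add: P_spots)

lemma escape_K2: "escape r \<Longrightarrow> nbh r (Con R2) \<or> nbh r (Con R5)"
  unfolding escape_def nbh_def E_def
  by (elim disjE imageE bexE exE conjE; simp add: P_spots P_Var_Con P_Con_Var P_Con_Clause P_sym[of "Clause j" for j];
    elim disjE; simp add: P_spots)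

definition on_track :: "(nat \<Rightarrow> vert) \<Rightarrow> bool" where
  "on_track l \<longleftrightarrow> (\<forall>v\<in>V. (\<exists>b. l v = Var Lit v b) \<or> l v = Var Mid v True)"

text \<open>A set, unlike the list \<open>cfg\<close>: the cops choose their first places, so it is
  not known which cop plays which part. For \<open>on_track\<close> functions the length forces the
  cops onto different vertices.\<close>

definition placed :: "(nat \<Rightarrow> vert) \<Rightarrow> spot \<Rightarrow> vert list \<Rightarrow> bool" where
  "placed l k as \<longleftrightarrow> length as = num_cops G \<and> set as = insert (Con k) (l ` V)"

lemma on_track_lits: "on_track (lits \<alpha>)" and on_track_mids: "on_track (mids \<alpha> y)"
  by (auto simp: on_track_def lits_def)

lemma card_V: "num_cops G = Suc (card V)" and finite_V: "finite V"
  using set_vs distinct_vs length_vs by (auto simp: distinct_card[symmetric] simp flip: set_vs)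

lemma on_track_inj: "on_track l \<Longrightarrow> inj_on l V"
  by (rule inj_onI) (metis on_track_def vert.inject(2))

lemma on_track_Con: "on_track l \<Longrightarrow> Con k \<notin> l ` V"
proof
  assume "on_track l" "Con k \<in> l ` V"
  then obtain v where "v \<in> V" "l v = Con k" by (metis imageE)
  then show False using \<open>on_track l\<close> unfolding on_track_def by (metis vert.distinct(1))
qed

lemma card_placed: "on_track l \<Longrightarrow> card (insert (Con k) (l ` V)) = num_cops G"
proof -
  assume l: "on_track l"
  from on_track_Con[OF this] show ?thesis using card_image[OF on_track_inj[OF l]] finite_V by (simp add: card_V)
qed

text \<open>There are as many cops as occupied vertices, so the list is distinct and a moving cop
  really vacates his vertex. A move can then be attributed to the cop of one variable or to the
  judge.\<close>

lemma placed_moves: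
  assumes l: "on_track l" and p: "placed l k as" and m: "cmove as as'"
  obtains "placed l k as'"
  | v u where "v \<in> V" "E (l v) u" "length as' = num_cops G" "set as' = insert u (insert (Con k) (l ` (V - {v})))"
  | u where "E (Con k) u" "length as' = num_cops G" "set as' = insert u (l ` V)"
proof -
  have d: "distinct as"
    using card_placed[OF l] p by (intro card_distinct) (auto simp: placed_def)
  note K = on_track_Con[OF l]
  from m consider "as' = as" | i u where "i < length as" "E (as ! i) u" "as' = as[i := u]"
    by (auto simp: cmove_def)
  then show thesis
  proof cases
    case 1 then show ?thesis using that(1) p by blast
  next
    case 2
    have s: "set as' = insert u (set as - {as ! i})" using 2 d by (simp add: set_update_distinct)
    have len: "length as' = num_cops G" using 2 p by (simp add: placed_def)
    have "as ! i \<in> set as" using 2 by simp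
    then consider "as ! i = Con k" | v where "v \<in> V" "as ! i = l v" using p by (auto simp: placed_def)
    then show ?thesis
    proof cases
      case 1
      then show ?thesis using that(3)[of u] 2 s len p K by (auto simp: placed_def)
    next
      case v: 2
      have "l ` V - {l v} = l ` (V - {v})"
        using on_track_inj[OF l] v(1) by (auto simp: inj_on_def)
      then have "set as' = insert u (insert (Con k) (l ` (V - {v})))"
        unfolding s using v K p by (auto simp: placed_def)
      then show ?thesis using that(2)[of v u] 2 v len by simp
    qed
  qed
qed

section \<open>The robber's invariant\<close>

definition safe :: "vert list \<Rightarrow> vert \<Rightarrow> bool" where
  "safe as r \<longleftrightarrow> length as = num_cops G \<and> escape r \<and> \<not> attacked as r"

text \<open>The formula has to be false already under \<open>\<alpha>\<close>, because the judge may
  challenge while the request is open. The last conjunct says that the requested move is good for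
  B.\<close>

definition pending :: "assignment \<Rightarrow> nat \<Rightarrow> bool \<Rightarrow> bool" where
  "pending \<alpha> y b \<longleftrightarrow> y \<in> Y \<and> \<alpha> y \<noteq> b \<and> \<not> cnf_true (formula I) \<alpha> \<and> \<not> A_wins (\<alpha>(y := b))"

definition B_good :: "vert list \<Rightarrow> vert \<Rightarrow> bool" where
  "B_good as r \<longleftrightarrow> safe as r \<or>
     (\<exists>\<alpha>. placed (lits \<alpha>) K0 as \<and> r = Con R3 \<and> \<not> A_wins \<alpha>) \<or>
     (\<exists>\<alpha> y b. placed (lits \<alpha>) K0 as \<and> r = Var Ask y b \<and> pending \<alpha> y b) \<or>
     (\<exists>\<alpha> y b. placed (mids \<alpha> y) K0 as \<and> r = Var Put y b \<and> pending \<alpha> y b)"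

lemma placed_unattacked:
  assumes "placed l k as" "\<not> U (Con k) r" "\<And>v. v \<in> V \<Longrightarrow> \<not> U (l v) r"
  shows "\<not> attacked as r"
  using assms by (auto simp: attacked_def placed_def)

lemma B_good_unattacked: "B_good as r \<Longrightarrow> \<not> attacked as r"
  unfolding B_good_def
proof (elim disjE exE conjE)
  show "\<not> attacked as r" if "safe as r" using that by (simp add: safe_def)
  show "\<not> attacked as r" if "placed (lits \<alpha>) K0 as" "r = Con R3" for \<alpha>
    using that(1) by (rule placed_unattacked) (auto simp: that(2) attackers_spot lits_def)
  show "\<not> attacked as r" if "placed (lits \<alpha>) K0 as" "r = Var Ask y b" for \<alpha> y b
    using that(1) by (rule placed_unattacked) (auto simp: that(2) lits_def dest: attackers_Ask)
  show "\<not> attacked as r" if "placed (mids \<alpha> y) K0 as" "r = Var Put y b" for \<alpha> y b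
    using that(1) by (rule placed_unattacked) (auto simp: that(2) lits_def dest: attackers_Put split: if_splits)
qed

text \<open>An unattacked haven is within reach. If there is none, the cops stand exactly on the
  initial places with the judge on the triangle, and a hexagon vertex is free. It belongs to
  \<open>escape\<close> unless it is \<open>R3\<close> with the judge on \<open>K0\<close>, and then
  \<open>lose\<close> makes the new game good for B.\<close>

lemma safe_step:
  assumes len: "length as = num_cops G" and r: "escape r" and lose: "\<not> A_wins init"
  shows "\<exists>r'. nbh r r' \<and> B_good as r'"
proof -
  consider (V) v where "v \<in> V" "Var Lit v (init v) \<notin> set as" | (K) "set as \<inter> Con ` {K0, K1, K2} = {}"
    | (full) k where "k \<in> {K0, K1, K2}" "Con k \<in> set as" "\<And>v. v \<in> V \<Longrightarrow> lits init v \<in> set as"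
    by (auto simp: lits_def)
  then show ?thesis
  proof cases
    case V
    then have "safe as (Var Haven v True)"
      using len attackers_Haven by (fastforce simp: safe_def escape_def attacked_def)
    then show ?thesis using escape_Haven[OF r V(1)] by (auto simp: B_good_def)
  next
    case K
    then have "safe as (Con HavenK)"
      using len by (auto simp: safe_def escape_def attacked_def attackers_spot)
    then show ?thesis using escape_HavenK[OF r] by (auto simp: B_good_def)
  next
    case full
    \<comment> \<open>Guarding all havens takes one vertex for each variable and one for the judge,
      as many as there are cops; so the inclusion is an equality.\<close>
    have "insert (Con k) (lits init ` V) \<subseteq> set as" using full by blast
    moreover have "card (set as) \<le> card (insert (Con k) (lits init ` V))"
      using card_length[of as] len by (simp add: card_placed[OF on_track_lits])
    ultimately have "insert (Con k) (lits init ` V) = set as" by (intro card_seteq) simp_all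
    then have p: "placed (lits init) k as" using len by (simp add: placed_def)
    have un: "\<not> attacked as (Con s)" if "\<not> U (Con k) (Con s)" "s \<in> {R0, R1, R2, R4, R5}" for s
      using p by (rule placed_unattacked) (use that in \<open>auto simp: attackers_spot lits_def\<close>)
    have sf: "safe as (Con s)" if "\<not> U (Con k) (Con s)" "s \<in> {R0, R1, R2, R4, R5}" for s
      using un[OF that] that(2) len by (auto simp: safe_def escape_def)
    from full(1) consider "k = K0" | "k = K1" | "k = K2" by blast
    then show ?thesis
    proof cases
      case 1
      have "B_good as (Con R3)" using p lose 1 by (auto simp: B_good_def)
      moreover have "B_good as (Con R0)" using sf[of R0] 1 by (simp add: B_good_def U_spots)
      ultimately show ?thesis using escape_K0[OF r] by blast
    next
      case 2
      have "B_good as (Con R1)" "B_good as (Con R4)" using sf[of R1] sf[of R4] 2 by (simp_all add: B_good_def U_spots)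
      then show ?thesis using escape_K1[OF r] by blast
    next
      case 3
      have "B_good as (Con R2)" "B_good as (Con R5)" using sf[of R2] sf[of R5] 3 by (simp_all add: B_good_def U_spots)
      then show ?thesis using escape_K2[OF r] by blast
    qed
  qed
qed

lemma not_A_wins:
  assumes "\<not> A_wins \<alpha>" and "change_at_most_one X \<alpha> \<alpha>'"
  shows "\<not> cnf_true (formula I) \<alpha>'" "\<exists>\<alpha>''. change_at_most_one Y \<alpha>' \<alpha>'' \<and> \<not> A_wins \<alpha>''"
  using assms wins_move_goal[of "change_at_most_one X" \<alpha> \<alpha>' "cnf_true (formula I)" "change_at_most_one Y"]
    wins_move[of "change_at_most_one X" \<alpha> \<alpha>' "change_at_most_one Y" "cnf_true (formula I)"] by blast+

text \<open>The robber copies a good answer of B: a pass, or rewriting the present value, is staying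
  on \<open>R3\<close>; a real change is a request.\<close>

lemma respond:
  assumes p: "placed (lits \<alpha>') K0 as" and "\<not> A_wins \<alpha>" and "change_at_most_one X \<alpha> \<alpha>'"
  shows "\<exists>r'. nbh (Con R3) r' \<and> B_good as r'"
proof -
  note false = not_A_wins(1)[OF assms(2,3)]
  from not_A_wins(2)[OF assms(2,3)] obtain \<alpha>'' where a: "change_at_most_one Y \<alpha>' \<alpha>''" "\<not> A_wins \<alpha>''" by blast
  show ?thesis
  proof (cases "\<alpha>'' = \<alpha>'")
    case True
    then have "B_good as (Con R3)" using p a by (auto simp: B_good_def)
    then show ?thesis by (auto simp: nbh_def)
  next
    case False
    with a obtain y b where y: "y \<in> Y" "\<alpha>'' = \<alpha>'(y := b)" unfolding change_at_most_one_def by blast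
    have "\<alpha>' y \<noteq> b"
    proof
      assume b: "\<alpha>' y = b"
      show False using False y(2) unfolding b[symmetric] fun_upd_triv by contradiction
    qed
    then have "pending \<alpha>' y b" using a(2) false y by (simp add: pending_def)
    then have "B_good as (Var Ask y b)" using p unfolding B_good_def by blast
    moreover have "nbh (Con R3) (Var Ask y b)" using y(1) by (simp add: nbh_R3)
    ultimately show ?thesis by blast
  qed
qed

lemma safe_B_good: "nbh r r' \<Longrightarrow> escape r' \<Longrightarrow> length as = num_cops G \<Longrightarrow> (\<And>a. a \<in> set as \<Longrightarrow> \<not> U a r') \<Longrightarrow>
    \<exists>r'. nbh r r' \<and> B_good as r'"
  unfolding B_good_def safe_def attacked_def by blast

lemma false_clause:
  assumes "\<not> cnf_true (formula I) \<alpha>"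
  obtains j where "j < nc" "\<And>v. \<not> U (lits \<alpha> v) (Clause j)"
proof -
  from assms obtain C where "C \<in> set (formula I)" "\<forall>l\<in>set C. \<alpha> (fst l) \<noteq> snd l"
    by (auto simp: cnf_true_def case_prod_beta)
  then obtain j where j: "j < nc" "\<forall>l\<in>clause j. \<alpha> (fst l) \<noteq> snd l" by (auto simp: in_set_conv_nth)
  then have "\<not> U (lits \<alpha> v) (Clause j)" for v by (force simp: lits_def U_Var_Clause)
  then show thesis using that j(1) by blast
qed

text \<open>Variable cops on \<open>Lit\<close> and \<open>Mid\<close> attack none of the spots used
  here, so only the new vertex \<open>u\<close> of the judge matters. On \<open>K1\<close> or
  \<open>K2\<close> he leaves a hexagon vertex free, and anywhere else he leaves
  \<open>GateK\<close> free.\<close>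

lemma judge_leaves:
  assumes len: "length as = num_cops G" and as: "set as = insert u (l ` V)" and l: "on_track l"
    and u: "u \<noteq> Con K0" "u \<noteq> Con KX" and r: "r = Con R3 \<or> (\<exists>y\<in>Y. \<exists>b. r = Var Ask y b \<or> r = Var Put y b)"
  shows "\<exists>r'. nbh r r' \<and> B_good as r'"
proof -
  have free: "\<not> U a (Con s)" if "a \<in> set as" "\<not> U u (Con s)" "s \<in> {R1, R2, R4, R5, GateK}" for a s
  proof
    assume "U a (Con s)"
    from this that(3) obtain k where k: "a = Con k" by (auto simp: attackers_spot)
    have "a = u \<or> a \<in> l ` V" using that(1) unfolding as by simp
    then show False
    proof
      assume "a = u" then show False using \<open>U a (Con s)\<close> that(2) by simp
    next
      assume "a \<in> l ` V" then show False using on_track_Con[OF l, of k] unfolding k by contradiction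
    qed
  qed
  have n1: "nbh r (Con R1) \<or> nbh r (Con R4)" and n2: "nbh r (Con R2) \<or> nbh r (Con R5)" and n3: "nbh r (Con GateK)"
    using r by (auto simp: nbh_R3 nbh_Ask nbh_Put)
  show ?thesis
  proof (cases "u = Con K1 \<or> u = Con K2")
    case True
    then show ?thesis
    proof
      assume "u = Con K1"
      then have "B_good as (Con R1)" "B_good as (Con R4)"
        using len free[of _ R1] free[of _ R4] by (auto simp: B_good_def safe_def escape_def attacked_def U_spots)
      then show ?thesis using n1 by blast
    next
      assume "u = Con K2"
      then have "B_good as (Con R2)" "B_good as (Con R5)"
        using len free[of _ R2] free[of _ R5] by (auto simp: B_good_def safe_def escape_def attacked_def U_spots)
      then show ?thesis using n2 by blast
    qed
  next
    case False
    then have "\<not> U u (Con GateK)" using u by (auto simp: attackers_spot)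
    then have "B_good as (Con GateK)" using len free[of _ GateK] by (auto simp: B_good_def safe_def escape_def attacked_def)
    then show ?thesis using n3 by blast
  qed
qed

lemma challenge_fails:
  assumes len: "length as = num_cops G" and as: "set as = insert (Con KX) (lits \<alpha> ` V)"
    and false: "\<not> cnf_true (formula I) \<alpha>" and r: "r = Con R3 \<or> (\<exists>y\<in>Y. \<exists>b. r = Var Ask y b)"
  shows "\<exists>r'. nbh r r' \<and> B_good as r'"
proof -
  obtain j where j: "j < nc" "\<And>v. \<not> U (lits \<alpha> v) (Clause j)" using false_clause[OF false] by blast
  show ?thesis
  proof (rule safe_B_good[OF _ _ len])
    show "nbh r (Clause j)" using r j(1) by (auto simp: nbh_R3 nbh_Ask)
    show "escape (Clause j)" using j(1) by (simp add: escape_def)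
    show "\<not> U a (Clause j)" if "a \<in> set as" for a using that j(2) as by (auto simp: U_Con_Clause)
  qed
qed

text \<open>A variable cop who leaves his literals bares \<open>Gate v\<close>, which is next to
  \<open>R3\<close>. Among the literals he can only make moves of A, because the two literals of a
  variable in \<open>Y\<close> are not adjacent.\<close>

lemma base_step:
  assumes p: "placed (lits \<alpha>) K0 as" and B: "\<not> A_wins \<alpha>" and m: "cmove as as'"
  shows "\<exists>r'. nbh (Con R3) r' \<and> B_good as' r'"
proof (rule placed_moves[OF on_track_lits p m])
  have refl: "change_at_most_one X \<alpha> \<alpha>" by (simp add: change_at_most_one_def)
  show ?thesis if "placed (lits \<alpha>) K0 as'" using respond[OF that B refl] .
  show ?thesis if v: "v \<in> V" and u: "E (lits \<alpha> v) u" and len: "length as' = num_cops G"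
      and as': "set as' = insert u (insert (Con K0) (lits \<alpha> ` (V - {v})))" for v u
  proof (cases "\<exists>c. u = Var Lit v c")
    case True
    then obtain c where c: "u = Var Lit v c" by blast
    have "c = \<alpha> v \<or> v \<in> X" using E_Lit[OF u[unfolded lits_def]] c by blast
    then have chg: "change_at_most_one X \<alpha> (\<alpha>(v := c))"
      unfolding change_at_most_one_def using fun_upd_triv[of \<alpha> v] by blast
    have img: "insert u (lits \<alpha> ` (V - {v})) = lits (\<alpha>(v := c)) ` V"
      using v by (simp only: c fun_upd_image if_True flip: lits_upd)
    have "placed (lits (\<alpha>(v := c))) K0 as'" using as' len by (simp only: placed_def insert_commute[of u] img)
    then show ?thesis by (rule respond[OF _ B chg])
  next
    case False
    show ?thesis
    proof (rule safe_B_good[OF _ _ len])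
      show "nbh (Con R3) (Var Gate v True)" using v by (simp add: nbh_R3)
      show "escape (Var Gate v True)" using v by (simp add: escape_def)
      fix a assume a: "a \<in> set as'"
      show "\<not> U a (Var Gate v True)"
      proof
        assume "U a (Var Gate v True)"
        then have bad: "a \<in> Con ` {K1, K2, KX} \<or> (\<exists>c. a = Var Lit v c)" by (rule attackers_Gate)
        have "a = Con K0 \<or> (\<exists>w. w \<noteq> v \<and> a = lits \<alpha> w) \<or> a = u" using a unfolding as' by blast
        then show False
        proof (elim disjE exE conjE)
          assume "a = u" then show False using bad False E_Lit[OF u[unfolded lits_def]] by blast
        qed (use bad in \<open>auto simp: lits_def\<close>)
      qed
    qed
  qed
  show ?thesis if "E (Con K0) u" and len: "length as' = num_cops G" and as': "set as' = insert u (lits \<alpha> ` V)" for u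
  proof -
    consider "u = Con K0" | "u = Con KX" | "u \<noteq> Con K0" "u \<noteq> Con KX" by blast
    then show ?thesis
    proof cases
      case 1
      then have "placed (lits \<alpha>) K0 as'" using len as' by (simp add: placed_def)
      then show ?thesis by (rule respond[OF _ B refl])
    next
      case 2
      show ?thesis
        by (rule challenge_fails[OF len as'[unfolded 2] not_A_wins(1)[OF B refl]]) simp
    next
      case 3
      then show ?thesis by (rule judge_leaves[OF len as' on_track_lits]) simp
    qed
  qed
qed

lemma ask_step:
  assumes p: "placed (lits \<alpha>) K0 as" and pend: "pending \<alpha> y b" and m: "cmove as as'"
  shows "\<exists>r'. nbh (Var Ask y b) r' \<and> B_good as' r'"
proof -
  have y: "y \<in> Y" "\<alpha> y \<noteq> b" "\<not> cnf_true (formula I) \<alpha>" using pend by (auto simp: pending_def)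
  \<comment> \<open>The possible attackers of \<open>Esc y b\<close>. The robber can escape there
    unless the cop of \<open>y\<close> goes to \<open>Mid y\<close> or the judge leaves
    \<open>K0\<close>.\<close>
  define D where "D = {Con K1, Con K2, Con KX, Var Mid y True, Var Lit y b}"
  have esc: ?thesis if "length as' = num_cops G" "set as' \<inter> D = {}"
  proof (rule safe_B_good[OF _ _ that(1)])
    show "nbh (Var Ask y b) (Var Esc y b)" using y by (simp add: nbh_Ask)
    show "escape (Var Esc y b)" using y by (auto simp: escape_def)
    show "\<not> U a (Var Esc y b)" if "a \<in> set as'" for a
      using attackers_Esc[of a y b] \<open>set as' \<inter> D = {}\<close> that unfolding D_def by blast
  qed
  have lit: "lits \<alpha> v \<notin> D" for v
    using y(2) by (auto simp: lits_def D_def)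
  have K0: "Con K0 \<notin> D" by (simp add: D_def)
  have stay: ?thesis if "placed (lits \<alpha>) K0 as'"
    using esc that lit K0 unfolding placed_def by auto
  show ?thesis
  proof (rule placed_moves[OF on_track_lits p m])
    show ?thesis if "placed (lits \<alpha>) K0 as'" using stay[OF that] .
    show ?thesis if v: "v \<in> V" and u: "E (lits \<alpha> v) u" and len: "length as' = num_cops G"
      and as': "set as' = insert u (insert (Con K0) (lits \<alpha> ` (V - {v})))" for v u
    proof (cases "v = y \<and> u = Var Mid y True")
      case True
      then have img: "insert u (lits \<alpha> ` (V - {v})) = mids \<alpha> y ` V"
        using v by (simp only: fun_upd_image if_True)
      have "placed (mids \<alpha> y) K0 as'" using as' len by (simp only: placed_def insert_commute[of u] img)
      then have "B_good as' (Var Put y b)" using pend by (auto simp: B_good_def)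
      moreover have "nbh (Var Ask y b) (Var Put y b)" using y by (simp add: nbh_Ask)
      ultimately show ?thesis by blast
    next
      case False
      have "u \<notin> D"
      proof -
        have "u = Var Mid y True \<Longrightarrow> False" using E_Lit[OF u[unfolded lits_def]] False by blast
        moreover have "u = Var Lit y b \<Longrightarrow> False"
          using E_Lit[OF u[unfolded lits_def]] y(1,2) X_Y_disjoint[of y] by blast
        ultimately show ?thesis using E_Lit[OF u[unfolded lits_def]] unfolding D_def by blast
      qed
      then have "set as' \<inter> D = {}" using lit K0 unfolding as' by auto
      then show ?thesis by (rule esc[OF len])
    qed
    show ?thesis if "E (Con K0) u" and len: "length as' = num_cops G" and as': "set as' = insert u (lits \<alpha> ` V)" for u
    proof -
      consider "u = Con K0" | "u = Con KX" | "u \<noteq> Con K0" "u \<noteq> Con KX" by blast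
      then show ?thesis
      proof cases
        case 1
        then show ?thesis using stay len as' by (simp add: placed_def)
      next
        case 2
        show ?thesis
          by (rule challenge_fails[OF len as'[unfolded 2] y(3)]) (use y(1) in blast)
      next
        case 3
        then show ?thesis by (rule judge_leaves[OF len as' on_track_lits]) (use y(1) in blast)
      qed
    qed
  qed
qed

lemma put_step:
  assumes p: "placed (mids \<alpha> y) K0 as" and pend: "pending \<alpha> y b" and m: "cmove as as'"
  shows "\<exists>r'. nbh (Var Put y b) r' \<and> B_good as' r'"
proof -
  have y: "y \<in> Y" "\<alpha> y \<noteq> b" and lose: "\<not> A_wins (\<alpha>(y := b))" using pend by (auto simp: pending_def)
  \<comment> \<open>The possible attackers of \<open>Dock y True\<close>. \<open>KX\<close> is not
    among them, so a challenge in the middle of a request fails.\<close>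
  define D where "D = {Con K1, Con K2} \<union> range (Var Lit y)"
  have dock: ?thesis if "length as' = num_cops G" "set as' \<inter> D = {}"
  proof (rule safe_B_good[OF _ _ that(1)])
    show "nbh (Var Put y b) (Var Dock y True)" using y by (simp add: nbh_Put)
    show "escape (Var Dock y True)" using y by (auto simp: escape_def)
    show "\<not> U a (Var Dock y True)" if "a \<in> set as'" for a
      using attackers_Dock[of a y] \<open>set as' \<inter> D = {}\<close> that unfolding D_def by blast
  qed
  have lit: "mids \<alpha> y v \<notin> D" for v
    by (auto simp: lits_def D_def)
  have judge: ?thesis if "length as' = num_cops G" "set as' = insert (Con k) (mids \<alpha> y ` V)" "k \<in> {K0, KX}" for k
  proof (rule dock[OF that(1)])
    have "Con k \<notin> D" using that(3) by (auto simp: D_def)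
    then show "set as' \<inter> D = {}" using lit unfolding that(2) by (auto simp del: fun_upd_apply)
  qed
  show ?thesis
  proof (rule placed_moves[OF on_track_mids p m])
    show ?thesis if "placed (mids \<alpha> y) K0 as'" using judge[of K0] that by (simp add: placed_def)
    show ?thesis if v: "v \<in> V" and u: "E (mids \<alpha> y v) u" and len: "length as' = num_cops G"
      and as': "set as' = insert u (insert (Con K0) (mids \<alpha> y ` (V - {v})))" for v u
    proof (cases "v = y \<and> (\<exists>c. u = Var Lit y c)")
      case True
      then obtain c where c: "v = y" "u = Var Lit y c" by blast
      have img: "insert u (mids \<alpha> y ` (V - {v})) = lits (\<alpha>(y := c)) ` V"
        using v by (simp only: c fun_upd_image if_True fun_upd_upd flip: lits_upd) auto
      have pl: "placed (lits (\<alpha>(y := c))) K0 as'" using as' len by (simp only: placed_def insert_commute[of u] img)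
      show ?thesis
      proof (cases "c = b")
        case True
        then have "B_good as' (Con R3)" using pl lose by (auto simp: B_good_def)
        moreover have "nbh (Var Put y b) (Con R3)" using y by (simp add: nbh_Put)
        ultimately show ?thesis by blast
      next
        \<comment> \<open>The cop has gone back to the old value, so the robber repeats the
          request.\<close>
        case False
        then have "c = \<alpha> y" using y(2) by auto
        then have "\<alpha>(y := c) = \<alpha>" by simp
        then have "B_good as' (Var Ask y b)" using pl pend by (auto simp: B_good_def)
        moreover have "nbh (Var Put y b) (Var Ask y b)" using y by (simp add: nbh_Put)
        ultimately show ?thesis by blast
      qed
    next
      case False
      have "u \<notin> D"
      proof (cases "v = y")
        case True
        then have "E (Var Mid y True) u" using u by simp
        from E_Mid[OF this] show ?thesis using False True unfolding D_def by blast
      next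
        case neq: False
        then have "E (Var Lit v (\<alpha> v)) u" using u by (simp add: lits_def)
        from E_Lit[OF this] neq show ?thesis unfolding D_def by blast
      qed
      moreover have "Con K0 \<notin> D" by (auto simp: D_def)
      ultimately have "set as' \<inter> D = {}" using lit unfolding as' by (auto simp del: fun_upd_apply)
      then show ?thesis by (rule dock[OF len])
    qed
    show ?thesis if "E (Con K0) u" and len: "length as' = num_cops G" and as': "set as' = insert u (mids \<alpha> y ` V)" for u
    proof -
      consider "u = Con K0" | "u = Con KX" | "u \<noteq> Con K0" "u \<noteq> Con KX" by blast
      then show ?thesis
      proof cases
        case 1
        then show ?thesis using judge[OF len, of K0] as' by simp
      next
        case 2
        then show ?thesis using judge[OF len, of KX] as' by simp
      next
        case 3
        then show ?thesis by (rule judge_leaves[OF len as' on_track_mids]) (use y(1) in blast)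
      qed
    qed
  qed
qed

theorem B_wins_robber_wins:
  assumes lose: "\<not> A_wins init"
  shows "\<not> cops_win G"
proof
  assume "cops_win G"
  then obtain as where as: "length as = num_cops G" "\<And>r. is_vert r \<Longrightarrow> winning as r"
    unfolding cops_win_iff by blast
  \<comment> \<open>The placement \<open>as\<close> is arbitrary. The robber begins where his answer
    from \<open>HavenK\<close> would have led him.\<close>
  obtain r where r: "nbh (Con HavenK) r" "B_good as r"
    using safe_step[OF as(1) _ lose, of "Con HavenK"] by (auto simp: escape_def)
  have "is_vert r"
    using r(1) E_is_vert[of "Con HavenK" r] by (cases "r = Con HavenK") (simp add: is_vert_def, simp add: nbh_def)
  moreover have "\<not> winning as r"
  proof (rule not_winning[where Inv = B_good, OF r(2) B_good_unattacked])
    fix as as' r assume "B_good as r" and m: "cmove as as'"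
    then show "\<exists>r'. nbh r r' \<and> B_good as' r'"
      unfolding B_good_def[of as]
    proof (elim disjE exE conjE)
      assume "safe as r"
      then have "length as' = num_cops G" "escape r" using m by (auto simp: safe_def cmove_def)
      then show ?thesis using safe_step lose by blast
    qed (use base_step ask_step put_step m in blast)+
  qed
  ultimately show False using as(2) by blast
qed

theorem reduction_correct: "player_A_wins I \<longleftrightarrow> cops_win G"
proof -
  have "player_A_wins I \<longleftrightarrow> A_wins init"
    unfolding player_A_wins_def
    using winning_strategy_imp_wins wins_imp_winning_strategy[of "change_at_most_one X"]
    by (metis change_at_most_one_def)
  then show ?thesis using A_wins_cops_win B_wins_robber_wins by blast
qed

end

section \<open>Multi-head transducers\<close>

text \<open>Input is read-only and output is never read back, so a configuration is a program
  address together with the head positions. For a fixed program there are polynomially many, and no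
  running times have to be counted.\<close>

datatype cmd = Skip | Out sym | Copy nat | Rt nat | Lf nat | Seq cmd cmd (infixr ";;" 60)
  | Test nat "sym set" cmd cmd | Loop nat "sym set" cmd

text \<open>A head is a zipper: the cells to its left in reverse order, and the remaining cells from its
  position on. Beyond the listed cells the tape is blank.\<close>

type_synonym heads = "nat \<Rightarrow> sym list \<times> sym list"

definition rd :: "sym list \<times> sym list \<Rightarrow> sym" where
  "rd z = (case snd z of [] \<Rightarrow> Blank | a # r \<Rightarrow> a)"

text \<open>No rule moves a head left from cell 0, or right when no listed cell is ahead. So a
  derivation certifies both termination and that the heads stay within the tape.\<close>

inductive ev :: "cmd \<Rightarrow> heads \<Rightarrow> sym list \<Rightarrow> heads \<Rightarrow> bool" where
  ev_Skip: "ev Skip s [] s"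
| ev_Out: "ev (Out a) s [a] s"
| ev_Copy: "ev (Copy h) s [rd (s h)] s"
| ev_Rt: "s h = (l, a # r) \<Longrightarrow> ev (Rt h) s [] (s(h := (a # l, r)))"
| ev_Lf: "s h = (a # l, r) \<Longrightarrow> ev (Lf h) s [] (s(h := (l, a # r)))"
| ev_Seq: "ev c s u s' \<Longrightarrow> ev d s' v s'' \<Longrightarrow> ev (c ;; d) s (u @ v) s''"
| ev_Test_True: "rd (s h) \<in> S \<Longrightarrow> ev c s u s' \<Longrightarrow> ev (Test h S c d) s u s'"
| ev_Test_False: "rd (s h) \<notin> S \<Longrightarrow> ev d s u s' \<Longrightarrow> ev (Test h S c d) s u s'"
| ev_Loop_exit: "rd (s h) \<notin> S \<Longrightarrow> ev (Loop h S c) s [] s"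
| ev_Loop: "rd (s h) \<in> S \<Longrightarrow> ev c s u s' \<Longrightarrow> ev (Loop h S c) s' v s'' \<Longrightarrow> ev (Loop h S c) s (u @ v) s''"

primrec heads_below :: "nat \<Rightarrow> cmd \<Rightarrow> bool" where
  "heads_below k Skip = True"
| "heads_below k (Out a) = True"
| "heads_below k (Copy h) = (h < k)"
| "heads_below k (Rt h) = (h < k)"
| "heads_below k (Lf h) = (h < k)"
| "heads_below k (c ;; d) = (heads_below k c \<and> heads_below k d)"
| "heads_below k (Test h S c d) = (h < k \<and> heads_below k c \<and> heads_below k d)"
| "heads_below k (Loop h S c) = (h < k \<and> heads_below k c)"

section \<open>Compilation to code with jumps\<close>

datatype instr = IOut sym | ICopy nat | IRt nat | ILf nat | IBranch nat "sym set" nat | IJump nat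

primrec len :: "cmd \<Rightarrow> nat" where
  "len Skip = 0"
| "len (Out a) = 1"
| "len (Copy h) = 1"
| "len (Rt h) = 1"
| "len (Lf h) = 1"
| "len (c ;; d) = len c + len d"
| "len (Test h S c d) = len c + len d + 2"
| "len (Loop h S c) = len c + 2"

text \<open>The second argument is the address of the first instruction.\<close>

primrec compile :: "cmd \<Rightarrow> nat \<Rightarrow> instr list" where
  "compile Skip a = []"
| "compile (Out x) a = [IOut x]"
| "compile (Copy h) a = [ICopy h]"
| "compile (Rt h) a = [IRt h]"
| "compile (Lf h) a = [ILf h]"
| "compile (c ;; d) a = compile c a @ compile d (a + len c)"
| "compile (Test h S c d) a =
    IBranch h S (a + len c + 2) # compile c (a + 1) @ [IJump (a + len c + len d + 2)] @ compile d (a + len c + 2)"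
| "compile (Loop h S c) a = IBranch h S (a + len c + 2) # compile c (a + 1) @ [IJump a]"

lemma length_compile [simp]: "length (compile c a) = len c"
  by (induction c arbitrary: a) simp_all

text \<open>Addresses start at 3 because states 0, 1 and 2 of the Turing machine copy its input.\<close>

definition target :: "instr list \<Rightarrow> sym list \<Rightarrow> nat \<times> nat list \<Rightarrow> nat \<times> nat list" where
  "target P t = (\<lambda>(q, p). case P ! (q - 3) of
       IOut a \<Rightarrow> (q + 1, p) | ICopy h \<Rightarrow> (q + 1, p)
     | IRt h \<Rightarrow> (q + 1, p[h := p ! h + 1]) | ILf h \<Rightarrow> (q + 1, p[h := p ! h - 1])
     | IBranch h S a \<Rightarrow> (if word_on_tape t (p ! h) \<in> S then q + 1 else min a (length P + 3), p)
     | IJump a \<Rightarrow> (min a (length P + 3), p))"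

definition emit :: "instr list \<Rightarrow> sym list \<Rightarrow> nat \<times> nat list \<Rightarrow> sym list" where
  "emit P t = (\<lambda>(q, p). case P ! (q - 3) of
       IOut a \<Rightarrow> [a] | ICopy h \<Rightarrow> [word_on_tape t (p ! h)] | _ \<Rightarrow> [])"

text \<open>A head may stand on the first cell behind the tape; hence \<open>length t\<close> is
  included, which gives \<open>Suc (length t)\<close> positions for each head.\<close>

definition running :: "instr list \<Rightarrow> sym list \<Rightarrow> nat \<Rightarrow> (nat \<times> nat list) set" where
  "running P t k = {3..<length P + 3} \<times> {p. set p \<subseteq> {..length t} \<and> length p = k}"

inductive reach :: "instr list \<Rightarrow> sym list \<Rightarrow> nat \<Rightarrow> nat \<Rightarrow> nat \<times> nat list \<Rightarrow> sym list \<Rightarrow> nat \<times> nat list \<Rightarrow> bool"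
  for P t k where
  reach_0: "reach P t k 0 x [] x"
| reach_Suc: "x \<in> running P t k \<Longrightarrow> reach P t k n (target P t x) u y \<Longrightarrow> reach P t k (Suc n) x (emit P t x @ u) y"

lemma reach_trans: "reach P t k m x u y \<Longrightarrow> reach P t k n y v z \<Longrightarrow> reach P t k (m + n) x (u @ v) z"
  by (induction rule: reach.induct) (auto intro: reach.intros)

lemma reach_funpow: "reach P t k n x u y \<Longrightarrow> y = (target P t ^^ n) x \<and> (\<forall>i<n. (target P t ^^ i) x \<in> running P t k)"
proof (induction rule: reach.induct)
  case (reach_Suc x n u y)
  then show ?case by (auto simp: funpow_swap1 less_Suc_eq_0_disj)
qed simp

text \<open>If steps \<open>i < j\<close> had the same configuration, the last \<open>n - j\<close>
  steps could be carried out from step \<open>i\<close>, and \<open>y\<close> would appear at time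
  \<open>n - j + i < n\<close>, when only running configurations occur.\<close>

lemma reach_bound:
  assumes "reach P t k n x u y" and "y \<notin> running P t k"
  shows "n \<le> length P * Suc (length t) ^ k"
proof -
  let ?F = "\<lambda>i. (target P t ^^ i) x"
  have y: "y = ?F n" and r: "\<And>i. i < n \<Longrightarrow> ?F i \<in> running P t k" using reach_funpow[OF assms(1)] by auto
  have neq: "?F i \<noteq> ?F j" if "i < j" "j < n" for i j
  proof
    assume e: "?F i = ?F j"
    have "?F (n - j + i) = (target P t ^^ (n - j)) (?F i)" by (simp add: funpow_add)
    also have "\<dots> = ?F (n - j + j)" unfolding e by (simp add: funpow_add)
    finally have "?F (n - j + i) = y" using that y by simp
    moreover have "n - j + i < n" using that by linarith
    ultimately show False using r assms(2) by blast
  qed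
  have "inj_on ?F {..<n}"
    using neq by (intro inj_onI) (metis lessThan_iff linorder_neqE_nat)
  moreover have "?F ` {..<n} \<subseteq> running P t k" using r by auto
  moreover have "finite (running P t k)" by (simp add: running_def finite_lists_length_eq)
  ultimately have "card {..<n} \<le> card (running P t k)" by (rule card_inj_on_le)
  then show ?thesis by (simp add: running_def card_cartesian_product card_lists_length_eq)
qed

definition tape_inv :: "sym list \<Rightarrow> heads \<Rightarrow> bool" where
  "tape_inv t s \<longleftrightarrow> (\<forall>h. rev (fst (s h)) @ snd (s h) = t)"

definition positions :: "nat \<Rightarrow> heads \<Rightarrow> nat list" where
  "positions k s = map (\<lambda>h. length (fst (s h))) [0..<k]"

lemma tape_inv_ev: "ev c s u s' \<Longrightarrow> tape_inv t s \<Longrightarrow> tape_inv t s'"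
proof (induction rule: ev.induct)
  case (ev_Rt s h l a r)
  then have "rev l @ a # r = t" by (auto simp: tape_inv_def dest!: spec[of _ h])
  then show ?case using ev_Rt by (simp add: tape_inv_def)
next
  case (ev_Lf s h a l r)
  then have "rev l @ a # r = t" by (auto simp: tape_inv_def dest!: spec[of _ h])
  then show ?case using ev_Lf by (simp add: tape_inv_def)
qed auto

lemma rd_positions: "tape_inv t s \<Longrightarrow> h < k \<Longrightarrow> word_on_tape t (positions k s ! h) = rd (s h)"
proof -
  assume "tape_inv t s" "h < k"
  then have t: "t = rev (fst (s h)) @ snd (s h)" by (simp add: tape_inv_def)
  show ?thesis using \<open>h < k\<close>
    by (auto simp: t positions_def word_on_tape_def rd_def nth_append split: list.split)
qed

lemma positions_running: "tape_inv t s \<Longrightarrow> 3 \<le> q \<Longrightarrow> q < length P + 3 \<Longrightarrow> (q, positions k s) \<in> running P t k"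
proof -
  assume inv: "tape_inv t s" and q: "3 \<le> q" "q < length P + 3"
  have "length (fst (s h)) \<le> length t" for h
    using inv by (metis tape_inv_def length_append length_rev le_add1)
  then show ?thesis using q by (auto simp: running_def positions_def)
qed

lemma positions_upd: "h < k \<Longrightarrow> positions k (s(h := z)) = (positions k s)[h := length (fst z)]"
  by (intro nth_equalityI) (auto simp: positions_def nth_list_update)

lemma reach_instr:
  assumes "tape_inv t s" and "P = xs @ i # ys"
  shows "reach P t k n (target P t (length xs + 3, positions k s)) u y \<Longrightarrow>
    reach P t k (Suc n) (length xs + 3, positions k s) (emit P t (length xs + 3, positions k s) @ u) y"
  using assms positions_running[of t s "length xs + 3" P k] by (intro reach_Suc) auto

lemma reach_one:
  assumes "tape_inv t s" and "P = xs @ i # ys" and "target P t (length xs + 3, positions k s) = y"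
    and "emit P t (length xs + 3, positions k s) = u"
  shows "reach P t k 1 (length xs + 3, positions k s) u y"
  using reach_instr[OF assms(1,2) reach_0, where k = k] assms(3,4) by simp

text \<open>The code lies in arbitrary surroundings \<open>xs\<close> and \<open>ys\<close>, as the
  induction requires for the parts of compound commands. The number of steps is left open here and
  bounded by \<open>reach_bound\<close>.\<close>

lemma compile_correct:
  "ev c s u s' \<Longrightarrow> tape_inv t s \<Longrightarrow> heads_below k c \<Longrightarrow> P = xs @ compile c (length xs + 3) @ ys \<Longrightarrow>
    \<exists>n. reach P t k n (length xs + 3, positions k s) u (length xs + 3 + len c, positions k s')"
proof (induction arbitrary: xs ys rule: ev.induct)
  case (ev_Skip s)
  then show ?case using reach_0 by force
next
  case (ev_Out a s)
  then have "reach P t k 1 (length xs + 3, positions k s) [a] (length xs + 4, positions k s)"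
    by (intro reach_one[where i = "IOut a"]) (auto simp: target_def emit_def)
  then show ?case by (auto simp: add.commute)
next
  case (ev_Copy h s)
  then have "reach P t k 1 (length xs + 3, positions k s) [rd (s h)] (length xs + 4, positions k s)"
    by (intro reach_one[where i = "ICopy h"]) (auto simp: target_def emit_def rd_positions)
  then show ?case by (auto simp: add.commute)
next
  case (ev_Rt s h l a r)
  then have "reach P t k 1 (length xs + 3, positions k s) [] (length xs + 4, positions k (s(h := (a # l, r))))"
    by (intro reach_one[where i = "IRt h"]) (auto simp: target_def emit_def positions_upd, simp add: positions_def)
  then show ?case by (intro exI[of _ 1]) (simp add: add.commute del: fun_upd_apply)
next
  case (ev_Lf s h a l r)
  then have "reach P t k 1 (length xs + 3, positions k s) [] (length xs + 4, positions k (s(h := (l, a # r))))"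
    by (intro reach_one[where i = "ILf h"]) (auto simp: target_def emit_def positions_upd, simp add: positions_def)
  then show ?case by (intro exI[of _ 1]) (simp add: add.commute del: fun_upd_apply)
next
  case (ev_Seq c s u s' d v s'')
  obtain m where m: "reach P t k m (length xs + 3, positions k s) u (length xs + 3 + len c, positions k s')"
    using ev_Seq.IH(1)[of xs "compile d (length xs + 3 + len c) @ ys"] ev_Seq.prems by auto
  obtain n where n: "reach P t k n (length xs + 3 + len c, positions k s') v (length xs + 3 + len c + len d, positions k s'')"
    using ev_Seq.IH(2)[of "xs @ compile c (length xs + 3)" ys] ev_Seq.prems tape_inv_ev[OF ev_Seq.hyps(1)]
    by (auto simp: add_ac)
  show ?case using reach_trans[OF m n] by (auto simp: add_ac)
next
  case (ev_Test_True s h S c u s' d)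
  let ?q = "length xs + 3"
  have P: "P = (xs @ [IBranch h S (?q + len c + 2)]) @ compile c (?q + 1) @
      [IJump (?q + len c + len d + 2)] @ compile d (?q + len c + 2) @ ys"
    using ev_Test_True.prems by simp
  have br: "reach P t k 1 (?q, positions k s) [] (?q + 1, positions k s)"
    using ev_Test_True.prems ev_Test_True.hyps
    by (intro reach_one[where i = "IBranch h S (?q + len c + 2)"]) (auto simp: target_def emit_def rd_positions)
  obtain n where n: "reach P t k n (?q + 1, positions k s) u (?q + 1 + len c, positions k s')"
    using ev_Test_True.IH[of "xs @ [IBranch h S (?q + len c + 2)]"] ev_Test_True.prems P by (auto simp: add_ac)
  have jmp: "reach P t k 1 (?q + 1 + len c, positions k s') [] (?q + len c + len d + 2, positions k s')"
    using reach_one[where xs = "(xs @ [IBranch h S (?q + len c + 2)]) @ compile c (?q + 1)" and P = P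
        and i = "IJump (?q + len c + len d + 2)" and t = t and s = s' and k = k and u = "[]"
        and y = "(?q + len c + len d + 2, positions k s')"]
      P tape_inv_ev[OF ev_Test_True.hyps(2) ev_Test_True.prems(1)]
    by (auto simp: target_def emit_def nth_append add_ac)
  show ?case using reach_trans[OF reach_trans[OF br n] jmp] by (auto simp: add_ac)
next
  case (ev_Test_False s h S d u s' c)
  let ?q = "length xs + 3"
  have P: "P = (xs @ IBranch h S (?q + len c + 2) # compile c (?q + 1) @ [IJump (?q + len c + len d + 2)]) @
      compile d (?q + len c + 2) @ ys"
    using ev_Test_False.prems by simp
  have br: "reach P t k 1 (?q, positions k s) [] (?q + len c + 2, positions k s)"
    using ev_Test_False.prems ev_Test_False.hyps
    by (intro reach_one[where i = "IBranch h S (?q + len c + 2)"]) (auto simp: target_def emit_def rd_positions)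
  obtain n where n: "reach P t k n (?q + len c + 2, positions k s) u (?q + len c + 2 + len d, positions k s')"
    using ev_Test_False.IH[of "xs @ IBranch h S (?q + len c + 2) # compile c (?q + 1) @ [IJump (?q + len c + len d + 2)]" ys]
      ev_Test_False.prems P by (auto simp: add_ac)
  show ?case using reach_trans[OF br n] by (auto simp: add_ac)
next
  case (ev_Loop_exit s h S c)
  let ?q = "length xs + 3"
  have br: "reach P t k 1 (?q, positions k s) [] (?q + len c + 2, positions k s)"
    using ev_Loop_exit
    by (intro reach_one[where i = "IBranch h S (?q + len c + 2)"]) (auto simp: target_def emit_def rd_positions)
  then show ?case by (auto simp: add_ac)
next
  case (ev_Loop s h S c u s' v s'')
  let ?q = "length xs + 3"
  have P: "P = (xs @ [IBranch h S (?q + len c + 2)]) @ compile c (?q + 1) @ [IJump ?q] @ ys"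
    using ev_Loop.prems by simp
  have br: "reach P t k 1 (?q, positions k s) [] (?q + 1, positions k s)"
    using ev_Loop.prems ev_Loop.hyps
    by (intro reach_one[where i = "IBranch h S (?q + len c + 2)"]) (auto simp: target_def emit_def rd_positions)
  obtain n where n: "reach P t k n (?q + 1, positions k s) u (?q + 1 + len c, positions k s')"
    using ev_Loop.IH(1)[of "xs @ [IBranch h S (?q + len c + 2)]"] ev_Loop.prems P by (auto simp: add_ac)
  have inv: "tape_inv t s'" using tape_inv_ev[OF ev_Loop.hyps(2) ev_Loop.prems(1)] .
  have jmp: "reach P t k 1 (?q + 1 + len c, positions k s') [] (?q, positions k s')"
    using reach_one[where xs = "(xs @ [IBranch h S (?q + len c + 2)]) @ compile c (?q + 1)" and P = P
        and i = "IJump ?q" and t = t and s = s' and k = k and u = "[]" and y = "(?q, positions k s')"]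
      P inv
    by (auto simp: target_def emit_def nth_append add_ac)
  obtain m where m: "reach P t k m (?q, positions k s') v (?q + len (Loop h S c), positions k s'')"
    using ev_Loop.IH(2)[of xs ys] ev_Loop.prems inv by auto
  show ?case using reach_trans[OF reach_trans[OF reach_trans[OF br n] jmp] m] by auto
qed

section \<open>Simulation by a Turing machine\<close>

definition keep :: "sym list \<Rightarrow> (sym \<times> dir) list" where
  "keep ss = map (\<lambda>a. (a, Stay)) ss"

definition instr_acts :: "instr \<Rightarrow> sym list \<Rightarrow> (sym \<times> dir) list" where
  "instr_acts i ss = (case i of
       IOut a \<Rightarrow> (keep ss)[1 := (a, MoveRight)] | ICopy h \<Rightarrow> (keep ss)[1 := (ss ! (h + 2), MoveRight)]
     | IRt h \<Rightarrow> (keep ss)[h + 2 := (ss ! (h + 2), MoveRight)]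
     | ILf h \<Rightarrow> (keep ss)[h + 2 := (ss ! (h + 2), MoveLeft)]
     | _ \<Rightarrow> keep ss)"

text \<open>Clipping at the halting state \<open>m\<close> serves \<open>wf_tm\<close>, which is to
  hold for arbitrary lists of instructions; jumps of compiled code do not exceed
  \<open>m\<close>.\<close>

definition instr_next :: "nat \<Rightarrow> nat \<Rightarrow> instr \<Rightarrow> sym list \<Rightarrow> nat" where
  "instr_next m q i ss = (case i of
       IBranch h S a \<Rightarrow> if ss ! (h + 2) \<in> S then q + 1 else min a m | IJump a \<Rightarrow> min a m | _ \<Rightarrow> q + 1)"

text \<open>Tape 0 holds the input, tape 1 the output. The heads of the program read \<open>k\<close> copies of the
  input, each shifted by one cell, so that the left end of a copy is marked by a blank.\<close>

definition machine :: "nat \<Rightarrow> instr list \<Rightarrow> tm" where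
  "machine k P = \<lparr>ntapes = k + 2, nstates = length P + 3, delta = (\<lambda>q ss.
     if q = 0 then (1, take 2 (keep ss) @ replicate k (Blank, MoveRight))
     else if q = 1 then
       if ss ! 0 = Blank then (2, take 2 (keep ss) @ map (\<lambda>a. (a, MoveLeft)) (drop 2 ss))
       else (1, [(ss ! 0, MoveRight), (ss ! 1, Stay)] @ replicate k (ss ! 0, MoveRight))
     else if q = 2 then
       if ss ! 2 = Blank then (3, keep ss)
       else (2, take 2 (keep ss) @ map (\<lambda>a. (a, MoveLeft)) (drop 2 ss))
     else (instr_next (length P + 3) q (P ! (q - 3)) ss, instr_acts (P ! (q - 3)) ss))\<rparr>"

lemma wf_machine: "wf_tm (machine k P)"
  by (auto simp: wf_tm_def machine_def keep_def instr_next_def instr_acts_def split: instr.split)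

primrec instr_below :: "nat \<Rightarrow> instr \<Rightarrow> bool" where
  "instr_below k (IOut a) = True"
| "instr_below k (ICopy h) = (h < k)"
| "instr_below k (IRt h) = (h < k)"
| "instr_below k (ILf h) = (h < k)"
| "instr_below k (IBranch h S a) = (h < k)"
| "instr_below k (IJump a) = True"

lemma instr_below_compile: "heads_below k c \<Longrightarrow> i \<in> set (compile c a) \<Longrightarrow> instr_below k i"
  by (induction c arbitrary: a) auto

lemma word_on_tape_snoc: "(word_on_tape u)(length u := a) = word_on_tape (u @ [a])"
  by (auto simp: word_on_tape_def nth_append)

definition config :: "sym list \<Rightarrow> sym list \<Rightarrow> nat \<times> nat list \<Rightarrow> sym list \<Rightarrow> tm_config" where
  "config w t x u = (fst x, (word_on_tape w, length w) # (word_on_tape u, length u) #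
     map (\<lambda>i. (word_on_tape t, i)) (snd x))"

lemma act_keep: "map2 act (keep (map (\<lambda>(t, h). t h) ts)) ts = ts"
  by (rule nth_equalityI) (auto simp: keep_def split: prod.split)

lemma act_update: "length as = length ts \<Longrightarrow>
    map2 act (as[j := a]) ts = (map2 act as ts)[j := act a (ts ! j)]"
  by (rule nth_equalityI; simp; case_tac "i = j"; simp)

lemma tm_step_config:
  assumes x: "x \<in> running P t k" and P: "\<forall>i\<in>set P. instr_below k i"
  shows "tm_step (machine k P) (config w t x u) = config w t (target P t x) (u @ emit P t x)"
proof -
  obtain q p where [simp]: "x = (q, p)" by (cases x)
  have q: "3 \<le> q" "q < length P + 3" and p: "length p = k" using x by (auto simp: running_def)
  let ?i = "P ! (q - 3)"
  have i: "instr_below k ?i" using P q nth_mem[of "q - 3" P] by auto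
  define ts where "ts = (word_on_tape w, length w) # (word_on_tape u, length u) # map (\<lambda>i. (word_on_tape t, i)) p"
  define ss where "ss = map (\<lambda>(t, h). t h) ts"
  have rd: "ss ! Suc (Suc h) = word_on_tape t (p ! h)" and ts: "ts ! Suc (Suc h) = (word_on_tape t, p ! h)" if "h < k" for h
    using that p by (auto simp: ss_def ts_def)
  have step: "tm_step (machine k P) (q, ts) = (instr_next (length P + 3) q ?i ss, map2 act (instr_acts ?i ss) ts)"
    using q by (simp add: machine_def ss_def)
  have acts: "map2 act (instr_acts ?i ss) ts = (case ?i of
       IOut a \<Rightarrow> ts[1 := act (a, MoveRight) (ts ! 1)] | ICopy h \<Rightarrow> ts[1 := act (ss ! (h + 2), MoveRight) (ts ! 1)]
     | IRt h \<Rightarrow> ts[h + 2 := act (ss ! (h + 2), MoveRight) (ts ! (h + 2))]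
     | ILf h \<Rightarrow> ts[h + 2 := act (ss ! (h + 2), MoveLeft) (ts ! (h + 2))]
     | _ \<Rightarrow> ts)"
    using act_keep[of ts] act_update[of "keep ss" ts] by (auto simp: instr_acts_def keep_def ss_def split: instr.split)
  have ts1: "ts ! Suc 0 = (word_on_tape u, length u)" by (simp add: ts_def)
  have u1: "ts[Suc 0 := (word_on_tape v, n)] = (word_on_tape w, length w) # (word_on_tape v, n) # map (\<lambda>i. (word_on_tape t, i)) p" for v n
    by (simp add: ts_def)
  have u2: "ts[Suc (Suc h) := (word_on_tape t, n)] = (word_on_tape w, length w) # (word_on_tape u, length u) #
      map (\<lambda>i. (word_on_tape t, i)) (p[h := n])" for h n
    by (simp add: ts_def map_update)
  have c: "config w t x u = (q, ts)" by (simp add: config_def ts_def)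
  have t0: "(q', ts) = config w t (q', p) u" for q' by (simp add: config_def ts_def)
  show ?thesis
    unfolding c step acts using i
    by (cases ?i) (simp_all add: target_def emit_def instr_next_def rd ts ts1 u1 u2 fun_upd_triv word_on_tape_snoc t0,
      simp_all add: config_def)
qed

lemma reach_tm:
  "reach P t k n x v y \<Longrightarrow> \<forall>i\<in>set P. instr_below k i \<Longrightarrow>
    (tm_step (machine k P) ^^ n) (config w t x u) = config w t y (u @ v)"
proof (induction arbitrary: u rule: reach.induct)
  case (reach_Suc x n v y)
  then show ?case by (simp only: funpow_Suc_right o_apply tm_step_config append_assoc)
qed simp

context
  fixes k :: nat and P :: "instr list" and w :: "sym list"
  assumes k: "0 < k" and w: "Blank \<notin> set w"
begin

text \<open>No symbol of \<open>w\<close> is blank, so a blank marks the end of the input in state 1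
  and the left end of the copies in state 2. The inserted blank puts the heads of the copies one
  cell ahead.\<close>

definition "copying i = (1 :: nat, (word_on_tape w, i) # (word_on_tape [], 0) #
  replicate k (word_on_tape (Blank # take i w), i + 1))"

definition "rewinding i = (2 :: nat, (word_on_tape w, length w) # (word_on_tape [], 0) #
  replicate k (word_on_tape (Blank # w), i))"

lemma step_init: "tm_step (machine k P) (tm_init (machine k P) w) = copying 0"
  using word_on_tape_snoc[of "[]" Blank]
  by (simp add: tm_init_def machine_def copying_def keep_def fun_upd_triv)

lemma step_copying: "i < length w \<Longrightarrow> tm_step (machine k P) (copying i) = copying (Suc i)"
proof -
  assume i: "i < length w"
  have "(word_on_tape (Blank # take i w))(Suc i := w ! i) = word_on_tape (Blank # take (Suc i) w)"
    using word_on_tape_snoc[of "Blank # take i w" "w ! i"] i by (simp add: take_Suc_conv_app_nth)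
  moreover have "word_on_tape w i = w ! i" "w ! i \<noteq> Blank"
    using i w by (simp_all add: word_on_tape_def) (metis nth_mem)
  ultimately show ?thesis
    by (simp add: machine_def copying_def keep_def fun_upd_idem)
qed

lemma step_copying_end: "tm_step (machine k P) (copying (length w)) = rewinding (length w)"
proof -
  have "word_on_tape w (length w) = Blank" "word_on_tape [] 0 = Blank" "word_on_tape (Blank # w) (Suc (length w)) = Blank"
    by (simp_all add: word_on_tape_def)
  then show ?thesis by (simp add: machine_def copying_def rewinding_def keep_def fun_upd_idem)
qed

lemma step_rewinding: "i < length w \<Longrightarrow> tm_step (machine k P) (rewinding (Suc i)) = rewinding i"
proof -
  assume i: "i < length w"
  then have "word_on_tape (Blank # w) (Suc i) \<noteq> Blank"
    using w by (simp add: word_on_tape_def) (metis nth_mem)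
  then show ?thesis using k
    by (simp add: machine_def rewinding_def keep_def fun_upd_triv)
qed

lemma step_rewinding_end: "tm_step (machine k P) (rewinding 0) = config w (Blank # w) (3, replicate k 0) []"
  using k act_keep[of "snd (rewinding 0)"]
  by (simp add: machine_def rewinding_def config_def keep_def word_on_tape_def map_replicate)

lemma copying_phase: "i \<le> length w \<Longrightarrow> (tm_step (machine k P) ^^ i) (copying 0) = copying i"
  by (induction i) (simp_all add: step_copying del: tm_step.simps)

lemma rewinding_phase: "i \<le> length w \<Longrightarrow> (tm_step (machine k P) ^^ i) (rewinding i) = rewinding 0"
  by (induction i) (simp_all add: step_rewinding funpow_Suc_right del: funpow.simps tm_step.simps)

lemma prologue: "(tm_step (machine k P) ^^ (2 * length w + 3)) (tm_init (machine k P) w) =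
    config w (Blank # w) (3, replicate k 0) []"
proof -
  let ?s = "tm_step (machine k P)"
  \<comment> \<open>One step to write the left blanks, \<open>length w\<close> to copy, one to turn,
    \<open>length w\<close> to go back, and one to enter the program.\<close>
  have "2 * length w + 3 = Suc (length w + Suc (length w + Suc 0))" by simp
  then have "(?s ^^ (2 * length w + 3)) (tm_init (machine k P) w) =
      ?s ((?s ^^ length w) (?s ((?s ^^ length w) (?s (tm_init (machine k P) w)))))"
    by (simp only: funpow_add funpow.simps o_apply id_apply)
  also have "\<dots> = config w (Blank # w) (3, replicate k 0) []"
    by (simp only: step_init copying_phase[OF order_refl] step_copying_end rewinding_phase[OF order_refl] step_rewinding_end)
  finally show ?thesis .
qed

end

theorem poly_time_transducer:
  assumes c: "heads_below k c" and k: "0 < k"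
    and run: "\<And>x. x \<in> D \<Longrightarrow> Blank \<notin> set (e x) \<and> (\<exists>s. ev c (\<lambda>_. ([], Blank # e x)) (e' (f x)) s)"
  shows "poly_time_computable e e' D f"
proof -
  define P where "P = compile c 3"
  \<comment> \<open>\<open>2n + 3\<close> is the prologue and \<open>length P * (n + 2) ^ k\<close>
    comes from \<open>reach_bound\<close>, where \<open>n + 2\<close> is \<open>Suc\<close> of the
    length of the tape with its extra blank.\<close>
  define p where "p = [:3, 2:] + Polynomial.smult (length P) ([:2, 1:] ^ k) "
  have bp: "poly p n = 2 * n + 3 + length P * (n + 2) ^ k" for n
    by (simp add: p_def algebra_simps)
  have below: "\<forall>i\<in>set P. instr_below k i"
    using instr_below_compile[OF c] by (auto simp: P_def)
  have "tm_outputs_within (machine k P) (e x) (e' (f x)) (poly p (length (e x)))" if x: "x \<in> D" for x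
  proof -
    let ?t = "Blank # e x" and ?M = "machine k P"
    define s0 where "s0 = (\<lambda>_ :: nat. ([] :: sym list, ?t))"
    obtain s where s: "ev c s0 (e' (f x)) s" and nb: "Blank \<notin> set (e x)" using run[OF x] by (auto simp: s0_def)
    have inv: "tape_inv ?t s0" by (simp add: tape_inv_def s0_def)
    have pos: "positions k s0 = replicate k 0"
      by (simp add: positions_def s0_def map_replicate_const)
    obtain n where n: "reach P ?t k n (3, replicate k 0) (e' (f x)) (3 + len c, positions k s)"
      using compile_correct[OF s inv c, of P "[]" "[]"] by (auto simp: P_def pos)
    have "n \<le> length P * Suc (length ?t) ^ k"
      by (rule reach_bound[OF n]) (simp add: running_def P_def)
    then have le: "n + (2 * length (e x) + 3) \<le> poly p (length (e x))" by (simp add: bp)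
    have "(tm_step ?M ^^ (n + (2 * length (e x) + 3))) (tm_init ?M (e x)) =
        config (e x) ?t (3 + len c, positions k s) (e' (f x))"
      by (simp only: funpow_add[of n] o_apply prologue[OF k nb] reach_tm[OF n below] append_Nil)
    also have "\<dots> = (nstates ?M, (word_on_tape (e x), length (e x)) # (word_on_tape (e' (f x)), length (e' (f x))) #
        map (\<lambda>i. (word_on_tape ?t, i)) (positions k s))"
      by (simp add: config_def machine_def P_def)
    finally show ?thesis using le unfolding tm_outputs_within_def
      by (intro exI conjI) (assumption, assumption, simp)
  qed
  then show ?thesis using wf_machine unfolding poly_time_computable_def by blast
qed

text \<open>Unfolding function updates would also unfold the states in the goals below.\<close>

declare fun_upd_apply [simp del] fun_upd_same [simp] fun_upd_other [simp]

text \<open>Subprograms that bring all heads back can be composed by concatenating their outputs,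
  without tracking intermediate states.\<close>

abbreviation emits :: "cmd \<Rightarrow> heads \<Rightarrow> sym list \<Rightarrow> bool" where
  "emits c s u \<equiv> ev c s u s"

section \<open>Blocks of commands and loops over bracketed items\<close>

primrec block :: "cmd list \<Rightarrow> cmd" where
  "block [] = Skip"
| "block (c # cs) = c ;; block cs"

definition outs :: "sym list \<Rightarrow> cmd" where
  "outs u = block (map Out u)"

lemma ev_SeqI: "ev c s u s' \<Longrightarrow> ev d s' v s'' \<Longrightarrow> w = u @ v \<Longrightarrow> ev (c ;; d) s w s''"
  using ev_Seq by simp

lemma ev_RtI: "s h = (l, a # r) \<Longrightarrow> s' = s(h := (a # l, r)) \<Longrightarrow> ev (Rt h) s [] s'"
  using ev_Rt by simp

lemma ev_LfI: "s h = (a # l, r) \<Longrightarrow> s' = s(h := (l, a # r)) \<Longrightarrow> ev (Lf h) s [] s'"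
  using ev_Lf by simp

lemma ev_LoopI: "rd (s h) \<in> S \<Longrightarrow> ev c s u s' \<Longrightarrow> ev (Loop h S c) s' v s'' \<Longrightarrow> w = u @ v \<Longrightarrow> ev (Loop h S c) s w s''"
  using ev_Loop by simp

lemma emits_block_map: "(\<And>x. x \<in> set xs \<Longrightarrow> emits (f x) s (g x)) \<Longrightarrow> emits (block (map f xs)) s (concat (map g xs))"
  by (induction xs) (auto intro: ev_Skip ev_SeqI)

lemma emits_outs: "emits (outs u) s u"
  using emits_block_map[of u Out s "\<lambda>a. [a]"] by (simp add: outs_def ev_Out)

lemma rd_simps [simp]: "rd (l, a # r) = a" "rd (l, []) = Blank"
  by (simp_all add: rd_def)

abbreviation bits :: "sym set" where "bits \<equiv> {Zero, One}"
abbreviation nonblank :: "sym set" where "nonblank \<equiv> {Zero, One, Open, Close}"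

definition bool_sym :: "bool \<Rightarrow> sym" where "bool_sym b = (if b then One else Zero)"

lemma ev_copy_right:
  "set u \<subseteq> S \<Longrightarrow> a \<notin> S \<Longrightarrow>
    ev (Loop h S (Copy h ;; Rt h)) (s(h := (l, u @ a # r))) u (s(h := (rev u @ l, a # r)))"
proof (induction u arbitrary: l)
  case Nil
  then show ?case by (auto intro: ev_Loop_exit)
next
  case (Cons x u)
  have "ev (Copy h ;; Rt h) (s(h := (l, x # u @ a # r))) [x] (s(h := (x # l, u @ a # r)))"
  proof (rule ev_SeqI)
    show "ev (Copy h) (s(h := (l, x # u @ a # r))) [x] (s(h := (l, x # u @ a # r)))"
      using ev_Copy[of h "s(h := (l, x # u @ a # r))"] by simp
    show "ev (Rt h) (s(h := (l, x # u @ a # r))) [] (s(h := (x # l, u @ a # r)))"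
      by (rule ev_RtI) auto
  qed simp
  from ev_LoopI[OF _ this Cons.IH] Cons.prems show ?case by simp
qed

lemma ev_skip_right:
  "set u \<subseteq> S \<Longrightarrow> a \<notin> S \<Longrightarrow> ev (Loop h S (Rt h)) (s(h := (l, u @ a # r))) [] (s(h := (rev u @ l, a # r)))"
proof (induction u arbitrary: l)
  case Nil
  then show ?case by (auto intro: ev_Loop_exit)
next
  case (Cons x u)
  have "ev (Rt h) (s(h := (l, x # u @ a # r))) [] (s(h := (x # l, u @ a # r)))"
    by (rule ev_RtI) auto
  from ev_LoopI[OF _ this Cons.IH] Cons.prems show ?case by simp
qed

lemma ev_skip_left:
  "set u \<subseteq> S \<Longrightarrow> x \<in> S \<Longrightarrow> a \<notin> S \<Longrightarrow>
    ev (Loop h S (Lf h)) (s(h := (u @ a # l, x # r))) [] (s(h := (l, a # rev u @ x # r)))"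
proof (induction u arbitrary: x r)
  case Nil
  have "ev (Lf h) (s(h := (a # l, x # r))) [] (s(h := (l, a # x # r)))"
    by (rule ev_LfI) auto
  from ev_LoopI[where S = S, OF _ this ev_Loop_exit] Nil.prems show ?case by simp
next
  case (Cons y u)
  have "ev (Lf h) (s(h := (y # u @ a # l, x # r))) [] (s(h := (u @ a # l, y # x # r)))"
    by (rule ev_LfI) auto
  from ev_LoopI[OF _ this Cons.IH[of y "x # r"]] Cons.prems show ?case by simp
qed

text \<open>The first \<open>Lf\<close> is unconditional because the head starts on the symbol
  behind the word, such as a bracket, which may lie outside \<open>S\<close>.\<close>

definition retreat :: "nat \<Rightarrow> sym set \<Rightarrow> cmd" where
  "retreat h S = Lf h ;; Loop h S (Lf h)"

lemma ev_retreat: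
  assumes "set u \<subseteq> S" "a \<notin> S"
  shows "ev (retreat h S) (s(h := (rev u @ a # l, r))) [] (s(h := (l, a # u @ r)))"
proof (cases u rule: rev_cases)
  case Nil
  have "ev (Lf h) (s(h := (a # l, r))) [] (s(h := (l, a # r)))"
    by (rule ev_LfI) auto
  from ev_SeqI[OF this ev_Loop_exit] assms show ?thesis by (simp add: retreat_def Nil)
next
  case (snoc v x)
  have "ev (Lf h) (s(h := (rev u @ a # l, r))) [] (s(h := (rev v @ a # l, x # r)))"
    by (rule ev_LfI) (auto simp: snoc)
  moreover have "ev (Loop h S (Lf h)) (s(h := (rev v @ a # l, x # r))) [] (s(h := (l, a # u @ r)))"
    using ev_skip_left[of "rev v" S x a h s l r] assms snoc by auto
  ultimately show ?thesis unfolding retreat_def by (rule ev_SeqI) simp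
qed

text \<open>Every item begins with \<open>Open\<close> and the list ends with \<open>Close\<close>,
  so the symbol under the head controls the loop. \<open>\<sigma> i\<close> describes the other
  heads before item \<open>i\<close>; it varies when a counter moves along.\<close>

lemma ev_loop_items:
  assumes "\<And>i l r. i < length xs \<Longrightarrow>
      ev body ((\<sigma> i)(h := (l, e (xs ! i) @ r))) (out i) ((\<sigma> (Suc i))(h := (rev (e (xs ! i)) @ l, r)))"
    and op: "\<And>x. \<exists>u. e x = Open # u"
  shows "ev (Loop h {Open} body) ((\<sigma> 0)(h := (l, concat (map e xs) @ Close # r)))
    (concat (map out [0..<length xs])) ((\<sigma> (length xs))(h := (rev (concat (map e xs)) @ l, Close # r)))"
  using assms(1)
proof (induction xs arbitrary: \<sigma> out l)
  case Nil
  then show ?case by (auto intro: ev_Loop_exit)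
next
  case (Cons x xs)
  let ?r = "concat (map e xs) @ Close # r"
  have 1: "ev body ((\<sigma> 0)(h := (l, e x @ ?r))) (out 0) ((\<sigma> 1)(h := (rev (e x) @ l, ?r)))"
    using Cons.prems[of 0 l ?r] by simp
  have 2: "ev (Loop h {Open} body) ((\<sigma> 1)(h := (rev (e x) @ l, ?r))) (concat (map (\<lambda>i. out (Suc i)) [0..<length xs]))
      ((\<sigma> (Suc (length xs)))(h := (rev (concat (map e xs)) @ rev (e x) @ l, Close # r)))"
    using Cons.IH[of "\<lambda>i. \<sigma> (Suc i)" "\<lambda>i. out (Suc i)" "rev (e x) @ l"] Cons.prems by fastforce
  have 3: "map out [0..<length (x # xs)] = out 0 # map (\<lambda>i. out (Suc i)) [0..<length xs]"
    by (simp add: upt_conv_Cons map_Suc_upt[symmetric] del: upt_Suc)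
  show ?case
    using op[of x] ev_LoopI[where S = "{Open}", OF _ 1 2] unfolding 3 by auto
qed

lemma ev_loop_items_const:
  assumes "\<And>x l r. x \<in> set xs \<Longrightarrow> ev body (s(h := (l, e x @ r))) (out x) (s(h := (rev (e x) @ l, r)))"
    and "\<And>x. \<exists>u. e x = Open # u"
  shows "ev (Loop h {Open} body) (s(h := (l, concat (map e xs) @ Close # r)))
    (concat (map out xs)) (s(h := (rev (concat (map e xs)) @ l, Close # r)))"
proof -
  have "map (\<lambda>i. out (xs ! i)) [0..<length xs] = map out xs"
    by (rule nth_equalityI) simp_all
  then show ?thesis
    using ev_loop_items[of xs body "\<lambda>_. s" h e "\<lambda>i. out (xs ! i)" l r] assms by simp
qed

section \<open>A transducer for the reduction\<close>

abbreviation "enc_entry \<equiv> enc_pair enc_nat enc_bool"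
abbreviation "enc_vert x \<equiv> enc_nat (vert_num x)"

definition enc_edge :: "vert \<times> vert \<Rightarrow> sym list" where
  "enc_edge e = enc_pair enc_nat enc_nat (map_prod vert_num vert_num e)"

lemma concat_enc_bool: "concat (map enc_bool bs) = map bool_sym bs"
  by (induction bs) (simp_all add: enc_bool_def bool_sym_def)

lemma enc_nat_bits: "enc_nat n = Open # map bool_sym (binary n) @ [Close]"
  by (simp add: enc_nat_def enc_list_def concat_enc_bool)

lemma enc_entry_bits: "enc_entry (v, b) = Open # Open # map bool_sym (binary v) @ [Close, bool_sym b, Close]"
  by (simp add: enc_pair_def enc_nat_bits enc_bool_def bool_sym_def)

lemma enc_vert_bits: "enc_vert x = Open # map bool_sym (vert_bits x) @ [Close]"
  by (simp add: enc_nat_bits binary_vert_num)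

lemma enc_edge_verts: "enc_edge (x, y) = Open # enc_vert x @ enc_vert y @ [Close]"
  by (simp add: enc_edge_def enc_pair_def)

lemma set_map_bit: "set (map bool_sym bs) \<subseteq> bits"
  by (auto simp: bool_sym_def)

section \<open>Head positions as counters\<close>

definition ctr :: "sym list \<Rightarrow> nat \<Rightarrow> sym list \<times> sym list" where
  "ctr t i = (rev (take i t), drop i t)"

lemma ctr_0: "ctr t 0 = ([], t)"
  by (simp add: ctr_def)

lemma ev_Rt_ctr: "i < length t \<Longrightarrow> ev (Rt h) (s(h := ctr t i)) [] (s(h := ctr t (Suc i)))"
  by (rule ev_RtI) (auto simp: ctr_def take_Suc_conv_app_nth Cons_nth_drop_Suc[symmetric])

lemma ev_Lf_ctr: "i < length t \<Longrightarrow> ev (Lf h) (s(h := ctr t (Suc i))) [] (s(h := ctr t i))"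
  by (rule ev_LfI) (auto simp: ctr_def take_Suc_conv_app_nth Cons_nth_drop_Suc[symmetric])

definition marked :: "sym list \<Rightarrow> bool" where
  "marked t \<longleftrightarrow> (\<exists>w. t = Blank # w \<and> Blank \<notin> set w)"

lemma nonblank_iff: "a \<in> nonblank \<longleftrightarrow> a \<noteq> Blank"
  by (cases a) auto

text \<open>The zero test: the left end holds the only blank of a marked tape. Behind the tape a
  head reads blank as well, whence the bound on \<open>i\<close>.\<close>

lemma rd_ctr: "marked t \<Longrightarrow> i < length t \<Longrightarrow> rd (ctr t i) \<in> nonblank \<longleftrightarrow> i \<noteq> 0"
proof -
  assume t: "marked t" and i: "i < length t"
  then have "rd (ctr t i) = t ! i" by (simp add: ctr_def Cons_nth_drop_Suc[symmetric])
  moreover obtain w where w: "t = Blank # w" "Blank \<notin> set w" using t by (auto simp: marked_def)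
  ultimately show ?thesis using i unfolding nonblank_iff
    by (cases i) (simp_all, metis nth_mem)
qed

definition rewind :: "nat \<Rightarrow> cmd" where
  "rewind h = Loop h nonblank (Lf h)"

lemma ev_rewind_ctr: "marked t \<Longrightarrow> i < length t \<Longrightarrow> ev (rewind h) (s(h := ctr t i)) [] (s(h := ctr t 0))"
proof (induction i)
  case 0
  then show ?case using rd_ctr[of t 0] unfolding rewind_def by (intro ev_Loop_exit) auto
next
  case (Suc i)
  have "rd ((s(h := ctr t (Suc i))) h) \<in> nonblank" using rd_ctr[of t "Suc i"] Suc.prems by simp
  from ev_LoopI[OF this ev_Lf_ctr[of i]] Suc show ?case unfolding rewind_def by simp
qed

lemma ev_rewind:
  assumes "marked t" "rev l @ a # r = t"
  shows "ev (rewind h) (s(h := (l, a # r))) [] (s(h := ([], t)))"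
proof -
  have "(l, a # r) = ctr t (length l)" using assms(2) by (auto simp: ctr_def)
  moreover have "length l < length t" using assms(2) by auto
  ultimately show ?thesis using ev_rewind_ctr[OF assms(1)] by (simp add: ctr_0)
qed

subsection \<open>Writing vertices and edges\<close>

abbreviation "tag t \<equiv> outs (Open # map bool_sym (tag_bits t))"

text \<open>An entry has the form \<open>Open Open bits Close b Close\<close>, so the name begins
  two cells to the right.\<close>

definition copy_name :: "nat \<Rightarrow> cmd" where
  "copy_name h = Rt h ;; Rt h ;; Loop h bits (Copy h ;; Rt h)"

definition return_name :: "nat \<Rightarrow> cmd" where
  "return_name h = retreat h bits ;; Lf h"

lemma ev_copy_name: "ev (copy_name h) (s(h := (l, enc_entry (v, b) @ r))) (map bool_sym (binary v))
    (s(h := (rev (map bool_sym (binary v)) @ Open # Open # l, Close # bool_sym b # Close # r)))"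
proof -
  let ?r = "map bool_sym (binary v) @ Close # bool_sym b # Close # r"
  have 1: "ev (Rt h) (s(h := (l, enc_entry (v, b) @ r))) [] (s(h := (Open # l, Open # ?r)))"
    by (rule ev_RtI) (auto simp: enc_entry_bits)
  have 2: "ev (Rt h) (s(h := (Open # l, Open # ?r))) [] (s(h := (Open # Open # l, ?r)))"
    by (rule ev_RtI) auto
  have 3: "ev (Loop h bits (Copy h ;; Rt h)) (s(h := (Open # Open # l, ?r))) (map bool_sym (binary v))
    (s(h := (rev (map bool_sym (binary v)) @ Open # Open # l, Close # bool_sym b # Close # r)))"
    by (rule ev_copy_right[OF set_map_bit]) simp
  show ?thesis unfolding copy_name_def using ev_Seq[OF 1 ev_Seq[OF 2 3]] by simp
qed

lemma ev_return_name: "ev (return_name h) (s(h := (rev (map bool_sym (binary v)) @ Open # Open # l, Close # bool_sym b # Close # r)))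
   [] (s(h := (l, enc_entry (v, b) @ r)))"
proof -
  have 1: "ev (retreat h bits) (s(h := (rev (map bool_sym (binary v)) @ Open # Open # l, Close # bool_sym b # Close # r)))
    [] (s(h := (Open # l, Open # map bool_sym (binary v) @ Close # bool_sym b # Close # r)))"
    by (rule ev_retreat[OF set_map_bit]) simp
  have 2: "ev (Lf h) (s(h := (Open # l, Open # map bool_sym (binary v) @ Close # bool_sym b # Close # r))) []
    (s(h := (l, enc_entry (v, b) @ r)))"
    by (rule ev_LfI) (auto simp: enc_entry_bits)
  show ?thesis unfolding return_name_def using ev_Seq[OF 1 2] by simp
qed

definition write_var :: "kind \<Rightarrow> nat \<Rightarrow> bool \<Rightarrow> cmd" where
  "write_var k h b = tag (kind_index k) ;; copy_name h ;; return_name h ;; outs [bool_sym b, One, Close]"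

lemma bool_sym_True: "bool_sym True = One" and bool_sym_False: "bool_sym False = Zero"
  by (simp_all add: bool_sym_def)

lemma emits_write_var:
  assumes "s h = (l, enc_entry p @ r)"
  shows "emits (write_var k h b) s (enc_vert (Var k (fst p) b))"
proof -
  obtain v c where p: "p = (v, c)" by (cases p)
  have s: "s = s(h := (l, enc_entry (v, c) @ r))" using assms p by (simp add: fun_upd_idem)
  show ?thesis
    using ev_Seq[OF emits_outs ev_Seq[OF ev_copy_name[of h s l v c r] ev_Seq[OF ev_return_name emits_outs]],
        of "Open # map bool_sym (tag_bits (kind_index k))" "[bool_sym b, One, Close]"]
    unfolding s[symmetric] write_var_def enc_vert_bits p by (simp add: bool_sym_True)
qed

text \<open>Here, unlike in \<open>write_var\<close>, the value is copied from the input too: the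
  initial value if the head is in a list of variables, the sign of the literal if it is in a
  clause.\<close>

definition write_lit :: "nat \<Rightarrow> cmd" where
  "write_lit h = tag (kind_index Lit) ;; copy_name h ;; Rt h ;; Copy h ;; Lf h ;; return_name h ;; outs [One, Close]"

lemma emits_write_lit:
  assumes "s h = (l, enc_entry p @ r)"
  shows "emits (write_lit h) s (enc_vert (Var Lit (fst p) (snd p)))"
proof -
  obtain v c where p: "p = (v, c)" by (cases p)
  have s: "s = s(h := (l, enc_entry (v, c) @ r))" using assms p by (simp add: fun_upd_idem)
  let ?l = "rev (map bool_sym (binary v)) @ Open # Open # l"
  have 1: "ev (Rt h) (s(h := (?l, Close # bool_sym c # Close # r))) [] (s(h := (Close # ?l, bool_sym c # Close # r)))"
    by (rule ev_RtI) auto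
  have 2: "ev (Copy h) (s(h := (Close # ?l, bool_sym c # Close # r))) [bool_sym c] (s(h := (Close # ?l, bool_sym c # Close # r)))"
    using ev_Copy[of h "s(h := (Close # ?l, bool_sym c # Close # r))"] by simp
  have 3: "ev (Lf h) (s(h := (Close # ?l, bool_sym c # Close # r))) [] (s(h := (?l, Close # bool_sym c # Close # r)))"
    by (rule ev_LfI) auto
  show ?thesis
    using ev_Seq[OF emits_outs ev_Seq[OF ev_copy_name[of h s l v c r] ev_Seq[OF 1 ev_Seq[OF 2 ev_Seq[OF 3
          ev_Seq[OF ev_return_name emits_outs]]]]], of "Open # map bool_sym (tag_bits (kind_index Lit))" "[One, Close]"]
    unfolding s[symmetric] write_lit_def enc_vert_bits p by (simp add: bool_sym_True)
qed

text \<open>Heads 2 and 3 serve as counters; the position of head 2 is the index of the current clause.\<close>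

definition write_clause :: cmd where
  "write_clause = tag 20 ;; Loop 2 nonblank (Out One ;; Lf 2 ;; Rt 3) ;; Loop 3 nonblank (Lf 3 ;; Rt 2) ;;
     outs [One, One, Close]"

lemma ev_transfer:
  assumes "marked t" "h \<noteq> h'" "i + j < length t"
  shows "ev (Loop h nonblank (Lf h ;; Rt h')) (s(h := ctr t i, h' := ctr t j)) [] (s(h := ctr t 0, h' := ctr t (i + j)))"
  using assms(3)
proof (induction i arbitrary: j)
  case 0
  then have "0 < length t" by linarith
  then show ?case using rd_ctr[OF assms(1), of 0] assms(2) by (simp, intro ev_Loop_exit) auto
next
  case (Suc i)
  have r: "rd ((s(h := ctr t (Suc i), h' := ctr t j)) h) \<in> nonblank"
    using rd_ctr[OF assms(1), of "Suc i"] Suc.prems assms(2) by simp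
  have 1: "ev (Lf h) (s(h := ctr t (Suc i), h' := ctr t j)) [] (s(h := ctr t i, h' := ctr t j))"
    using ev_Lf_ctr[of i t h "s(h' := ctr t j)"] Suc.prems assms(2) by (simp add: fun_upd_twist)
  have 2: "ev (Rt h') (s(h := ctr t i, h' := ctr t j)) [] (s(h := ctr t i, h' := ctr t (Suc j)))"
    using ev_Rt_ctr[of j t h'] Suc.prems by simp
  show ?case using ev_LoopI[OF r ev_Seq[OF 1 2] Suc.IH[of "Suc j"]] Suc.prems by simp
qed

lemma ev_transfer_One:
  assumes "marked t" "i + j < length t"
  shows "ev (Loop 2 nonblank (Out One ;; Lf 2 ;; Rt 3)) (s(2 := ctr t i, 3 := ctr t j)) (replicate i One)
    (s(2 := ctr t 0, 3 := ctr t (i + j)))"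
  using assms(2)
proof (induction i arbitrary: j)
  case 0
  then have "0 < length t" by linarith
  then show ?case using rd_ctr[OF assms(1), of 0] by (simp, intro ev_Loop_exit) auto
next
  case (Suc i)
  have r: "rd ((s(2 := ctr t (Suc i), 3 := ctr t j)) 2) \<in> nonblank"
    using rd_ctr[OF assms(1), of "Suc i"] Suc.prems by simp
  have 1: "ev (Lf 2) (s(2 := ctr t (Suc i), 3 := ctr t j)) [] (s(2 := ctr t i, 3 := ctr t j))"
    using ev_Lf_ctr[of i t 2 "s(3 := ctr t j)"] Suc.prems by (simp add: fun_upd_twist)
  have 2: "ev (Rt 3) (s(2 := ctr t i, 3 := ctr t j)) [] (s(2 := ctr t i, 3 := ctr t (Suc j)))"
    using ev_Rt_ctr[of j t 3] Suc.prems by simp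
  show ?case using ev_LoopI[OF r ev_Seq[OF ev_Out ev_Seq[OF 1 2]] Suc.IH[of "Suc j"]] Suc.prems by simp
qed

text \<open>Head 2 is emptied into head 3 with one \<open>One\<close> per step and then refilled, so
  the position \<open>j\<close> is written in unary and preserved.\<close>

lemma emits_write_clause:
  assumes "marked t" "j < length t" "s 2 = ctr t j" "s 3 = ctr t 0"
  shows "emits write_clause s (enc_vert (Clause j))"
proof -
  have s: "s = s(2 := ctr t j, 3 := ctr t 0)" using assms(3,4) by (simp add: fun_upd_idem)
  have s': "s(3 := ctr t 0, 2 := ctr t j) = s(2 := ctr t j, 3 := ctr t 0)" by (simp add: fun_upd_twist)
  have 1: "ev (Loop 2 nonblank (Out One ;; Lf 2 ;; Rt 3)) (s(2 := ctr t j, 3 := ctr t 0)) (replicate j One)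
    (s(2 := ctr t 0, 3 := ctr t j))"
    using ev_transfer_One[OF assms(1), of j 0 s] assms(2) by simp
  have 2: "ev (Loop 3 nonblank (Lf 3 ;; Rt 2)) (s(2 := ctr t 0, 3 := ctr t j)) [] (s(2 := ctr t j, 3 := ctr t 0))"
    using ev_transfer[OF assms(1), of 3 2 j 0 s] assms(2) by (simp add: fun_upd_twist)
  show ?thesis
    using ev_Seq[OF emits_outs ev_Seq[OF 1 ev_Seq[OF 2 emits_outs]],
        of "Open # map bool_sym (tag_bits 20)" "[One, One, Close]"]
    unfolding s[symmetric] write_clause_def enc_vert_bits by (simp add: bool_sym_True)
qed

text \<open>In a template, the variable of a vertex is the head that reads its name, and the index of a
  clause is irrelevant.\<close>

primrec instance_of :: "(nat \<Rightarrow> nat \<times> bool) \<Rightarrow> nat \<Rightarrow> vert \<Rightarrow> vert" where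
  "instance_of e j (Con x) = Con x"
| "instance_of e j (Var k h b) = Var k (fst (e h)) b"
| "instance_of e j (Clause i) = Clause j"

primrec write_vert :: "vert \<Rightarrow> cmd" where
  "write_vert (Con x) = outs (enc_vert (Con x))"
| "write_vert (Var k h b) = write_var k h b"
| "write_vert (Clause i) = write_clause"

primrec vert_fits :: "sym list \<Rightarrow> (nat \<Rightarrow> nat \<times> bool) \<Rightarrow> nat \<Rightarrow> heads \<Rightarrow> vert \<Rightarrow> bool" where
  "vert_fits t e j s (Con x) = True"
| "vert_fits t e j s (Var k h b) = (\<exists>l r. s h = (l, enc_entry (e h) @ r))"
| "vert_fits t e j s (Clause i) = (marked t \<and> j < length t \<and> s 2 = ctr t j \<and> s 3 = ctr t 0)"

lemma emits_write_vert: "vert_fits t e j s x \<Longrightarrow> emits (write_vert x) s (enc_vert (instance_of e j x))"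
  by (cases x) (auto simp: emits_outs emits_write_var emits_write_clause)

definition write_verts :: "vert list \<Rightarrow> cmd" where
  "write_verts xs = block (map write_vert xs)"

lemma emits_write_verts:
  "\<forall>x\<in>set xs. vert_fits t e j s x \<Longrightarrow> map (instance_of e j) xs = ys \<Longrightarrow>
    emits (write_verts xs) s (concat (map enc_vert ys))"
  unfolding write_verts_def using emits_block_map[OF emits_write_vert[of t e j s], of xs "\<lambda>x. x"]
  by (auto simp: comp_def)

definition write_pair :: "cmd \<Rightarrow> cmd \<Rightarrow> cmd" where
  "write_pair c d = Out Open ;; c ;; d ;; Out Close"

lemma emits_write_pair: "emits c s (enc_vert x) \<Longrightarrow> emits d s (enc_vert y) \<Longrightarrow> emits (write_pair c d) s (enc_edge (x, y))"
  unfolding write_pair_def enc_edge_verts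
  by (rule ev_SeqI[OF ev_Out ev_Seq[OF _ ev_Seq[OF _ ev_Out]]]) simp_all

definition write_edges :: "(vert \<times> vert) list \<Rightarrow> cmd" where
  "write_edges es = block (map (\<lambda>(x, y). write_pair (write_vert x) (write_vert y)) es)"

lemma emits_write_edges:
  assumes "\<forall>(x, y)\<in>set es. vert_fits t e j s x \<and> vert_fits t e j s y"
    and "map (map_prod (instance_of e j) (instance_of e j)) es = es'"
  shows "emits (write_edges es) s (concat (map enc_edge es'))"
proof -
  have "emits (write_edges es) s (concat (map (\<lambda>x. enc_edge (map_prod (instance_of e j) (instance_of e j) x)) es))"
    unfolding write_edges_def
  proof (rule emits_block_map)
    fix x assume x: "x \<in> set es"
    obtain y z where "x = (y, z)" by (cases x)
    then show "emits (case x of (x, y) \<Rightarrow> write_pair (write_vert x) (write_vert y)) s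
        (enc_edge (map_prod (instance_of e j) (instance_of e j) x))"
      using assms(1) x by (auto intro!: emits_write_pair emits_write_vert[of t])
  qed
  then show ?thesis unfolding assms(2)[symmetric] by (simp add: comp_def)
qed

definition skip_entry :: "nat \<Rightarrow> cmd" where
  "skip_entry h = Rt h ;; Rt h ;; Loop h bits (Rt h) ;; Rt h ;; Rt h ;; Rt h"

lemma ev_skip_entry:
  "ev (skip_entry h) (s(h := (l, enc_entry p @ r))) [] (s(h := (rev (enc_entry p) @ l, r)))"
proof -
  obtain v b where p: "p = (v, b)" by (cases p)
  let ?u = "map bool_sym (binary v)"
  have 1: "ev (Rt h) (s(h := (l, enc_entry p @ r))) [] (s(h := (Open # l, Open # ?u @ Close # bool_sym b # Close # r)))"
    by (rule ev_RtI) (auto simp: p enc_entry_bits)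
  have 2: "ev (Rt h) (s(h := (Open # l, Open # ?u @ Close # bool_sym b # Close # r))) []
      (s(h := (Open # Open # l, ?u @ Close # bool_sym b # Close # r)))"
    by (rule ev_RtI) auto
  have 3: "ev (Loop h bits (Rt h)) (s(h := (Open # Open # l, ?u @ Close # bool_sym b # Close # r))) []
      (s(h := (rev ?u @ Open # Open # l, Close # bool_sym b # Close # r)))"
    by (rule ev_skip_right[OF set_map_bit]) simp
  have 4: "ev (Rt h) (s(h := (rev ?u @ Open # Open # l, Close # bool_sym b # Close # r))) []
      (s(h := (Close # rev ?u @ Open # Open # l, bool_sym b # Close # r)))"
    by (rule ev_RtI) auto
  have 5: "ev (Rt h) (s(h := (Close # rev ?u @ Open # Open # l, bool_sym b # Close # r))) []
      (s(h := (bool_sym b # Close # rev ?u @ Open # Open # l, Close # r)))"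
    by (rule ev_RtI) auto
  have 6: "ev (Rt h) (s(h := (bool_sym b # Close # rev ?u @ Open # Open # l, Close # r))) []
      (s(h := (rev (enc_entry p) @ l, r)))"
    by (rule ev_RtI) (auto simp: p enc_entry_bits)
  show ?thesis
    unfolding skip_entry_def using ev_Seq[OF 1 ev_Seq[OF 2 ev_Seq[OF 3 ev_Seq[OF 4 ev_Seq[OF 5 6]]]]] by simp
qed

lemma concat_map_Nil: "concat (map (\<lambda>_. []) xs) = []"
  by simp

lemma enc_entry_Open: "\<exists>u. enc_entry p = Open # u"
  by (cases p) (simp add: enc_entry_bits)

lemma enc_list_Open: "\<exists>u. enc_list e xs = Open # u"
  by (simp add: enc_list_def)

lemma Blank_enc_entry: "Blank \<notin> set (enc_entry p)"
  by (cases p) (auto simp: enc_entry_bits bool_sym_def)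

lemma Blank_enc_list: "(\<And>x. Blank \<notin> set (e x)) \<Longrightarrow> Blank \<notin> set (enc_list e xs)"
  by (auto simp: enc_list_def)

lemma Blank_enc_abf: "Blank \<notin> set (enc_abf I)"
  using Blank_enc_list[of enc_entry] Blank_enc_list[of "enc_list enc_entry"] Blank_enc_entry
  by (auto simp: enc_abf_def)

section \<open>Loops over the variables and clauses of the instance\<close>

context
  fixes I :: abf
begin

definition tape :: "sym list" where
  "tape = Blank # enc_abf I"

lemma marked_tape: "marked tape"
  using Blank_enc_abf by (auto simp: marked_def tape_def)

definition after_vars :: "sym list" where
  "after_vars = Open # concat (map (enc_list enc_entry) (formula I)) @ [Close, Close]"

definition vars_part :: "sym list" where
  "vars_part = Blank # Open # Open # concat (map enc_entry (xvars I)) @ Close # Open # concat (map enc_entry (yvars I))"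

lemma tape_eq: "tape = vars_part @ Close # after_vars"
  by (simp add: tape_def after_vars_def vars_part_def enc_abf_def enc_list_def)

text \<open>The first three \<open>Rt\<close> pass the left blank, the bracket of the instance and
  that of \<open>xvars\<close>; the two in the middle pass the \<open>Close\<close> and
  \<open>Open\<close> between the lists. The head ends on the \<open>Close\<close> of
  \<open>yvars\<close>, from where the formula can be entered.\<close>

definition over_vars :: "nat \<Rightarrow> cmd \<Rightarrow> cmd \<Rightarrow> cmd" where
  "over_vars h f g = Rt h ;; Rt h ;; Rt h ;; Loop h {Open} (f ;; skip_entry h) ;; Rt h ;; Rt h ;;
     Loop h {Open} (g ;; skip_entry h)"

lemma ev_over_vars:
  assumes f: "\<And>i l r. i < length (xvars I) \<Longrightarrow>
      ev f ((\<sigma> i)(h := (l, enc_entry (xvars I ! i) @ r))) (ox i) ((\<sigma> (Suc i))(h := (l, enc_entry (xvars I ! i) @ r)))"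
    and g: "\<And>i l r. i < length (yvars I) \<Longrightarrow>
      ev g ((\<sigma> (length (xvars I) + i))(h := (l, enc_entry (yvars I ! i) @ r))) (oy i)
        ((\<sigma> (Suc (length (xvars I) + i)))(h := (l, enc_entry (yvars I ! i) @ r)))"
  shows "ev (over_vars h f g) ((\<sigma> 0)(h := ([], tape)))
    (concat (map ox [0..<length (xvars I)]) @ concat (map oy [0..<length (yvars I)]))
    ((\<sigma> (length (xvars I) + length (yvars I)))(h := (rev vars_part, Close # after_vars)))"
proof -
  let ?X = "concat (map enc_entry (xvars I))" and ?Y = "concat (map enc_entry (yvars I))" and ?nx = "length (xvars I)"
  let ?r = "Close # Open # ?Y @ Close # after_vars"
  have 1: "ev (Rt h) ((\<sigma> 0)(h := ([], tape))) [] ((\<sigma> 0)(h := ([Blank], Open # Open # ?X @ ?r)))"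
    by (rule ev_RtI) (auto simp: tape_eq vars_part_def)
  have 2: "ev (Rt h) ((\<sigma> 0)(h := ([Blank], Open # Open # ?X @ ?r))) [] ((\<sigma> 0)(h := ([Open, Blank], Open # ?X @ ?r)))"
    by (rule ev_RtI) auto
  have 3: "ev (Rt h) ((\<sigma> 0)(h := ([Open, Blank], Open # ?X @ ?r))) [] ((\<sigma> 0)(h := ([Open, Open, Blank], ?X @ ?r)))"
    by (rule ev_RtI) auto
  have 4: "ev (Loop h {Open} (f ;; skip_entry h)) ((\<sigma> 0)(h := ([Open, Open, Blank], ?X @ ?r)))
      (concat (map ox [0..<?nx])) ((\<sigma> ?nx)(h := (rev ?X @ [Open, Open, Blank], ?r)))"
    by (rule ev_loop_items[OF _ enc_entry_Open]) (use ev_Seq[OF f ev_skip_entry] in simp)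
  have 5: "ev (Rt h) ((\<sigma> ?nx)(h := (rev ?X @ [Open, Open, Blank], ?r))) []
      ((\<sigma> ?nx)(h := (Close # rev ?X @ [Open, Open, Blank], Open # ?Y @ Close # after_vars)))"
    by (rule ev_RtI) auto
  have 6: "ev (Rt h) ((\<sigma> ?nx)(h := (Close # rev ?X @ [Open, Open, Blank], Open # ?Y @ Close # after_vars))) []
      ((\<sigma> ?nx)(h := (Open # Close # rev ?X @ [Open, Open, Blank], ?Y @ Close # after_vars)))"
    by (rule ev_RtI) auto
  have 7: "ev (Loop h {Open} (g ;; skip_entry h))
      ((\<sigma> (?nx + 0))(h := (Open # Close # rev ?X @ [Open, Open, Blank], ?Y @ Close # after_vars)))
      (concat (map oy [0..<length (yvars I)]))
      ((\<sigma> (?nx + length (yvars I)))(h := (rev ?Y @ Open # Close # rev ?X @ [Open, Open, Blank], Close # after_vars)))"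
    by (rule ev_loop_items[where \<sigma> = "\<lambda>i. \<sigma> (?nx + i)", OF _ enc_entry_Open]) (use ev_Seq[OF g ev_skip_entry] in simp)
  show ?thesis
    unfolding over_vars_def
    using ev_Seq[OF 1 ev_Seq[OF 2 ev_Seq[OF 3 ev_Seq[OF 4 ev_Seq[OF 5 ev_Seq[OF 6 7[unfolded add_0_right]]]]]]]
    by (simp add: vars_part_def)
qed

lemma ev_over_vars_emits:
  assumes f: "\<And>p l r. p \<in> set (xvars I) \<Longrightarrow> emits f (s(h := (l, enc_entry p @ r))) (ox p)"
    and g: "\<And>p l r. p \<in> set (yvars I) \<Longrightarrow> emits g (s(h := (l, enc_entry p @ r))) (oy p)"
  shows "ev (over_vars h f g) (s(h := ([], tape))) (for_vars I ox oy) (s(h := (rev vars_part, Close # after_vars)))"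
proof -
  have m: "map (\<lambda>i. out (xs ! i)) [0..<length xs] = map out xs" for out :: "nat \<times> bool \<Rightarrow> sym list" and xs
    by (rule nth_equalityI) simp_all
  show ?thesis
    using ev_over_vars[where \<sigma> = "\<lambda>_. s" and ox = "\<lambda>i. ox (xvars I ! i)" and oy = "\<lambda>i. oy (yvars I ! i)" and f = f and g = g and h = h]
      f g by (simp add: m for_vars_def)
qed

definition write_for_vars :: "nat \<Rightarrow> cmd \<Rightarrow> cmd \<Rightarrow> cmd" where
  "write_for_vars h f g = over_vars h f g ;; rewind h"

lemma emits_for_vars:
  assumes "s h = ([], tape)"
    and "\<And>p l r. p \<in> set (xvars I) \<Longrightarrow> emits f (s(h := (l, enc_entry p @ r))) (ox p)"
    and "\<And>p l r. p \<in> set (yvars I) \<Longrightarrow> emits g (s(h := (l, enc_entry p @ r))) (oy p)"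
  shows "emits (write_for_vars h f g) s (for_vars I ox oy)"
proof -
  have s: "s = s(h := ([], tape))" using assms(1) by (simp add: fun_upd_idem)
  have "ev (rewind h) (s(h := (rev vars_part, Close # after_vars))) [] (s(h := ([], tape)))"
    by (rule ev_rewind[OF marked_tape]) (simp add: tape_eq)
  from ev_Seq[OF ev_over_vars_emits[OF assms(2,3)] this] show ?thesis
    unfolding write_for_vars_def s[symmetric] by simp
qed

text \<open>\<open>over_vars\<close> with \<open>Skip\<close> merely carries the head to the
  formula. Head 2 advances with each clause, so that its position is the index, and is reset at the
  end.\<close>

definition write_for_clauses :: "nat \<Rightarrow> cmd \<Rightarrow> cmd \<Rightarrow> cmd" where
  "write_for_clauses h f g = over_vars h Skip Skip ;; Rt h ;; Rt h ;;
     Loop h {Open} (f ;; Rt h ;; Loop h {Open} (g ;; skip_entry h) ;; Rt h ;; Rt 2) ;; rewind h ;; rewind 2"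

lemma length_concat_enc_list: "length xs \<le> length (concat (map (enc_list e) xs))"
  by (induction xs) (auto simp: enc_list_def)

lemma emits_for_clauses:
  assumes s: "s h = ([], tape)" "s 2 = ctr tape 0" "h \<noteq> 2"
    and f: "\<And>j l r. j < length (formula I) \<Longrightarrow> emits f (s(2 := ctr tape j, h := (l, r))) (oc j)"
    and g: "\<And>j p l r. j < length (formula I) \<Longrightarrow> p \<in> set (formula I ! j) \<Longrightarrow>
      emits g (s(2 := ctr tape j, h := (l, enc_entry p @ r))) (ol p j)"
  shows "emits (write_for_clauses h f g) s (for_clauses I oc ol)"
proof -
  let ?n = "length (formula I)" and ?F = "concat (map (enc_list enc_entry) (formula I))"
  let ?\<sigma> = "\<lambda>j. s(2 := ctr tape j)"
  have s0: "s = (?\<sigma> 0)(h := ([], tape))" using s by (simp add: fun_upd_idem)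
  \<comment> \<open>Each clause takes at least one symbol of the input, so the clause counter stays
    on the tape.\<close>
  have n: "?n < length tape"
    using length_concat_enc_list[of "formula I" enc_entry] by (simp add: tape_eq after_vars_def)
  let ?l = "Open # Close # rev vars_part"
  have 1: "ev (over_vars h Skip Skip) ((?\<sigma> 0)(h := ([], tape))) [] ((?\<sigma> 0)(h := (rev vars_part, Close # after_vars)))"
    using ev_over_vars_emits[of Skip "?\<sigma> 0" h "\<lambda>_. []" Skip "\<lambda>_. []"] ev_Skip by (simp add: for_vars_def concat_map_Nil)
  have 2: "ev (Rt h) ((?\<sigma> 0)(h := (rev vars_part, Close # after_vars))) [] ((?\<sigma> 0)(h := (Close # rev vars_part, after_vars)))"
    by (rule ev_RtI) auto
  have 3: "ev (Rt h) ((?\<sigma> 0)(h := (Close # rev vars_part, after_vars))) [] ((?\<sigma> 0)(h := (?l, ?F @ [Close, Close])))"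
    by (rule ev_RtI) (auto simp: after_vars_def)
  have body: "ev (f ;; Rt h ;; Loop h {Open} (g ;; skip_entry h) ;; Rt h ;; Rt 2)
      ((?\<sigma> j)(h := (l, enc_list enc_entry (formula I ! j) @ r))) (oc j @ concat (map (\<lambda>p. ol p j) (formula I ! j)))
      ((?\<sigma> (Suc j))(h := (rev (enc_list enc_entry (formula I ! j)) @ l, r)))" if j: "j < ?n" for j l r
  proof -
    let ?C = "concat (map enc_entry (formula I ! j))"
    have b1: "ev (Rt h) ((?\<sigma> j)(h := (l, enc_list enc_entry (formula I ! j) @ r))) [] ((?\<sigma> j)(h := (Open # l, ?C @ Close # r)))"
      by (rule ev_RtI) (auto simp: enc_list_def)
    have b2: "ev (Loop h {Open} (g ;; skip_entry h)) ((?\<sigma> j)(h := (Open # l, ?C @ Close # r)))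
        (concat (map (\<lambda>p. ol p j) (formula I ! j))) ((?\<sigma> j)(h := (rev ?C @ Open # l, Close # r)))"
      by (rule ev_loop_items_const[OF _ enc_entry_Open]) (use ev_Seq[OF g[OF j] ev_skip_entry] in simp)
    have b3: "ev (Rt h) ((?\<sigma> j)(h := (rev ?C @ Open # l, Close # r))) []
        ((?\<sigma> j)(h := (rev (enc_list enc_entry (formula I ! j)) @ l, r)))"
      by (rule ev_RtI) (auto simp: enc_list_def)
    have b4: "ev (Rt 2) ((?\<sigma> j)(h := (rev (enc_list enc_entry (formula I ! j)) @ l, r))) []
        ((?\<sigma> (Suc j))(h := (rev (enc_list enc_entry (formula I ! j)) @ l, r)))"
      using ev_Rt_ctr[of j tape 2 "s(h := (rev (enc_list enc_entry (formula I ! j)) @ l, r))"] j n s(3)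
      by (simp add: fun_upd_twist)
    show ?thesis using ev_Seq[OF f[OF j] ev_Seq[OF b1 ev_Seq[OF b2 ev_Seq[OF b3 b4]]]] by simp
  qed
  have 4: "ev (Loop h {Open} (f ;; Rt h ;; Loop h {Open} (g ;; skip_entry h) ;; Rt h ;; Rt 2))
      ((?\<sigma> 0)(h := (?l, ?F @ [Close, Close]))) (for_clauses I oc ol) ((?\<sigma> ?n)(h := (rev ?F @ ?l, [Close, Close])))"
    using ev_loop_items[where \<sigma> = ?\<sigma> and xs = "formula I" and h = h and e = "enc_list enc_entry" and l = ?l and r = "[Close]",
        OF body enc_list_Open] by (simp add: for_clauses_def)
  have 5: "ev (rewind h) ((?\<sigma> ?n)(h := (rev ?F @ ?l, [Close, Close]))) [] ((?\<sigma> ?n)(h := ([], tape)))"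
    by (rule ev_rewind[OF marked_tape]) (simp add: tape_eq after_vars_def)
  have 6: "ev (rewind 2) ((?\<sigma> ?n)(h := ([], tape))) [] ((?\<sigma> 0)(h := ([], tape)))"
    using ev_rewind_ctr[OF marked_tape n, of 2 "s(h := ([], tape))"] s(3) by (simp add: fun_upd_twist)
  show ?thesis
    using ev_Seq[OF 1 ev_Seq[OF 2 ev_Seq[OF 3 ev_Seq[OF 4 ev_Seq[OF 5 6]]]]]
    unfolding write_for_clauses_def s0[symmetric] by simp
qed

subsection \<open>Writing the number of cops\<close>

text \<open>Head 2 counts the cops. To write a number in binary, repeatedly halve the position of head 2, with
  head 0 moved off the left end iff the remainder is one.\<close>

definition write_binary :: cmd where
  "write_binary = Loop 2 nonblank
     (Loop 2 nonblank (Lf 2 ;; Test 2 nonblank (Lf 2 ;; Rt 3) (Rt 0)) ;;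
      Test 0 nonblank (Out One ;; Lf 0) (Out Zero) ;; Loop 3 nonblank (Lf 3 ;; Rt 2))"

abbreviation counters :: "heads \<Rightarrow> nat \<Rightarrow> nat \<Rightarrow> nat \<Rightarrow> heads" where
  "counters s i j m \<equiv> s(0 := ctr tape i, 2 := ctr tape j, 3 := ctr tape m)"

lemma counters_moves:
  assumes "i < length tape"
  shows "ev (Rt 0) (counters s i j m) [] (counters s (Suc i) j m)" "ev (Lf 0) (counters s (Suc i) j m) [] (counters s i j m)"
    "ev (Lf 2) (counters s j (Suc i) m) [] (counters s j i m)" "ev (Rt 3) (counters s j m i) [] (counters s j m (Suc i))"
  using assms ev_Rt_ctr[of i tape 0 "s(2 := ctr tape j, 3 := ctr tape m)"]
    ev_Lf_ctr[of i tape 0 "s(2 := ctr tape j, 3 := ctr tape m)"]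
    ev_Lf_ctr[of i tape 2 "s(0 := ctr tape j, 3 := ctr tape m)"]
    ev_Rt_ctr[of i tape 3 "s(0 := ctr tape j, 2 := ctr tape m)"]
  by (simp_all add: fun_upd_twist)

text \<open>A full iteration takes two cells from head 2 and adds one to head 3. If only one cell
  was left, the test in the middle fails, head 0 records the remainder, and the loop ends.\<close>

lemma ev_halve:
  "j + m < length tape \<Longrightarrow> 1 < length tape \<Longrightarrow>
    ev (Loop 2 nonblank (Lf 2 ;; Test 2 nonblank (Lf 2 ;; Rt 3) (Rt 0))) (counters s 0 j m) []
      (counters s (j mod 2) 0 (m + j div 2))"
proof (induction j arbitrary: m rule: less_induct)
  case (less j)
  have rd: "rd ((counters s 0 j' m) 2) \<in> nonblank \<longleftrightarrow> j' \<noteq> 0" if "j' \<le> j" for j'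
    using rd_ctr[OF marked_tape, of j'] that less.prems by simp
  have t0: "0 < length tape" using less.prems by linarith
  consider "j = 0" | "j = 1" | i where "j = Suc (Suc i)"
    by (metis One_nat_def not0_implies_Suc)
  then show ?case
  proof cases
    case 1
    then show ?thesis using ev_Loop_exit[where S = nonblank, of "counters s 0 0 m" 2] rd[of 0] by simp
  next
    case 2
    have b: "ev (Lf 2 ;; Test 2 nonblank (Lf 2 ;; Rt 3) (Rt 0)) (counters s 0 1 m) ([] @ []) (counters s 1 0 m)"
      using counters_moves(3)[OF t0, of s 0 m] counters_moves(1)[OF t0, of s 0 m] rd[of 0] less.prems 2
      by (intro ev_Seq[where s' = "counters s 0 0 m"] ev_Test_False) auto
    have e: "ev (Loop 2 nonblank (Lf 2 ;; Test 2 nonblank (Lf 2 ;; Rt 3) (Rt 0))) (counters s 1 0 m) []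
        (counters s 1 0 m)"
      by (rule ev_Loop_exit) (use rd_ctr[OF marked_tape t0] in simp)
    have "rd ((counters s 0 1 m) 2) \<in> nonblank" using rd[of 1] 2 by simp
    from ev_Loop[OF this b e] show ?thesis using 2 by simp
  next
    case 3
    have l: "ev (Lf 2 ;; Test 2 nonblank (Lf 2 ;; Rt 3) (Rt 0)) (counters s 0 j m) ([] @ [] @ []) (counters s 0 i (Suc m))"
      using counters_moves(3)[of "Suc i" s 0 m] counters_moves(3)[of i s 0 m] counters_moves(4)[of m s 0 i]
        rd[of "Suc i"] less.prems 3
      by (intro ev_Seq[where s' = "counters s 0 (Suc i) m"] ev_Test_True ev_Seq[where s' = "counters s 0 i m"]) auto
    have "ev (Loop 2 nonblank (Lf 2 ;; Test 2 nonblank (Lf 2 ;; Rt 3) (Rt 0))) (counters s 0 i (Suc m)) []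
      (counters s (i mod 2) 0 (Suc m + i div 2))"
      by (rule less.IH) (use 3 less.prems in auto)
    from ev_Loop[OF _ l this] show ?thesis using rd[of j] 3 by auto
  qed
qed

lemma ev_write_binary:
  "n < length tape \<Longrightarrow> 1 < length tape \<Longrightarrow>
    ev write_binary (counters s 0 n 0) (map bool_sym (binary n)) (counters s 0 0 0)"
proof (induction n rule: less_induct)
  case (less n)
  have t0: "0 < length tape" using less.prems by linarith
  have rd2: "rd ((counters s i n m) 2) \<in> nonblank \<longleftrightarrow> n \<noteq> 0" for i m
    using rd_ctr[OF marked_tape, of n] less.prems by simp
  show ?case
  proof (cases "n = 0")
    case True
    then show ?thesis using ev_Loop_exit[where S = nonblank, of "counters s 0 0 0" 2] rd2[of 0 0]
      unfolding write_binary_def by (simp add: binary.simps)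
  next
    case False
    have 1: "ev (Loop 2 nonblank (Lf 2 ;; Test 2 nonblank (Lf 2 ;; Rt 3) (Rt 0))) (counters s 0 n 0) []
        (counters s (n mod 2) 0 (n div 2))"
      using ev_halve[of n 0 s] less.prems by simp
    have 2: "ev (Test 0 nonblank (Out One ;; Lf 0) (Out Zero)) (counters s (n mod 2) 0 (n div 2)) [bool_sym (odd n)]
        (counters s 0 0 (n div 2))"
    proof (cases "odd n")
      case True
      then have m: "n mod 2 = 1" and b: "bool_sym (odd n) = One" by (simp_all add: odd_iff_mod_2_eq_one bool_sym_def)
      have r: "rd ((counters s 1 0 (n div 2)) 0) \<in> nonblank"
        using rd_ctr[OF marked_tape, of 1] less.prems by simp
      have e: "ev (Out One ;; Lf 0) (counters s 1 0 (n div 2)) [One] (counters s 0 0 (n div 2))"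
        using ev_Seq[OF ev_Out counters_moves(2)[OF t0, of s 0 "n div 2"]] by simp
      show ?thesis unfolding m b by (rule ev_Test_True) (rule r, rule e)
    next
      case False
      then have m: "n mod 2 = 0" and b: "bool_sym (odd n) = Zero" by (simp_all add: even_iff_mod_2_eq_zero bool_sym_def)
      have r: "rd ((counters s 0 0 (n div 2)) 0) \<notin> nonblank"
        using rd_ctr[OF marked_tape t0] by simp
      show ?thesis unfolding m b by (rule ev_Test_False) (rule r, rule ev_Out)
    qed
    have 3: "ev (Loop 3 nonblank (Lf 3 ;; Rt 2)) (counters s 0 0 (n div 2)) [] (counters s 0 (n div 2) 0)"
      using ev_transfer[OF marked_tape, of 3 2 "n div 2" 0 "s(0 := ctr tape 0)"] less.prems by (simp add: fun_upd_twist)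
    have "ev write_binary (counters s 0 (n div 2) 0) (map bool_sym (binary (n div 2))) (counters s 0 0 0)"
      by (rule less.IH) (use False less.prems in auto)
    from ev_Loop[OF _ ev_Seq[OF 1 ev_Seq[OF 2 3]] this[unfolded write_binary_def]] show ?thesis
      using rd2[of 0 0] False unfolding write_binary_def by (simp add: binary.simps[of n])
  qed
qed

text \<open>Every variable advances head 2 by one, and the separate \<open>Rt 2\<close> counts the
  judge. Head 0, rewound before, then serves as the remainder flag of
  \<open>write_binary\<close>.\<close>

definition write_num_cops :: cmd where
  "write_num_cops = Out Open ;; over_vars 0 (Rt 2) (Rt 2) ;; rewind 0 ;; Rt 2 ;; write_binary ;; Out Close"

lemma length_concat_enc_entry: "length xs \<le> length (concat (map enc_entry xs))"
  by (induction xs) (auto simp: enc_entry_bits)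

lemma emits_write_num_cops:
  assumes s: "s 0 = ctr tape 0" "s 2 = ctr tape 0" "s 3 = ctr tape 0"
  shows "emits write_num_cops s (enc_nat (length (xvars I) + length (yvars I) + 1))"
proof -
  let ?n = "length (xvars I) + length (yvars I)"
  have n: "Suc ?n < length tape"
    using length_concat_enc_entry[of "xvars I"] length_concat_enc_entry[of "yvars I"]
    by (simp add: tape_eq vars_part_def)
  have s0: "s = counters s 0 0 0" using s by (simp add: fun_upd_idem)
  define \<sigma> where "\<sigma> i = s(2 := ctr tape i)" for i
  have step: "ev (Rt 2) ((\<sigma> i)(0 := z)) [] ((\<sigma> (Suc i))(0 := z))" if "i < length tape" for i z
    using ev_Rt_ctr[OF that, of 2 "s(0 := z)"] by (simp add: \<sigma>_def fun_upd_twist)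
  have 1: "ev (over_vars 0 (Rt 2) (Rt 2)) ((\<sigma> 0)(0 := ([], tape))) (concat (map (\<lambda>_. []) [0..<length (xvars I)]) @
      concat (map (\<lambda>_. []) [0..<length (yvars I)])) ((\<sigma> ?n)(0 := (rev vars_part, Close # after_vars)))"
    by (rule ev_over_vars) (use step n in auto)
  have 2: "ev (rewind 0) ((\<sigma> ?n)(0 := (rev vars_part, Close # after_vars))) [] ((\<sigma> ?n)(0 := ([], tape)))"
    by (rule ev_rewind[OF marked_tape]) (simp add: tape_eq)
  have 3: "ev (Rt 2) ((\<sigma> ?n)(0 := ([], tape))) [] ((\<sigma> (Suc ?n))(0 := ([], tape)))"
    by (rule step) (use n in simp)
  have e: "(\<sigma> i)(0 := ([], tape)) = counters s 0 i 0" for i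
    using s by (simp add: \<sigma>_def ctr_0 fun_upd_twist fun_upd_idem)
  have 4: "ev write_binary (counters s 0 (Suc ?n) 0) (map bool_sym (binary (Suc ?n))) (counters s 0 0 0)"
    by (rule ev_write_binary) (use n in simp_all)
  show ?thesis
    using ev_Seq[OF ev_Out ev_Seq[OF 1[unfolded e] ev_Seq[OF 2[unfolded e] ev_Seq[OF 3[unfolded e] ev_Seq[OF 4 ev_Out]]]]]
    unfolding write_num_cops_def enc_nat_bits s0[symmetric] by (simp add: concat_map_Nil)
qed

end

text \<open>\<open>True\<close> is a dummy that the templates applied to \<open>entry\<close>
  ignore. The edges that depend on the value, those of \<open>own_unprot\<close> and
  \<open>lc_unprot\<close>, are written with \<open>write_lit\<close> instead.\<close>

abbreviation "entry h \<equiv> (h :: nat, True)"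

definition write_list :: "cmd \<Rightarrow> cmd" where
  "write_list c = Out Open ;; c ;; Out Close"

definition vertices_cmd :: cmd where
  "vertices_cmd = write_verts spot_verts ;;
     write_for_vars 0 (write_verts (x_verts (entry 0))) (write_verts (y_verts (entry 0))) ;;
     write_for_clauses 0 (write_verts [Clause 0]) Skip"

definition prot_cmd :: cmd where
  "prot_cmd = write_edges spot_prot ;;
     write_for_vars 0
       (write_edges (x_prot (entry 0)) ;;
        write_for_vars 1 (write_edges (xv_prot (entry 0) (entry 1))) (write_edges (xv_prot (entry 0) (entry 1))) ;;
        write_for_clauses 1 (write_edges (xc_prot (entry 0) 0)) Skip)
       (write_edges (y_prot (entry 0)) ;;
        write_for_vars 1 (write_edges (yv_prot (entry 0) (entry 1))) (write_edges (yv_prot (entry 0) (entry 1))) ;;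
        write_for_clauses 1 (write_edges (yc_prot (entry 0) 0)) Skip) ;;
     write_for_clauses 0 (write_edges (c_prot 0)) Skip"

definition own_cmd :: cmd where
  "own_cmd = write_pair (write_vert (Var Haven 0 True)) (write_lit 0)"

definition unprot_cmd :: cmd where
  "unprot_cmd = write_edges spot_unprot ;;
     write_for_vars 0
       (write_edges (x_unprot (entry 0)) ;; own_cmd)
       (write_edges (y_unprot (entry 0)) ;; own_cmd ;;
        write_for_clauses 1 (write_edges (yc_unprot (entry 0) 0)) Skip) ;;
     write_for_clauses 0 (write_edges (c_unprot 0)) (write_pair (write_vert (Clause 0)) (write_lit 0))"

definition reduction_cmd :: cmd where
  "reduction_cmd = Out Open ;; write_list vertices_cmd ;; write_list prot_cmd ;; write_list unprot_cmd ;;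
     write_num_cops ;; Out Close"

section \<open>The program emits the encoding of the reduction\<close>

lemma heads_below_block: "heads_below k (block cs) \<longleftrightarrow> (\<forall>c\<in>set cs. heads_below k c)"
  by (induction cs) auto

lemma heads_below_outs: "heads_below k (outs u)"
  by (auto simp: outs_def heads_below_block)

lemma heads_below_reduction_cmd: "heads_below 4 reduction_cmd"
  by (simp add: reduction_cmd_def write_list_def vertices_cmd_def prot_cmd_def unprot_cmd_def own_cmd_def
      write_num_cops_def write_binary_def write_for_vars_def write_for_clauses_def over_vars_def skip_entry_def
      rewind_def write_verts_def write_edges_def write_pair_def write_var_def write_lit_def write_clause_def
      copy_name_def return_name_def retreat_def heads_below_block heads_below_outs
      spot_verts_def spot_prot_def spot_unprot_def c_prot_def c_unprot_def star_def)

lemma emits_Seq: "emits c s u \<Longrightarrow> emits d s v \<Longrightarrow> emits (c ;; d) s (u @ v)"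
  by (rule ev_Seq)

lemma concat_map_concat: "concat (map e (concat xss)) = concat (map (\<lambda>xs. concat (map e xs)) xss)"
  by (induction xss) simp_all

context
  fixes I :: abf
begin

definition start :: heads where
  "start = (\<lambda>_. ([], tape I))"

lemma start_simps [simp]: "start h = ctr (tape I) 0"
  by (simp add: start_def ctr_0)

lemma clause_bound: "j < length (formula I) \<Longrightarrow> j < length (tape I)"
  using length_concat_enc_list[of "formula I" enc_entry] by (simp add: tape_eq after_vars_def)

lemma concat_for_vars: "concat (map e (for_vars I f g)) = for_vars I (\<lambda>p. concat (map e (f p))) (\<lambda>p. concat (map e (g p)))"
  by (simp add: for_vars_def concat_map_concat comp_def)

lemma concat_for_clauses:
  "concat (map e (for_clauses I f g)) = for_clauses I (\<lambda>j. concat (map e (f j))) (\<lambda>l j. concat (map e (g l j)))"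
  by (simp add: for_clauses_def concat_map_concat comp_def)

abbreviation "enc_verts xs \<equiv> concat (map (\<lambda>x. enc_vert x) xs)"
abbreviation "enc_edges es \<equiv> concat (map enc_edge es)"

abbreviation "at1 l p r \<equiv> start(0 := (l, enc_entry p @ r))"
abbreviation "at2 l p r l' q r' \<equiv> start(0 := (l, enc_entry p @ r), 1 := (l', enc_entry q @ r'))"

lemmas fits_simps = star_def ctr_0[symmetric] marked_tape clause_bound

lemma emits_Skip: "emits Skip s (concat (map e []))"
  by (simp add: ev_Skip)

lemma emits_vertices: "emits vertices_cmd start (enc_verts (vert_list I))"
proof -
  have 1: "emits (write_verts spot_verts) start (enc_verts spot_verts)"
    by (rule emits_write_verts[where t = "[]" and e = "\<lambda>_. (0, True)" and j = 0]) (simp_all add: spot_verts_def)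
  have x: "emits (write_verts (x_verts (entry 0))) (at1 l p r) (enc_verts (x_verts p))" for l p r
    by (rule emits_write_verts[where t = "[]" and e = "\<lambda>_. p" and j = 0]) (cases p; simp)+
  have y: "emits (write_verts (y_verts (entry 0))) (at1 l p r) (enc_verts (y_verts p))" for l p r
    by (rule emits_write_verts[where t = "[]" and e = "\<lambda>_. p" and j = 0]) (cases p; simp)+
  have c: "emits (write_verts [Clause 0]) (start(2 := ctr (tape I) j, 0 := (l, r))) (enc_verts [Clause j])"
    if "j < length (formula I)" for j l r
    by (rule emits_write_verts[where t = "tape I" and e = "\<lambda>_. (0, True)" and j = j]) (use that in \<open>simp_all add: fits_simps\<close>)
  show ?thesis
    unfolding vertices_cmd_def vert_list_def map_append concat_append concat_for_vars concat_for_clauses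
    by (intro emits_Seq 1 emits_for_vars emits_for_clauses x y c emits_Skip) (simp_all add: ctr_0)
qed

lemma emits_prot: "emits prot_cmd start (enc_edges (prot_list I))"
proof -
  have 1: "emits (write_edges spot_prot) start (enc_edges spot_prot)"
    by (rule emits_write_edges[where t = "[]" and e = "\<lambda>_. (0, True)" and j = 0]) (simp_all add: spot_prot_def star_def)
  have x: "emits (write_edges (x_prot (entry 0))) (at1 l p r) (enc_edges (x_prot p))" for l p r
    by (rule emits_write_edges[where t = "[]" and e = "\<lambda>_. p" and j = 0]) (cases p; simp add: star_def)+
  have y: "emits (write_edges (y_prot (entry 0))) (at1 l p r) (enc_edges (y_prot p))" for l p r
    by (rule emits_write_edges[where t = "[]" and e = "\<lambda>_. p" and j = 0]) (cases p; simp add: star_def)+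
  have xv: "emits (write_edges (xv_prot (entry 0) (entry 1))) (at2 l p r l' q r') (enc_edges (xv_prot p q))" for l p r l' q r'
    by (rule emits_write_edges[where t = "[]" and e = "\<lambda>h. if h = 0 then p else q" and j = 0]) (cases p; cases q; simp)+
  have yv: "emits (write_edges (yv_prot (entry 0) (entry 1))) (at2 l p r l' q r') (enc_edges (yv_prot p q))" for l p r l' q r'
    by (rule emits_write_edges[where t = "[]" and e = "\<lambda>h. if h = 0 then p else q" and j = 0]) (cases p; cases q; simp)+
  have xc: "emits (write_edges (xc_prot (entry 0) 0)) ((at1 l p r)(2 := ctr (tape I) j, 1 := z)) (enc_edges (xc_prot p j))"
    if "j < length (formula I)" for l p r j z
    by (rule emits_write_edges[where t = "tape I" and e = "\<lambda>_. p" and j = j]) (use that in \<open>cases p; simp add: fits_simps\<close>)+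
  have yc: "emits (write_edges (yc_prot (entry 0) 0)) ((at1 l p r)(2 := ctr (tape I) j, 1 := z)) (enc_edges (yc_prot p j))"
    if "j < length (formula I)" for l p r j z
    by (rule emits_write_edges[where t = "tape I" and e = "\<lambda>_. p" and j = j]) (use that in \<open>cases p; simp add: fits_simps\<close>)+
  have c: "emits (write_edges (c_prot 0)) (start(2 := ctr (tape I) j, 0 := (l, r))) (enc_edges (c_prot j))"
    if "j < length (formula I)" for j l r
    by (rule emits_write_edges[where t = "tape I" and e = "\<lambda>_. (0, True)" and j = j])
      (use that in \<open>simp_all add: fits_simps c_prot_def\<close>)
  show ?thesis
    unfolding prot_cmd_def prot_list_def map_append concat_append concat_for_vars concat_for_clauses
    by (intro emits_Seq 1 emits_for_vars emits_for_clauses x y xv yv xc yc c emits_Skip) (simp_all add: ctr_0)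
qed

lemma emits_own: "emits own_cmd (at1 l p r) (enc_edges (own_unprot p))"
proof -
  obtain v b where p: "p = (v, b)" by (cases p)
  show ?thesis
    unfolding own_cmd_def p using emits_write_pair[OF emits_write_vert[where t = "[]" and e = "\<lambda>_. (v, b)" and j = 0, of _ "Var Haven 0 True"]
        emits_write_lit[where p = "(v, b)"]] by simp
qed

lemma emits_unprot: "emits unprot_cmd start (enc_edges (unprot_list I))"
proof -
  have 1: "emits (write_edges spot_unprot) start (enc_edges spot_unprot)"
    by (rule emits_write_edges[where t = "[]" and e = "\<lambda>_. (0, True)" and j = 0]) (simp_all add: spot_unprot_def star_def)
  have x: "emits (write_edges (x_unprot (entry 0))) (at1 l p r) (enc_edges (x_unprot p))" for l p r
    by (rule emits_write_edges[where t = "[]" and e = "\<lambda>_. p" and j = 0]) (cases p; simp add: star_def)+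
  have y: "emits (write_edges (y_unprot (entry 0))) (at1 l p r) (enc_edges (y_unprot p))" for l p r
    by (rule emits_write_edges[where t = "[]" and e = "\<lambda>_. p" and j = 0]) (cases p; simp add: star_def)+
  have yc: "emits (write_edges (yc_unprot (entry 0) 0)) ((at1 l p r)(2 := ctr (tape I) j, 1 := z)) (enc_edges (yc_unprot p j))"
    if "j < length (formula I)" for l p r j z
    by (rule emits_write_edges[where t = "tape I" and e = "\<lambda>_. p" and j = j]) (use that in \<open>cases p; simp add: fits_simps\<close>)+
  have c: "emits (write_edges (c_unprot 0)) (start(2 := ctr (tape I) j, 0 := (l, r))) (enc_edges (c_unprot j))"
    if "j < length (formula I)" for j l r
    by (rule emits_write_edges[where t = "tape I" and e = "\<lambda>_. (0, True)" and j = j])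
      (use that in \<open>simp_all add: fits_simps c_unprot_def\<close>)
  have lc: "emits (write_pair (write_vert (Clause 0)) (write_lit 0)) (start(2 := ctr (tape I) j, 0 := (l, enc_entry p @ r)))
      (enc_edges (lc_unprot p j))" if "j < length (formula I)" for j l p r
  proof -
    obtain v b where p: "p = (v, b)" by (cases p)
    show ?thesis
      unfolding p using that emits_write_pair[OF emits_write_vert[where t = "tape I" and e = "\<lambda>_. (v, b)" and j = j, of _ "Clause 0"]
        emits_write_lit[where p = "(v, b)"]] by (simp add: fits_simps)
  qed
  show ?thesis
    unfolding unprot_cmd_def unprot_list_def map_append concat_append concat_for_vars concat_for_clauses
    by (intro emits_Seq 1 emits_for_vars emits_for_clauses x y emits_own yc c lc emits_Skip) (simp_all add: ctr_0)
qed

lemma enc_reduction: "enc_lcrp (reduction I) = Open # (Open # enc_verts (vert_list I) @ [Close]) @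
    (Open # enc_edges (prot_list I) @ [Close]) @ (Open # enc_edges (unprot_list I) @ [Close]) @
    enc_nat (length (xvars I) + length (yvars I) + 1) @ [Close]"
  by (simp add: enc_lcrp_def enc_list_def reduction_def enc_edge_def[abs_def] comp_def)

lemma emits_write_list: "emits c s u \<Longrightarrow> emits (write_list c) s (Open # u @ [Close])"
  unfolding write_list_def by (rule ev_SeqI[OF ev_Out ev_Seq[OF _ ev_Out]]) simp_all

lemma emits_reduction: "emits reduction_cmd start (enc_lcrp (reduction I))"
  unfolding reduction_cmd_def enc_reduction
  using ev_Seq[OF ev_Out ev_Seq[OF emits_write_list[OF emits_vertices] ev_Seq[OF emits_write_list[OF emits_prot]
        ev_Seq[OF emits_write_list[OF emits_unprot] ev_Seq[OF emits_write_num_cops ev_Out]]]]] by simp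

end

lemma poly_time_reduction: "poly_time_computable enc_abf enc_lcrp D reduction"
proof (rule poly_time_transducer[OF heads_below_reduction_cmd])
  fix I :: abf
  show "Blank \<notin> set (enc_abf I) \<and> (\<exists>s. ev reduction_cmd (\<lambda>_. ([], Blank # enc_abf I)) (enc_lcrp (reduction I)) s)"
    using Blank_enc_abf emits_reduction[of I] unfolding start_def tape_def by blast
qed simp

theorem theorem3p1:
  "\<exists>f :: abf \<Rightarrow> lcrp.
     poly_time_computable enc_abf enc_lcrp {I. abf_instance I} f \<and>
     (\<forall>I. abf_instance I \<longrightarrow>
        lcrp_instance (f I) \<and> (player_A_wins I \<longleftrightarrow> cops_win (f I)))"
  using poly_time_reduction abf_game.lcrp_instance_reduction abf_game.reduction_correct
  by (intro exI[of _ reduction]) (simp add: abf_game_def)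

end
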